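(* Consider the linear regression model $Y=X\beta+\epsilon$ of the context, where the error process $(\epsilon_i)_{i\in\mathbb{Z}}$ is strictly stationary, centered, square integrable, independent of the design, with $\mathcal{F}_{-\infty}$ trivial and $\epsilon_0$ $\mathcal{F}_\infty$-measurable. Assume Hannan's condition $$\sum_{i\in\mathbb{Z}}\|P_0(\epsilon_i)\|_{\mathbb{L}^2}<+\infty .$$ Assume that the design satisfies, almost surely: (i) for all $j\in\{1,\dots,p\}$, $\lim_{n\to\infty}d_j(n)=\infty$; (ii) for all $j\in\{1,\dots,p\}$, $\lim_{n\to\infty}\frac{\sup_{1\le i\le n}|x_{i,j}|}{d_j(n)}=0$; (iii) for all $j,l\in\{1,\dots,p\}$ and all integers $k\ge 0$, the limit $\rho_{j,l}(k)=\lim_{n\to\infty}\sum_{m=1}^{n-k}\frac{x_{m,j}x_{m+k,l}}{d_j(n)d_l(n)}$ exists; (iv) the matrix $R(0)=[\rho_{j,l}(0)]_{1\le j,l\le p}$ is positive definite. Let $(h_n)$ be a sequence of positive reals such that $h_n\to\infty$, $h_n/n\to0$, and $$h_n\,\mathbb{E}\left(|\epsilon_0|^2\left(1\wedge\frac{h_n}{n}|\epsilon_0|^2\right)\right)\xrightarrow[n\to\infty]{}0 .$$ Let $C_n=[c_{n,(j,l)}]_{1\le j,l\le p}$ be the estimator defined in the context (built with the bandwidth $h_n$ and a kernel $K$ as there), and let $C=F^{-1}GF^{-1}=[c_{j,l}]_{1\le j,l\le p}$. Then for all $j,l\in\{1,\dots,p\}$, $$\mathbb{E}\left(\left|c_{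n,(j,l)}-c_{j,l}\right|\,\Big|\,X\right)\xrightarrow[n\to\infty]{}0\quad\text{a.s.}$$
   Context: Model. All random variables live on a probability space $(\Omega,\mathcal{F},\mathbb{P})$. Fix $p\ge1$. The design is a (random or deterministic) array $(x_{i,j})_{i\ge1,\,1\le j\le p}$ of real numbers; for each $n$, $X$ is the $n\times p$ matrix $[x_{i,j}]_{1\le i\le n,1\le j\le p}$. One observes $Y=X\beta+\epsilon\in\mathbb{R}^n$ with $\beta\in\mathbb{R}^p$ an unknown deterministic vector and $\epsilon=(\epsilon_1,\dots,\epsilon_n)^t$. The process $(\epsilon_i)_{i\in\mathbb{Z}}$ is independent of the design. Conditioning on $X$ means conditioning on the $\sigma$-algebra generated by the whole design array. The superscript $t$ denotes transpose. Errors. $\epsilon_i=\epsilon_0\circ\mathbb{T}^i$ for all $i\in\mathbb{Z}$, where $\mathbb{T}:\Omega\to\Omega$ is a bijective bimeasurable transformation preserving $\mathbb{P}$; $\mathbb{E}(\epsilon_0)=0$, $\mathbb{E}(\epsilon_0^2)<\infty$. $\mathcal{F}_0\subseteq\mathcal{F}$ is a sub-$\sigma$-algebra with $\mathcal{F}_0\subseteq\mathbb{T}^{-1}(\mathcal{F}_0)$, $\mathcal{F}_i=\mathbb{T}^{-i}(\mathcal{F}_0)$, $\mathcal{F}_{-\infty}=\bigcap_{i\in\mathbb{Z}}\mathcal{F}_i$, $\mathcal{F}_\infty=\sigma(\bigcup_{i\in\mathbb{Z}}\mathcal{F}_i)$. For $Z\in\mathbb{L}^2(\Omega)$, $P_j(Z)=\mathbb{E}(Z|\mathcal{F}_j)-\mathbb{E}(Z|\mathcal{F}_{j-1})$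 and $\|Z\|_{\mathbb{L}^2}=(\mathbb{E}(Z^2))^{1/2}$. The autocovariance is $\gamma(k)=\mathbb{E}(\epsilon_0\epsilon_k)$ (absolutely summable under Hannan's condition) and the spectral density is $f(\lambda)=\frac1{2\pi}\sum_{k\in\mathbb{Z}}\gamma(k)e^{ik\lambda}$, $\lambda\in[-\pi,\pi]$. Design quantities. $d_j(n)=\left(\sum_{i=1}^nx_{i,j}^2\right)^{1/2}$ and $D(n)=\mathrm{diag}(d_1(n),\dots,d_p(n))$. For $k\ge0$, $R(k)=[\rho_{j,l}(k)]_{1\le j,l\le p}$, and $F_X$ is the associated spectral measure, i.e. the Hermitian nonnegative-definite $p\times p$ matrix-valued measure on $[-\pi,\pi]$ such that $R(k)=\int_{-\pi}^{\pi}e^{ik\lambda}F_X(d\lambda)$ for all $k\ge 0$. Set $$F=\frac1{2\pi}\int_{-\pi}^{\pi}F_X(d\lambda),\qquad G=\frac1{2\pi}\int_{-\pi}^{\pi}f(\lambda)\,F_X(d\lambda).$$ Estimator. $\hat\beta=(X^tX)^{-1}X^tY$ is the least square estimator (under the positive definiteness of $R(0)$, $X^tX$ is a.s. invertible for $n$ large). The residuals are $\hat\epsilon_j=Y_j-(x_j)^t\hat\beta$, where $(x_j)^t$ is the $j$-th row of $X$, and $\hat\gamma_k^*=\frac1n\sum_{j=1}^{n-|k|}\hat\epsilon_j\hat\epsilon_{j+|k|}$ for $0\le|k|\le n-1$. The kernel $K:\mathbb{R}\to\mathbb{R}$ is nonnegative, symmetric, with $K(0)=1$, has compact support, and its Fourier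 transform is integrable. Set $$\widehat\Gamma^*_{n,h_n}=\left[K\left(\frac{j-l}{h_n}\right)\hat\gamma^*_{j-l}\right]_{1\le j,l\le n},\qquad C_n=D(n)(X^tX)^{-1}X^t\,\widehat\Gamma^*_{n,h_n}\,X(X^tX)^{-1}D(n).$$
   Formalization: The kernel K is additionally assumed continuous; without this the claim fails, e.g. for K the indicator of {0}, which is nonnegative, symmetric, compactly supported, with K(0)=1 and zero Fourier transform. *)

theory Defs
  imports "HOL-Probability.Probability"
begin

section \<open>Stationary errors\<close>

text \<open>The iterate \<open>T\<^sup>i\<close>, \<open>i \<in> \<int>\<close>, of a bijection \<open>T\<close> of the sample space.\<close>

definition iterate_int :: "'a measure \<Rightarrow> ('a \<Rightarrow> 'a) \<Rightarrow> int \<Rightarrow> 'a \<Rightarrow> 'a" where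
  "iterate_int M T i =
     (if 0 \<le> i then T ^^ nat i else the_inv_into (space M) T ^^ nat (- i))"

definition error :: "'a measure \<Rightarrow> ('a \<Rightarrow> 'a) \<Rightarrow> ('a \<Rightarrow> real) \<Rightarrow> int \<Rightarrow> 'a \<Rightarrow> real" where
  "error M T \<epsilon>0 i = (\<lambda>\<omega>. \<epsilon>0 (iterate_int M T i \<omega>))"

text \<open>\<open>\<F>\<^sub>i = T\<^sup>-\<^sup>i(\<F>\<^sub>0)\<close>, the preimage \<open>\<sigma>\<close>-algebra of \<open>\<F>\<^sub>0\<close> under \<open>T\<^sup>i\<close>. As in the library's theory
  of conditional expectation, \<open>\<sigma>\<close>-algebras are represented by measures of which only the space and
  the measurable sets matter.\<close>

definition filt :: "'a measure \<Rightarrow> ('a \<Rightarrow> 'a) \<Rightarrow> 'a measure \<Rightarrow> int \<Rightarrow> 'a measure" where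
  "filt M T F0 i = vimage_algebra (space M) (iterate_int M T i) F0"

definition filt_infty :: "'a measure \<Rightarrow> ('a \<Rightarrow> 'a) \<Rightarrow> 'a measure \<Rightarrow> 'a measure" where
  "filt_infty M T F0 = sigma (space M) (\<Union>i. sets (filt M T F0 i))"

definition filt_minus_infty_sets :: "'a measure \<Rightarrow> ('a \<Rightarrow> 'a) \<Rightarrow> 'a measure \<Rightarrow> 'a set set" where
  "filt_minus_infty_sets M T F0 = (\<Inter>i. sets (filt M T F0 i))"

definition proj_op ::
  "'a measure \<Rightarrow> ('a \<Rightarrow> 'a) \<Rightarrow> 'a measure \<Rightarrow> int \<Rightarrow> ('a \<Rightarrow> real) \<Rightarrow> 'a \<Rightarrow> real" where
  "proj_op M T F0 j Z = (\<lambda>\<omega>.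
     real_cond_exp M (filt M T F0 j) Z \<omega> - real_cond_exp M (filt M T F0 (j - 1)) Z \<omega>)"

definition L2_norm :: "'a measure \<Rightarrow> ('a \<Rightarrow> real) \<Rightarrow> real" where
  "L2_norm M Z = sqrt (\<integral>\<omega>. (Z \<omega>)\<^sup>2 \<partial>M)"

definition autocov :: "'a measure \<Rightarrow> (int \<Rightarrow> 'a \<Rightarrow> real) \<Rightarrow> int \<Rightarrow> real" where
  "autocov M \<epsilon> k = (\<integral>\<omega>. \<epsilon> 0 \<omega> * \<epsilon> k \<omega> \<partial>M)"

text \<open>The spectral density, as a complex number (its value is real since \<open>\<gamma>\<close> is even).\<close>

definition spectral_density :: "(int \<Rightarrow> real) \<Rightarrow> real \<Rightarrow> complex" where
  "spectral_density \<gamma> t =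
     (1 / (2 * pi)) *\<^sub>R (\<Sum>\<^sub>\<infinity>k\<in>UNIV. complex_of_real (\<gamma> k) * cis (of_int k * t))"

text \<open>The \<open>\<sigma>\<close>-algebra generated by the family \<open>(Z\<^sub>i)\<close>, \<open>i \<in> I\<close>.\<close>

definition generated_algebra ::
  "'a measure \<Rightarrow> 'i set \<Rightarrow> ('i \<Rightarrow> 'a \<Rightarrow> 'b::topological_space) \<Rightarrow> 'a measure" where
  "generated_algebra M I Z =
     vimage_algebra (space M) (\<lambda>\<omega>. \<lambda>i\<in>I. Z i \<omega>) (\<Pi>\<^sub>M i\<in>I. borel)"


section \<open>Matrix-valued spectral measures\<close>

text \<open>Integral of a complex function against a finite signed measure \<open>\<nu>\<close> via its Jordan
  decomposition, where \<open>\<nu>\<^sup>+(A) = sup {\<nu>(B) | B \<subseteq> A}\<close> and \<open>\<nu>\<^sup>- = (-\<nu>)\<^sup>+\<close>; \<open>ennreal\<close> truncates negative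
  values to 0, which does not change the supremum because \<open>B = {}\<close> is allowed.\<close>

definition positive_variation :: "'b measure \<Rightarrow> ('b set \<Rightarrow> real) \<Rightarrow> 'b measure" where
  "positive_variation S \<nu> =
     measure_of (space S) (sets S) (\<lambda>A. SUP B\<in>{B \<in> sets S. B \<subseteq> A}. ennreal (\<nu> B))"

definition signed_integral :: "'b measure \<Rightarrow> ('b set \<Rightarrow> real) \<Rightarrow> ('b \<Rightarrow> complex) \<Rightarrow> complex" where
  "signed_integral S \<nu> g =
     (\<integral>t. g t \<partial>positive_variation S \<nu>) - (\<integral>t. g t \<partial>positive_variation S (\<lambda>A. - \<nu> A))"

definition complex_measure_integral ::
  "'b measure \<Rightarrow> ('b set \<Rightarrow> complex) \<Rightarrow> ('b \<Rightarrow> complex) \<Rightarrow> complex" where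
  "complex_measure_integral S \<nu> g =
     signed_integral S (\<lambda>A. Re (\<nu> A)) g + \<i> * signed_integral S (\<lambda>A. Im (\<nu> A)) g"

definition matrix_integral ::
  "'b measure \<Rightarrow> ('b set \<Rightarrow> complex^'p^'p) \<Rightarrow> ('b \<Rightarrow> complex) \<Rightarrow> complex^'p^'p" where
  "matrix_integral S N g = (\<chi> j l. complex_measure_integral S (\<lambda>A. N A $ j $ l) g)"

definition hermitian_nonneg :: "complex^'p^'p \<Rightarrow> bool" where
  "hermitian_nonneg A \<longleftrightarrow>
     (\<forall>j l. A $ l $ j = cnj (A $ j $ l)) \<and>
     (\<forall>v :: complex^'p. 0 \<le> Re (\<Sum>j\<in>UNIV. \<Sum>l\<in>UNIV. cnj (v $ j) * A $ j $ l * v $ l))"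

definition hermitian_matrix_measure ::
  "'b measure \<Rightarrow> ('b set \<Rightarrow> complex^'p^'p) \<Rightarrow> bool" where
  "hermitian_matrix_measure S N \<longleftrightarrow>
     (\<forall>A :: nat \<Rightarrow> 'b set. range A \<subseteq> sets S \<longrightarrow> disjoint_family A \<longrightarrow>
        (\<lambda>i. N (A i)) sums N (\<Union>i. A i)) \<and>
     (\<forall>A\<in>sets S. hermitian_nonneg (N A))"

definition freq_space :: "real measure" where
  "freq_space = restrict_space borel {-pi..pi}"

definition is_spectral_measure ::
  "(nat \<Rightarrow> real^'p^'p) \<Rightarrow> (real set \<Rightarrow> complex^'p^'p) \<Rightarrow> bool" where
  "is_spectral_measure R N \<longleftrightarrow>
     hermitian_matrix_measure freq_space N \<and>
     (\<forall>k. (\<chi> j l. complex_of_real (R k $ j $ l)) =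
            matrix_integral freq_space N (\<lambda>t. cis (real k * t)))"

definition F_mat :: "(real set \<Rightarrow> complex^'p^'p) \<Rightarrow> complex^'p^'p" where
  "F_mat N = (1 / (2 * pi)) *\<^sub>R matrix_integral freq_space N (\<lambda>t. 1)"

definition G_mat :: "(real \<Rightarrow> complex) \<Rightarrow> (real set \<Rightarrow> complex^'p^'p) \<Rightarrow> complex^'p^'p" where
  "G_mat f N = (1 / (2 * pi)) *\<^sub>R matrix_integral freq_space N f"

definition C_mat :: "(real \<Rightarrow> complex) \<Rightarrow> (real set \<Rightarrow> complex^'p^'p) \<Rightarrow> complex^'p^'p" where
  "C_mat f N = matrix_inv (F_mat N) ** G_mat f N ** matrix_inv (F_mat N)"


section \<open>Design and estimators\<close>

text \<open>Everything here is pathwise: a design is the sequence \<open>x\<close> of its rows \<open>x 1, x 2, \<dots>\<close>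
  (\<open>x 0\<close> is never used), and \<open>X\<close> is the matrix with rows \<open>x 1, \<dots>, x n\<close>. The products \<open>X\<^sup>tX\<close>,
  \<open>X\<^sup>tY\<close> and \<open>X\<^sup>t\<Gamma>X\<close> are written out because the number \<open>n\<close> of rows varies.\<close>

definition d_norm :: "(nat \<Rightarrow> real^'p) \<Rightarrow> nat \<Rightarrow> 'p \<Rightarrow> real" where
  "d_norm x n j = sqrt (\<Sum>i=1..n. (x i $ j)\<^sup>2)"

definition D_mat :: "(nat \<Rightarrow> real^'p) \<Rightarrow> nat \<Rightarrow> real^'p^'p" where
  "D_mat x n = (\<chi> j l. if j = l then d_norm x n j else 0)"

definition rho_seq :: "(nat \<Rightarrow> real^'p) \<Rightarrow> nat \<Rightarrow> 'p \<Rightarrow> 'p \<Rightarrow> nat \<Rightarrow> real" where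
  "rho_seq x k j l n =
     (\<Sum>m=1..n - k. x m $ j * x (m + k) $ l / (d_norm x n j * d_norm x n l))"

definition R_mat :: "(nat \<Rightarrow> real^'p) \<Rightarrow> nat \<Rightarrow> real^'p^'p" where
  "R_mat x k = (\<chi> j l. lim (rho_seq x k j l))"

definition pos_definite :: "real^'p^'p \<Rightarrow> bool" where
  "pos_definite A \<longleftrightarrow> transpose A = A \<and> (\<forall>v. v \<noteq> 0 \<longrightarrow> 0 < v \<bullet> (A *v v))"

definition XtX :: "(nat \<Rightarrow> real^'p) \<Rightarrow> nat \<Rightarrow> real^'p^'p" where
  "XtX x n = (\<chi> j l. \<Sum>i=1..n. x i $ j * x i $ l)"

definition XtY :: "(nat \<Rightarrow> real^'p) \<Rightarrow> (nat \<Rightarrow> real) \<Rightarrow> nat \<Rightarrow> real^'p" where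
  "XtY x y n = (\<chi> j. \<Sum>i=1..n. x i $ j * y i)"

definition XtMX :: "(nat \<Rightarrow> real^'p) \<Rightarrow> (nat \<Rightarrow> nat \<Rightarrow> real) \<Rightarrow> nat \<Rightarrow> real^'p^'p" where
  "XtMX x \<Gamma> n = (\<chi> j l. \<Sum>a=1..n. \<Sum>b=1..n. x a $ j * \<Gamma> a b * x b $ l)"

definition lse :: "(nat \<Rightarrow> real^'p) \<Rightarrow> (nat \<Rightarrow> real) \<Rightarrow> nat \<Rightarrow> real^'p" where
  "lse x y n = matrix_inv (XtX x n) *v XtY x y n"

definition residual :: "(nat \<Rightarrow> real^'p) \<Rightarrow> (nat \<Rightarrow> real) \<Rightarrow> nat \<Rightarrow> nat \<Rightarrow> real" where
  "residual x y n i = y i - x i \<bullet> lse x y n"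

definition gamma_hat :: "(nat \<Rightarrow> real^'p) \<Rightarrow> (nat \<Rightarrow> real) \<Rightarrow> nat \<Rightarrow> int \<Rightarrow> real" where
  "gamma_hat x y n k =
     (\<Sum>i=1..n - nat \<bar>k\<bar>. residual x y n i * residual x y n (i + nat \<bar>k\<bar>)) / real n"

definition Gamma_hat ::
  "(real \<Rightarrow> real) \<Rightarrow> real \<Rightarrow> (nat \<Rightarrow> real^'p) \<Rightarrow> (nat \<Rightarrow> real) \<Rightarrow> nat \<Rightarrow> nat \<Rightarrow> nat \<Rightarrow> real" where
  "Gamma_hat K b x y n j l = K ((real j - real l) / b) * gamma_hat x y n (int j - int l)"

definition C_hat ::
  "(real \<Rightarrow> real) \<Rightarrow> real \<Rightarrow> (nat \<Rightarrow> real^'p) \<Rightarrow> (nat \<Rightarrow> real) \<Rightarrow> nat \<Rightarrow> real^'p^'p" where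
  "C_hat K b x y n =
     D_mat x n ** matrix_inv (XtX x n) ** XtMX x (Gamma_hat K b x y n) n
       ** matrix_inv (XtX x n) ** D_mat x n"

text \<open>Kernels. An integrable function with integrable Fourier transform is determined by that
  transform only up to a null set, while the estimator evaluates \<open>K\<close> at countably many points;
  \<open>K\<close> is taken to be the continuous representative. (With \<open>K = indicator {0}\<close>, say, the estimator
  would converge to a wrong limit.)\<close>

definition lag_kernel :: "(real \<Rightarrow> real) \<Rightarrow> bool" where
  "lag_kernel K \<longleftrightarrow>
     continuous_on UNIV K \<and> (\<forall>t. 0 \<le> K t) \<and> (\<forall>t. K (- t) = K t) \<and> K 0 = 1 \<and>
     compact (closure {t. K t \<noteq> 0}) \<and>
     integrable lborel (\<lambda>u. \<integral>t. complex_of_real (K t) * cis (- (u * t)) \<partial>lborel)"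

end

theory Submission
  imports Defs
begin

text \<open>
  By independence, the conditional expectation given the design is, for almost every fixed design,
  an expectation over the errors alone, so that it suffices to treat deterministic designs. For these,
  the entries of the normalised matrix \<open>X\<^sup>t\<Gamma>X\<close> are the quadratic forms
  \<open>1/n \<Sum>\<^sub>a\<^sub>,\<^sub>b w(a - b) r\<^sub>a r\<^sub>b\<close> in the residuals \<open>r\<close>, where
  \<open>w(k) = K(k/h) \<Sum>\<^sub>t y(t + k) z(t)\<close> for normalised columns \<open>y\<close> and \<open>z\<close> of the design.

  Writing \<open>K\<close> as a Fourier transform and using the Cauchy--Schwarz inequality at each frequency,
  one gets \<open>E|\<Sum> w(a - b) \<eta>\<^sub>a \<zeta>\<^sub>b| \<le> C n A B\<close> for all processes \<open>\<eta>\<close> and \<open>\<zeta>\<close> with spectral bounds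
  \<open>A\<close> and \<open>B\<close>. Under Hannan's condition the errors are a sum of sequences of stationary martingale
  differences whose spectral bounds are summable, so in the quadratic form they may be replaced by
  finitely many such sequences, which may moreover be taken bounded. For two of these the
  off-diagonal part of the form is a martingale transform, of size \<open>O(\<surd>(n h))\<close> because \<open>w\<close> is supported in
  a band of width \<open>O(h)\<close>, and the diagonal part obeys a law of large numbers since the tail of the
  filtration is trivial.

  Passing from errors to residuals changes the form by \<open>O(\<surd>(n h))\<close> only, and by dominated
  convergence its normalised mean tends to \<open>\<Sum>\<^sub>k \<gamma>(k) R(k)\<close>, which is a multiple of the integral of the
  spectral density against the spectral measure of the design.
\<close>

section \<open>Square integrable functions\<close>

text \<open>With second moments only, a quadratic form in the errors need not have a variance. Such
  forms are therefore estimated in L1, and squares are taken only of linear forms or of forms in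
  bounded martingale differences. The obstacle is the bandwidth: summing estimates lag by lag would
  cost a factor of order \<open>h\<close>, which tends to infinity, whereas the error must be small
  against \<open>n\<close>. Freezing one frequency of the kernel turns the factor
  \<open>K((a - b)/h)\<close> into a product of two phases, and the integrability of the Fourier
  transform pays for all frequencies at once, uniformly in \<open>h\<close>. This is why the errors
  have to be approximated in the sense of spectral bounds and not merely one variable at a time. The
  limit is first identified as the real matrix \<open>C_lim\<close>, an explicit measurable function
  of the design. The spectral measure is only given path by path, which is also the reason for the
  completed space in the final conditional expectation.\<close>

definition sq_integrable :: "'a measure \<Rightarrow> ('a \<Rightarrow> real) \<Rightarrow> bool" where
  "sq_integrable M f \<longleftrightarrow> f \<in> borel_measurable M \<and> integrable M (\<lambda>\<omega>. (f \<omega>)\<^sup>2)"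

lemma sq_integrable_measurable: "sq_integrable M f \<Longrightarrow> f \<in> borel_measurable M"
  by (simp add: sq_integrable_def)

lemma sq_integrable_integrable_square: "sq_integrable M f \<Longrightarrow> integrable M (\<lambda>\<omega>. (f \<omega>)\<^sup>2)"
  by (simp add: sq_integrable_def)

text \<open>The weight \<open>s\<close> stays free because it is later set to a quotient of two
  bounds, for which the integrated right side becomes the product of these bounds.\<close>

lemma abs_mult_le_weighted_squares:
  fixes a b s :: real
  assumes "0 < s"
  shows "\<bar>a * b\<bar> \<le> (s * a\<^sup>2 + b\<^sup>2 / s) / 2"
proof -
  have "0 \<le> (s * \<bar>a\<bar> - \<bar>b\<bar>)\<^sup>2" by simp
  also have "\<dots> = s * (s * a\<^sup>2) - s * (2 * \<bar>a * b\<bar>) + b\<^sup>2"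
    by (simp add: power2_eq_square algebra_simps abs_mult)
  finally show ?thesis using assms
    by (simp add: field_simps power2_eq_square abs_mult)
qed

lemma sq_integrable_mult_integrable:
  assumes "sq_integrable M f" "sq_integrable M g"
  shows "integrable M (\<lambda>\<omega>. f \<omega> * g \<omega>)"
proof (rule Bochner_Integration.integrable_bound)
  show "integrable M (\<lambda>\<omega>. (f \<omega>)\<^sup>2 + (g \<omega>)\<^sup>2)"
    using assms by (simp add: sq_integrable_def)
  show "(\<lambda>\<omega>. f \<omega> * g \<omega>) \<in> borel_measurable M"
    using assms by (auto simp: sq_integrable_def)
  show "AE \<omega> in M. norm (f \<omega> * g \<omega>) \<le> norm ((f \<omega>)\<^sup>2 + (g \<omega>)\<^sup>2)"
  proof (intro AE_I2)
    fix \<omega>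
    have "\<bar>f \<omega> * g \<omega>\<bar> \<le> ((f \<omega>)\<^sup>2 + (g \<omega>)\<^sup>2) / 2"
      using abs_mult_le_weighted_squares[of 1 "f \<omega>" "g \<omega>"] by simp
    also have "\<dots> \<le> (f \<omega>)\<^sup>2 + (g \<omega>)\<^sup>2" by simp
    finally show "norm (f \<omega> * g \<omega>) \<le> norm ((f \<omega>)\<^sup>2 + (g \<omega>)\<^sup>2)" by simp
  qed
qed

lemma sq_integrable_add:
  assumes "sq_integrable M f" "sq_integrable M g"
  shows "sq_integrable M (\<lambda>\<omega>. f \<omega> + g \<omega>)"
  using assms sq_integrable_mult_integrable[OF assms]
  by (auto simp: sq_integrable_def power2_sum mult.assoc)

lemma sq_integrable_cmult: "sq_integrable M f \<Longrightarrow> sq_integrable M (\<lambda>\<omega>. c * f \<omega>)"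
  by (auto simp: sq_integrable_def power_mult_distrib)

lemma sq_integrable_minus: "sq_integrable M f \<Longrightarrow> sq_integrable M (\<lambda>\<omega>. - f \<omega>)"
  by (simp add: sq_integrable_def)

lemma sq_integrable_diff:
  "sq_integrable M f \<Longrightarrow> sq_integrable M g \<Longrightarrow> sq_integrable M (\<lambda>\<omega>. f \<omega> - g \<omega>)"
  using sq_integrable_add[OF _ sq_integrable_minus] by fastforce

lemma sq_integrable_zero: "sq_integrable M (\<lambda>_. 0)"
  by (simp add: sq_integrable_def)

lemma sq_integrable_sum:
  "(\<And>i. i \<in> I \<Longrightarrow> sq_integrable M (f i)) \<Longrightarrow> sq_integrable M (\<lambda>\<omega>. \<Sum>i\<in>I. f i \<omega>)"
  by (induction I rule: infinite_finite_induct) (auto simp: sq_integrable_zero sq_integrable_add)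

lemma (in finite_measure) sq_integrable_AE_bounded:
  assumes "f \<in> borel_measurable M" "AE \<omega> in M. \<bar>f \<omega>\<bar> \<le> L"
  shows "sq_integrable M f"
  unfolding sq_integrable_def
proof
  show "integrable M (\<lambda>\<omega>. (f \<omega>)\<^sup>2)"
  proof (rule integrable_const_bound[where B = "L\<^sup>2"])
    show "AE \<omega> in M. norm ((f \<omega>)\<^sup>2) \<le> L\<^sup>2"
      using assms(2) by eventually_elim (simp add: abs_le_square_iff[symmetric])
  qed (use assms in simp)
qed fact

lemma (in finite_measure) sq_integrable_integrable:
  assumes "sq_integrable M f"
  shows "integrable M f"
  using sq_integrable_mult_integrable[OF assms, of "\<lambda>_. 1"] by (simp add: sq_integrable_def)

lemma L2_norm_nonneg: "0 \<le> L2_norm M f"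
  by (simp add: L2_norm_def)

lemma L2_norm_square: "(L2_norm M f)\<^sup>2 = (\<integral>\<omega>. (f \<omega>)\<^sup>2 \<partial>M)"
  by (simp add: L2_norm_def)

lemma L2_norm_cong_AE:
  assumes "AE \<omega> in M. f \<omega> = g \<omega>" "f \<in> borel_measurable M" "g \<in> borel_measurable M"
  shows "L2_norm M f = L2_norm M g"
proof -
  have "(\<integral>\<omega>. (f \<omega>)\<^sup>2 \<partial>M) = (\<integral>\<omega>. (g \<omega>)\<^sup>2 \<partial>M)"
    by (rule integral_cong_AE) (use assms in auto)
  then show ?thesis by (simp add: L2_norm_def)
qed

lemma L2_norm_cmult: "L2_norm M (\<lambda>\<omega>. c * f \<omega>) = \<bar>c\<bar> * L2_norm M f"
  by (simp add: L2_norm_def power_mult_distrib real_sqrt_mult)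

lemma L2_norm_minus: "L2_norm M (\<lambda>\<omega>. - f \<omega>) = L2_norm M f"
  by (simp add: L2_norm_def)

lemma L2_norm_zero: "L2_norm M (\<lambda>_. 0) = 0"
  by (simp add: L2_norm_def)

lemma L2_norm_diff_commute: "L2_norm M (\<lambda>\<omega>. f \<omega> - g \<omega>) = L2_norm M (\<lambda>\<omega>. g \<omega> - f \<omega>)"
  by (simp add: L2_norm_def power2_commute)

lemma L2_norm_cauchy_schwarz:
  assumes f: "sq_integrable M f" and g: "sq_integrable M g"
  shows "(\<integral>\<omega>. \<bar>f \<omega> * g \<omega>\<bar> \<partial>M) \<le> L2_norm M f * L2_norm M g"
proof (cases "L2_norm M f = 0 \<or> L2_norm M g = 0")
  case True
  have z: "AE \<omega> in M. u \<omega> = 0" if "L2_norm M u = 0" "sq_integrable M u" for u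
    using that by (simp add: L2_norm_def sq_integrable_def integral_nonneg_eq_0_iff_AE)
  have "AE \<omega> in M. f \<omega> * g \<omega> = 0"
    using True z[OF _ f] z[OF _ g] by (auto elim: AE_mp)
  then have "(\<integral>\<omega>. \<bar>f \<omega> * g \<omega>\<bar> \<partial>M) = (\<integral>\<omega>. 0 \<partial>M)"
    by (intro integral_cong_AE) (use f g in \<open>auto simp: sq_integrable_def\<close>)
  then show ?thesis using L2_norm_nonneg[of M f] L2_norm_nonneg[of M g] by simp
next
  case False
  let ?a = "L2_norm M f" and ?b = "L2_norm M g"
  have pos: "0 < ?a" "0 < ?b" using False L2_norm_nonneg[of M f] L2_norm_nonneg[of M g] by auto
  \<comment> \<open>With this weight each square contributes half of the product of the norms. The
    case of a vanishing norm was split off because the weight must be positive and finite.\<close>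
  let ?s = "?b / ?a"
  have "(\<integral>\<omega>. \<bar>f \<omega> * g \<omega>\<bar> \<partial>M) \<le> (\<integral>\<omega>. (?s * (f \<omega>)\<^sup>2 + (g \<omega>)\<^sup>2 / ?s) / 2 \<partial>M)"
    by (intro integral_mono integrable_abs sq_integrable_mult_integrable abs_mult_le_weighted_squares)
      (use f g pos in \<open>auto simp: sq_integrable_def\<close>)
  also have "\<dots> = (?s * ?a\<^sup>2 + ?b\<^sup>2 / ?s) / 2"
    using f g by (simp add: sq_integrable_def L2_norm_square)
  also have "\<dots> = ?a * ?b" using pos by (simp add: field_simps power2_eq_square)
  finally show ?thesis .
qed

lemma L2_norm_cauchy_schwarz_integral:
  assumes f: "sq_integrable M f" and g: "sq_integrable M g"
  shows "\<bar>\<integral>\<omega>. f \<omega> * g \<omega> \<partial>M\<bar> \<le> L2_norm M f * L2_norm M g"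
  using integral_abs_bound[of M "\<lambda>\<omega>. f \<omega> * g \<omega>"] L2_norm_cauchy_schwarz[OF assms] by linarith

lemma L2_norm_add_le:
  assumes f: "sq_integrable M f" and g: "sq_integrable M g"
  shows "L2_norm M (\<lambda>\<omega>. f \<omega> + g \<omega>) \<le> L2_norm M f + L2_norm M g"
proof (rule power2_le_imp_le)
  have "(L2_norm M (\<lambda>\<omega>. f \<omega> + g \<omega>))\<^sup>2
      = (\<integral>\<omega>. (f \<omega>)\<^sup>2 \<partial>M) + (\<integral>\<omega>. (g \<omega>)\<^sup>2 \<partial>M) + 2 * (\<integral>\<omega>. f \<omega> * g \<omega> \<partial>M)"
    using f g sq_integrable_mult_integrable[OF f g]
    by (simp add: L2_norm_square sq_integrable_def power2_sum mult.assoc)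
  also have "\<dots> \<le> (L2_norm M f)\<^sup>2 + (L2_norm M g)\<^sup>2 + 2 * (L2_norm M f * L2_norm M g)"
    using L2_norm_cauchy_schwarz_integral[OF f g] by (simp add: L2_norm_square)
  finally show "(L2_norm M (\<lambda>\<omega>. f \<omega> + g \<omega>))\<^sup>2 \<le> (L2_norm M f + L2_norm M g)\<^sup>2"
    by (simp add: power2_sum)
qed (simp add: L2_norm_nonneg)

lemma L2_norm_diff_le:
  assumes f: "sq_integrable M f" and g: "sq_integrable M g"
  shows "L2_norm M (\<lambda>\<omega>. f \<omega> - g \<omega>) \<le> L2_norm M f + L2_norm M g"
  using L2_norm_add_le[OF f sq_integrable_minus[OF g]] by (simp add: L2_norm_minus)

lemma L2_norm_sum_le:
  assumes "\<And>i. i \<in> I \<Longrightarrow> sq_integrable M (f i)"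
  shows "L2_norm M (\<lambda>\<omega>. \<Sum>i\<in>I. f i \<omega>) \<le> (\<Sum>i\<in>I. L2_norm M (f i))"
  using assms
proof (induction I rule: infinite_finite_induct)
  case (insert a I)
  have "L2_norm M (\<lambda>\<omega>. f a \<omega> + (\<Sum>i\<in>I. f i \<omega>)) \<le> L2_norm M (f a) + L2_norm M (\<lambda>\<omega>. \<Sum>i\<in>I. f i \<omega>)"
    by (intro L2_norm_add_le sq_integrable_sum) (use insert in auto)
  with insert show ?case by fastforce
qed (auto simp: L2_norm_zero)

lemma (in prob_space) integral_abs_le_L2_norm:
  assumes "sq_integrable M f"
  shows "(\<integral>\<omega>. \<bar>f \<omega>\<bar> \<partial>M) \<le> L2_norm M f"
  using L2_norm_cauchy_schwarz[OF assms, of "\<lambda>_. 1"]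
  by (simp add: sq_integrable_def L2_norm_def prob_space)

lemma (in prob_space) abs_integral_le_L2_norm:
  assumes "sq_integrable M f"
  shows "\<bar>\<integral>\<omega>. f \<omega> \<partial>M\<bar> \<le> L2_norm M f"
  using integral_abs_le_L2_norm[OF assms] integral_abs_bound[of M f] by linarith

text \<open>Completeness of \<open>L\<^sup>2\<close>: the limit is a pointwise one, the tail bound is Fatou's lemma.\<close>

lemma (in prob_space) L2_series_converges:
  assumes f: "\<And>k::nat. sq_integrable M (f k)"
    and s: "summable (\<lambda>k. L2_norm M (f k))"
  shows "AE \<omega> in M. summable (\<lambda>k. f k \<omega>)"
    and "sq_integrable M (\<lambda>\<omega>. (\<Sum>k. f k \<omega>) - (\<Sum>k<n. f k \<omega>))"
    and "L2_norm M (\<lambda>\<omega>. (\<Sum>k. f k \<omega>) - (\<Sum>k<n. f k \<omega>)) \<le> (\<Sum>k. L2_norm M (f (k + n)))"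
proof -
  have [measurable]: "f k \<in> borel_measurable M" for k using f by (rule sq_integrable_measurable)
  have "(\<integral>\<^sup>+\<omega>. (\<Sum>k. ennreal \<bar>f k \<omega>\<bar>) \<partial>M) = (\<Sum>k. \<integral>\<^sup>+\<omega>. ennreal \<bar>f k \<omega>\<bar> \<partial>M)"
    by (rule nn_integral_suminf) measurable
  also have "\<dots> \<le> (\<Sum>k. ennreal (L2_norm M (f k)))"
  \<comment> \<open>On a probability space the L1 norm is at most the L2 norm, so the sum of the
    absolute values is integrable and the series converges absolutely almost everywhere.\<close>
  proof (intro suminf_le summableI)
    fix k
    have "(\<integral>\<^sup>+\<omega>. ennreal \<bar>f k \<omega>\<bar> \<partial>M) = ennreal (\<integral>\<omega>. \<bar>f k \<omega>\<bar> \<partial>M)"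
      by (rule nn_integral_eq_integral) (auto intro: integrable_abs sq_integrable_integrable f)
    also have "\<dots> \<le> ennreal (L2_norm M (f k))" by (intro ennreal_leI integral_abs_le_L2_norm f)
    finally show "(\<integral>\<^sup>+\<omega>. ennreal \<bar>f k \<omega>\<bar> \<partial>M) \<le> ennreal (L2_norm M (f k))" .
  qed
  also have "\<dots> < \<infinity>" using s by (simp add: suminf_ennreal2 L2_norm_nonneg)
  finally have "AE \<omega> in M. (\<Sum>k. ennreal \<bar>f k \<omega>\<bar>) \<noteq> \<infinity>"
    by (intro nn_integral_PInf_AE) auto
  then have "AE \<omega> in M. summable (\<lambda>k. norm (f k \<omega>))"
    by eventually_elim (auto intro: summable_suminf_not_top)
  then show summ: "AE \<omega> in M. summable (\<lambda>k. f k \<omega>)"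
    by eventually_elim (rule summable_norm_cancel)
  define t where "t = (\<Sum>k. L2_norm M (f (k + n)))"
  have s': "summable (\<lambda>k. L2_norm M (f (k + n)))" using s summable_iff_shift[of "\<lambda>k. L2_norm M (f k)" n] by simp
  have t0: "0 \<le> t" unfolding t_def by (intro suminf_nonneg s' L2_norm_nonneg)
  have part: "(\<integral>\<omega>. (\<Sum>k<m. f (k + n) \<omega>)\<^sup>2 \<partial>M) \<le> t\<^sup>2" for m
  proof -
    have "L2_norm M (\<lambda>\<omega>. \<Sum>k<m. f (k + n) \<omega>) \<le> (\<Sum>k<m. L2_norm M (f (k + n)))"
      by (intro L2_norm_sum_le f)
    also have "\<dots> \<le> t" unfolding t_def by (intro sum_le_suminf s') (auto simp: L2_norm_nonneg)
    finally show ?thesis unfolding L2_norm_square[symmetric]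
      by (intro power_mono L2_norm_nonneg)
  qed
  let ?g = "\<lambda>\<omega>. (\<Sum>k. f k \<omega>) - (\<Sum>k<n. f k \<omega>)"
  have "(\<integral>\<^sup>+\<omega>. ennreal ((?g \<omega>)\<^sup>2) \<partial>M) \<le> (\<integral>\<^sup>+\<omega>. liminf (\<lambda>m. ennreal ((\<Sum>k<m. f (k + n) \<omega>)\<^sup>2)) \<partial>M)"
  proof (rule nn_integral_mono_AE)
    show "AE \<omega> in M. ennreal ((?g \<omega>)\<^sup>2) \<le> liminf (\<lambda>m. ennreal ((\<Sum>k<m. f (k + n) \<omega>)\<^sup>2))"
      using summ
    proof eventually_elim
      case (elim \<omega>)
      have "(\<lambda>m. \<Sum>k<m. f (k + n) \<omega>) \<longlonglongrightarrow> ?g \<omega>"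
        using elim suminf_split_initial_segment[OF elim, of n] summable_LIMSEQ[of "\<lambda>k. f (k + n) \<omega>"]
          summable_iff_shift[of "\<lambda>k. f k \<omega>" n] by simp
      then have "(\<lambda>m. ennreal ((\<Sum>k<m. f (k + n) \<omega>)\<^sup>2)) \<longlonglongrightarrow> ennreal ((?g \<omega>)\<^sup>2)"
        by (intro tendsto_ennrealI tendsto_power)
      then show ?case using lim_imp_Liminf[of sequentially] by fastforce
    qed
  qed
  also have "\<dots> \<le> liminf (\<lambda>m. \<integral>\<^sup>+\<omega>. ennreal ((\<Sum>k<m. f (k + n) \<omega>)\<^sup>2) \<partial>M)"
    by (rule nn_integral_liminf) measurable
  also have "\<dots> \<le> liminf (\<lambda>m::nat. ennreal (t\<^sup>2))"
  proof (intro Liminf_mono always_eventually allI)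
    fix m
    have "(\<integral>\<^sup>+\<omega>. ennreal ((\<Sum>k<m. f (k + n) \<omega>)\<^sup>2) \<partial>M) = ennreal (\<integral>\<omega>. (\<Sum>k<m. f (k + n) \<omega>)\<^sup>2 \<partial>M)"
      using sq_integrable_sum[of "{..<m}" M "\<lambda>k. f (k + n)"] f
      by (intro nn_integral_eq_integral) (auto simp: sq_integrable_def)
    then show "(\<integral>\<^sup>+\<omega>. ennreal ((\<Sum>k<m. f (k + n) \<omega>)\<^sup>2) \<partial>M) \<le> ennreal (t\<^sup>2)"
      using part[of m] by (simp add: ennreal_leI)
  qed
  also have "\<dots> = ennreal (t\<^sup>2)" by (simp add: Liminf_const)
  finally have le: "(\<integral>\<^sup>+\<omega>. ennreal ((?g \<omega>)\<^sup>2) \<partial>M) \<le> ennreal (t\<^sup>2)" .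
  have int: "integrable M (\<lambda>\<omega>. (?g \<omega>)\<^sup>2)"
    by (rule integrableI_bounded) (use le in \<open>auto simp: top_unique less_top[symmetric]\<close>)
  then show "sq_integrable M ?g" by (simp add: sq_integrable_def)
  have "ennreal (\<integral>\<omega>. (?g \<omega>)\<^sup>2 \<partial>M) \<le> ennreal (t\<^sup>2)"
    using le nn_integral_eq_integral[OF int] by simp
  then have "(L2_norm M ?g)\<^sup>2 \<le> t\<^sup>2" unfolding L2_norm_square by (simp add: ennreal_le_iff)
  then show "L2_norm M ?g \<le> (\<Sum>k. L2_norm M (f (k + n)))"
    using t0 power2_le_imp_le unfolding t_def by blast
qed

text \<open>Integrability is the conditional Jensen inequality for the square. The contraction is
  self-adjointness: the squared norm of the conditional expectation \<open>g\<close> of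
  \<open>f\<close> is the inner product of \<open>g\<close> with \<open>f\<close>, and after
  Cauchy-Schwarz one factor cancels.\<close>

lemma (in sigma_finite_subalgebra) sq_integrable_cond_exp:
  assumes "finite_measure M" "sq_integrable M f"
  shows "sq_integrable M (real_cond_exp M F f)"
    and "L2_norm M (real_cond_exp M F f) \<le> L2_norm M f"
proof -
  interpret finite_measure M by fact
  have i: "integrable M f" using assms(2) by (rule sq_integrable_integrable)
  have i2: "integrable M (\<lambda>\<omega>. (f \<omega>)\<^sup>2)" using assms(2) by (simp add: sq_integrable_def)
  have c: "convex_on UNIV (\<lambda>t::real. t\<^sup>2)" by (rule convex_power2)
  have "integrable M (\<lambda>\<omega>. (real_cond_exp M F f \<omega>)\<^sup>2)"
    by (rule integrable_convex_cond_exp[where I = UNIV and q = "\<lambda>t. t\<^sup>2", OF i _ _ i2 c]) auto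
  then show *: "sq_integrable M (real_cond_exp M F f)" by (simp add: sq_integrable_def)
  have "integrable M (\<lambda>\<omega>. real_cond_exp M F f \<omega> * f \<omega>)"
    by (rule sq_integrable_mult_integrable[OF * assms(2)])
  then have "(\<integral>\<omega>. real_cond_exp M F f \<omega> * real_cond_exp M F f \<omega> \<partial>M) = (\<integral>\<omega>. real_cond_exp M F f \<omega> * f \<omega> \<partial>M)"
    by (intro real_cond_exp_intg(2)) (use i in auto)
  then have "(L2_norm M (real_cond_exp M F f))\<^sup>2 \<le> L2_norm M (real_cond_exp M F f) * L2_norm M f"
    using L2_norm_cauchy_schwarz_integral[OF * assms(2)] unfolding L2_norm_square
    by (simp add: power2_eq_square)
  then show "L2_norm M (real_cond_exp M F f) \<le> L2_norm M f"
    using L2_norm_nonneg[of M f] L2_norm_nonneg[of M "real_cond_exp M F f"]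
    by (cases "L2_norm M (real_cond_exp M F f) = 0") (auto simp: power2_eq_square)
qed

section \<open>Stationary filtrations\<close>

locale stationary_filtration = prob_space M for M :: "'a measure" +
  fixes T :: "'a \<Rightarrow> 'a" and F0 :: "'a measure"
  assumes bij_T: "bij_betw T (space M) (space M)"
    and T_measurable [measurable]: "T \<in> M \<rightarrow>\<^sub>M M"
    and T_inv_measurable [measurable]: "the_inv_into (space M) T \<in> M \<rightarrow>\<^sub>M M"
    and T_preserving: "distr M M T = M"
    and F0_subalgebra: "subalgebra M F0"
    and F0_increasing: "sets F0 \<subseteq> sets (vimage_algebra (space M) T F0)"
begin

abbreviation shift :: "int \<Rightarrow> 'a \<Rightarrow> 'a" where "shift \<equiv> iterate_int M T"
abbreviation \<F> :: "int \<Rightarrow> 'a measure" where "\<F> \<equiv> filt M T F0"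

lemma T_inv_T: "\<omega> \<in> space M \<Longrightarrow> the_inv_into (space M) T (T \<omega>) = \<omega>"
  using bij_T by (simp add: bij_betw_def the_inv_into_f_f)

lemma T_T_inv: "\<omega> \<in> space M \<Longrightarrow> T (the_inv_into (space M) T \<omega>) = \<omega>"
  using bij_T by (simp add: f_the_inv_into_f_bij_betw)

lemma shift_measurable [measurable]: "shift i \<in> M \<rightarrow>\<^sub>M M"
proof -
  have "f ^^ n \<in> M \<rightarrow>\<^sub>M M" if [measurable]: "f \<in> M \<rightarrow>\<^sub>M M" for f and n :: nat
    by (induction n) (auto simp: id_def intro: measurable_comp that)
  then show ?thesis by (simp add: iterate_int_def)
qed

lemma shift_space: "\<omega> \<in> space M \<Longrightarrow> shift i \<omega> \<in> space M"
  using shift_measurable by (rule measurable_space)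

lemma shift_0 [simp]: "shift 0 \<omega> = \<omega>"
  by (simp add: iterate_int_def)

lemma shift_succ:
  assumes "\<omega> \<in> space M"
  shows "shift (i + 1) \<omega> = T (shift i \<omega>)"
proof (cases "0 \<le> i")
  case True
  then have "nat (i + 1) = Suc (nat i)" by simp
  with True show ?thesis by (simp add: iterate_int_def)
next
  case False
  then obtain k where k: "nat (- i) = Suc k" using not0_implies_Suc[of "nat (- i)"] by auto
  have k': "nat (- (i + 1)) = k" using k by simp
  have "(the_inv_into (space M) T ^^ k) \<omega> \<in> space M"
    using assms by (induction k) (auto intro: measurable_space[OF T_inv_measurable])
  then have *: "shift (i + 1) \<omega> = T (the_inv_into (space M) T ((the_inv_into (space M) T ^^ k) \<omega>))"
    if "i + 1 < 0" using that k' by (simp add: iterate_int_def T_T_inv)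
  show ?thesis
  proof (cases "i + 1 < 0")
    case True with * False k show ?thesis by (simp add: iterate_int_def)
  next
    \<comment> \<open>The one step at which \<open>iterate_int\<close> passes from its negative to
      its nonnegative branch.\<close>
    case F: False
    then have "i = - 1" using False by simp
    then show ?thesis using assms by (simp add: iterate_int_def T_T_inv)
  qed
qed

lemma shift_pred:
  assumes "\<omega> \<in> space M"
  shows "shift (i - 1) \<omega> = the_inv_into (space M) T (shift i \<omega>)"
  using shift_succ[OF assms, of "i - 1"] T_inv_T[OF shift_space[OF assms, of "i - 1"]] by simp

lemma shift_add:
  assumes "\<omega> \<in> space M"
  shows "shift (i + j) \<omega> = shift i (shift j \<omega>)"
proof (induction i rule: int_induct[where k = 0])
  case (step1 i)
  then show ?case using shift_succ[OF assms, of "i + j"] shift_succ[OF shift_space[OF assms], of i j]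
    by (simp add: algebra_simps)
next
  case (step2 i)
  then show ?case using shift_pred[OF assms, of "i + j"] shift_pred[OF shift_space[OF assms], of i j]
    by (simp add: algebra_simps)
qed simp

lemma distr_shift: "distr M M (shift i) = M"
proof (induction i rule: int_induct[where k = 0])
  case base
  show ?case by (rule distr_cong[THEN trans, OF refl refl _ distr_id]) simp
next
  case (step1 i)
  have "distr M M (shift (i + 1)) = distr (distr M M (shift i)) M T"
    by (subst distr_distr) (auto intro!: distr_cong simp: shift_succ)
  then show ?case using step1 T_preserving by simp
next
  case (step2 i)
  \<comment> \<open>Invariance under \<open>T\<close> lets \<open>M\<close> be rewritten as its own
    image, on which the inverse undoes \<open>T\<close>.\<close>
  have "distr M M (the_inv_into (space M) T) = distr (distr M M T) M (the_inv_into (space M) T)"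
    using T_preserving by simp
  also have "\<dots> = distr M M (\<lambda>\<omega>. \<omega>)"
    by (subst distr_distr[OF T_inv_measurable T_measurable], rule distr_cong) (simp_all add: T_inv_T)
  finally have inv: "distr M M (the_inv_into (space M) T) = M" by (simp add: distr_id2)
  have "distr M M (shift (i - 1)) = distr (distr M M (shift i)) M (the_inv_into (space M) T)"
    by (subst distr_distr) (auto intro!: distr_cong simp: shift_pred)
  then show ?case using step2 inv by simp
qed

lemma integral_shift:
  fixes f :: "'a \<Rightarrow> real"
  assumes "f \<in> borel_measurable M"
  shows "(\<integral>\<omega>. f (shift i \<omega>) \<partial>M) = (\<integral>\<omega>. f \<omega> \<partial>M)"
  using integral_distr[OF shift_measurable[of i] assms] by (simp add: distr_shift)

lemma integrable_shift:
  fixes f :: "'a \<Rightarrow> real"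
  assumes "integrable M f"
  shows "integrable M (\<lambda>\<omega>. f (shift i \<omega>))"
  using integrable_distr[OF shift_measurable[of i], of f] assms by (simp add: distr_shift)

lemma AE_shift:
  assumes "AE \<omega> in M. P \<omega>"
  shows "AE \<omega> in M. P (shift i \<omega>)"
proof -
  have "AE \<omega> in distr M M (shift i). P \<omega>" using assms unfolding distr_shift .
  then show ?thesis by (rule AE_distrD[OF shift_measurable])
qed

lemma measurable_shift: "f \<in> borel_measurable M \<Longrightarrow> (\<lambda>\<omega>. f (shift i \<omega>)) \<in> borel_measurable M"
  by (rule measurable_compose[OF shift_measurable])

lemma sq_integrable_shift: "sq_integrable M f \<Longrightarrow> sq_integrable M (\<lambda>\<omega>. f (shift i \<omega>))"
  unfolding sq_integrable_def using integrable_shift[of "\<lambda>\<omega>. (f \<omega>)\<^sup>2" i] by auto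

lemma L2_norm_shift: "sq_integrable M f \<Longrightarrow> L2_norm M (\<lambda>\<omega>. f (shift i \<omega>)) = L2_norm M f"
  unfolding L2_norm_def sq_integrable_def using integral_shift[of "\<lambda>\<omega>. (f \<omega>)\<^sup>2" i] by auto

lemma space_F0: "space F0 = space M"
  using F0_subalgebra by (simp add: subalgebra_def)

lemma space_filt [simp]: "space (\<F> i) = space M"
  by (simp add: filt_def)

lemma sets_filt: "sets (\<F> i) = {shift i -` A \<inter> space M |A. A \<in> sets F0}"
  unfolding filt_def
  by (rule sets_vimage_algebra2) (use shift_space space_F0 in auto)

lemma filt_subalgebra: "subalgebra M (\<F> i)"
proof -
  have "sets (\<F> i) \<subseteq> sets M"
    using F0_subalgebra measurable_sets[OF shift_measurable[of i]]
    by (auto simp: sets_filt subalgebra_def)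
  then show ?thesis by (simp add: subalgebra_def)
qed

lemma sets_filt_shift:
  assumes "A \<in> sets (\<F> j)"
  shows "shift i -` A \<inter> space M \<in> sets (\<F> (j + i))"
proof -
  obtain B where B: "B \<in> sets F0" "A = shift j -` B \<inter> space M" using assms by (auto simp: sets_filt)
  have "shift i -` A \<inter> space M = shift (j + i) -` B \<inter> space M"
    using shift_space by (auto simp: B shift_add)
  then show ?thesis using B by (auto simp: sets_filt)
qed

lemma filt_succ: "sets (\<F> i) \<subseteq> sets (\<F> (i + 1))"
proof
  fix A assume "A \<in> sets (\<F> i)"
  then obtain B where B: "B \<in> sets F0" "A = shift i -` B \<inter> space M" by (auto simp: sets_filt)
  have "sets (vimage_algebra (space M) T F0) = {T -` A \<inter> space M |A. A \<in> sets F0}"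
    by (rule sets_vimage_algebra2) (use measurable_space[OF T_measurable] space_F0 in auto)
  then obtain C where C: "C \<in> sets F0" "B = T -` C \<inter> space M" using B F0_increasing by blast
  have "A = shift (i + 1) -` C \<inter> space M"
    using shift_space by (auto simp: B C shift_succ)
  then show "A \<in> sets (\<F> (i + 1))" using C by (auto simp: sets_filt)
qed

lemma filt_mono: "i \<le> j \<Longrightarrow> sets (\<F> i) \<subseteq> sets (\<F> j)"
proof (induction j rule: int_ge_induct)
  case (step j)
  then show ?case using filt_succ[of j] by blast
qed simp

lemma filt_subalgebra_filt: "i \<le> j \<Longrightarrow> subalgebra (\<F> j) (\<F> i)"
  using filt_mono by (simp add: subalgebra_def)

lemma measurable_filt_mono:
  "i \<le> j \<Longrightarrow> f \<in> borel_measurable (\<F> i) \<Longrightarrow> f \<in> borel_measurable (\<F> j)"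
  using filt_subalgebra_filt by (rule measurable_from_subalg)

lemma measurable_filt: "f \<in> borel_measurable (\<F> i) \<Longrightarrow> f \<in> borel_measurable M"
  using filt_subalgebra by (rule measurable_from_subalg)

lemma shift_measurable_filt: "shift i \<in> \<F> (j + i) \<rightarrow>\<^sub>M \<F> j"
  by (rule measurableI) (use sets_filt_shift shift_space in auto)

lemma measurable_filt_shift:
  assumes "f \<in> borel_measurable (\<F> j)"
  shows "(\<lambda>\<omega>. f (shift i \<omega>)) \<in> borel_measurable (\<F> (j + i))"
  using measurable_compose[OF shift_measurable_filt assms] .

sublocale filt: sigma_finite_subalgebra M "\<F> i" for i
proof -
  interpret finite_measure_subalgebra M "\<F> i"
    by unfold_locales (rule filt_subalgebra)
  show "sigma_finite_subalgebra M (\<F> i)" by unfold_locales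
qed

abbreviation cexp :: "int \<Rightarrow> ('a \<Rightarrow> real) \<Rightarrow> 'a \<Rightarrow> real" where
  "cexp j \<equiv> real_cond_exp M (\<F> j)"

lemma sq_integrable_cexp:
  assumes "sq_integrable M f"
  shows "sq_integrable M (cexp j f)" "L2_norm M (cexp j f) \<le> L2_norm M f"
  using filt.sq_integrable_cond_exp[OF finite_measure_axioms assms] by auto

text \<open>The shift preserves the measure and pulls \<open>\<F> j\<close> back to
  \<open>\<F> (j + i)\<close>, so integrals over a set of the latter are integrals over a set of the
  former, where the conditional expectation is known.\<close>

lemma cexp_shift:
  assumes f: "integrable M f"
  shows "AE \<omega> in M. cexp (j + i) (\<lambda>\<omega>. f (shift i \<omega>)) \<omega> = cexp j f (shift i \<omega>)"
proof (rule filt.real_cond_exp_charact)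
  fix A assume A: "A \<in> sets (\<F> (j + i))"
  \<comment> \<open>As \<open>shift i\<close> is invertible, \<open>A\<close> is the preimage of
    this set.\<close>
  define B where "B = shift (- i) -` A \<inter> space M"
  have B: "B \<in> sets (\<F> j)" unfolding B_def using sets_filt_shift[OF A, of "- i"] by simp
  have BM: "B \<in> sets M" using B filt_subalgebra by (auto simp: subalgebra_def)
  have AB: "indicat_real A \<omega> = indicat_real B (shift i \<omega>)" if "\<omega> \<in> space M" for \<omega>
    using that shift_add[OF that, of "- i" i] shift_space[OF that] by (auto simp: B_def indicator_def)
  have eq: "(\<integral>\<omega>\<in>A. g (shift i \<omega>) \<partial>M) = (\<integral>\<omega>\<in>B. g \<omega> \<partial>M)" if g: "integrable M g" for g :: "'a \<Rightarrow> real"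
  proof -
    have "(\<integral>\<omega>\<in>A. g (shift i \<omega>) \<partial>M) = (\<integral>\<omega>. indicator B (shift i \<omega>) *\<^sub>R g (shift i \<omega>) \<partial>M)"
      unfolding set_lebesgue_integral_def by (intro Bochner_Integration.integral_cong) (simp_all add: AB)
    also have "\<dots> = (\<integral>\<omega>\<in>B. g \<omega> \<partial>M)"
      unfolding set_lebesgue_integral_def
      by (rule integral_shift[of "\<lambda>\<omega>. indicator B \<omega> *\<^sub>R g \<omega>"]) (use g BM in measurable)
    finally show ?thesis .
  qed
  show "(\<integral>\<omega>\<in>A. f (shift i \<omega>) \<partial>M) = (\<integral>\<omega>\<in>A. cexp j f (shift i \<omega>) \<partial>M)"
    using eq[OF f] eq[OF filt.real_cond_exp_int(1)[OF f, of j]] filt.real_cond_exp_intA[OF f B] by simp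
next
  show "integrable M (\<lambda>\<omega>. f (shift i \<omega>))" "integrable M (\<lambda>\<omega>. cexp j f (shift i \<omega>))"
    using f filt.real_cond_exp_int(1)[OF f, of j] by (auto intro: integrable_shift)
  show "(\<lambda>\<omega>. cexp j f (shift i \<omega>)) \<in> borel_measurable (\<F> (j + i))"
    by (rule measurable_filt_shift) simp
qed

section \<open>Martingale differences\<close>

text \<open>That the conditional expectation given the previous algebra vanishes is stated by
  testing against square integrable functions. Shifts and predictable factors then act on the test
  function, and no version of a conditional expectation has to be carried along;
  \<open>proj_op_eq_self\<close> recovers the usual form.\<close>

definition mart_diff :: "int \<Rightarrow> ('a \<Rightarrow> real) \<Rightarrow> bool" where
  "mart_diff j U \<longleftrightarrow> U \<in> borel_measurable (\<F> j) \<and> sq_integrable M U \<and>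
     (\<forall>V. V \<in> borel_measurable (\<F> (j - 1)) \<longrightarrow> sq_integrable M V \<longrightarrow> (\<integral>\<omega>. U \<omega> * V \<omega> \<partial>M) = 0)"

lemma mart_diffD:
  assumes "mart_diff j U"
  shows "U \<in> borel_measurable (\<F> j)" "sq_integrable M U" "U \<in> borel_measurable M"
    "\<And>V. V \<in> borel_measurable (\<F> (j - 1)) \<Longrightarrow> sq_integrable M V \<Longrightarrow> (\<integral>\<omega>. U \<omega> * V \<omega> \<partial>M) = 0"
  using assms by (auto simp: mart_diff_def sq_integrable_def)

lemma mart_diff_shift:
  assumes U: "mart_diff j U"
  shows "mart_diff (j + i) (\<lambda>\<omega>. U (shift i \<omega>))"
  unfolding mart_diff_def
proof (intro conjI allI impI)
  show "(\<lambda>\<omega>. U (shift i \<omega>)) \<in> borel_measurable (\<F> (j + i))"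
    using U by (intro measurable_filt_shift mart_diffD)
  show "sq_integrable M (\<lambda>\<omega>. U (shift i \<omega>))"
    using U by (intro sq_integrable_shift mart_diffD)
  fix V assume V: "V \<in> borel_measurable (\<F> (j + i - 1))" "sq_integrable M V"
  \<comment> \<open>The test function is transported back to time \<open>j - 1\<close>, where
    \<open>U\<close> itself can be tested.\<close>
  let ?V = "\<lambda>\<omega>. V (shift (- i) \<omega>)"
  have [measurable]: "U \<in> borel_measurable M" "V \<in> borel_measurable M"
    using U V mart_diffD by (auto simp: sq_integrable_def)
  have "?V \<in> borel_measurable (\<F> (j - 1))" using measurable_filt_shift[OF V(1), of "- i"] by simp
  then have "0 = (\<integral>\<omega>. U \<omega> * ?V \<omega> \<partial>M)" using mart_diffD(4)[OF U] sq_integrable_shift[OF V(2)] by simp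
  also have "\<dots> = (\<integral>\<omega>. U (shift i \<omega>) * ?V (shift i \<omega>) \<partial>M)"
    by (rule integral_shift[symmetric, of "\<lambda>\<omega>. U \<omega> * ?V \<omega>"]) measurable
  also have "\<dots> = (\<integral>\<omega>. U (shift i \<omega>) * V \<omega> \<partial>M)"
    by (rule Bochner_Integration.integral_cong) (simp_all add: shift_add[symmetric])
  finally show "(\<integral>\<omega>. U (shift i \<omega>) * V \<omega> \<partial>M) = 0" by simp
qed

lemma mart_diff_orthogonal:
  assumes "mart_diff j U" "mart_diff k V" "j \<noteq> k"
  shows "(\<integral>\<omega>. U \<omega> * V \<omega> \<partial>M) = 0"
proof (cases "j < k")
  case True
  have "(\<integral>\<omega>. V \<omega> * U \<omega> \<partial>M) = 0"
    using True assms measurable_filt_mono[OF _ mart_diffD(1)[OF assms(1)], of "k - 1"]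
    by (intro mart_diffD(4)[OF assms(2)] mart_diffD(2)[OF assms(1)]) auto
  then show ?thesis by (simp add: mult.commute)
next
  case False
  show ?thesis
    using False assms measurable_filt_mono[OF _ mart_diffD(1)[OF assms(2)], of "j - 1"]
    by (intro mart_diffD(4)[OF assms(1)] mart_diffD(2)[OF assms(2)]) auto
qed

lemma mart_diff_cmult:
  assumes "mart_diff j U"
  shows "mart_diff j (\<lambda>\<omega>. c * U \<omega>)"
  using assms by (auto simp: mart_diff_def sq_integrable_cmult mult.assoc)

lemma mart_diff_diff:
  assumes U: "mart_diff j U" and U': "mart_diff j U'"
  shows "mart_diff j (\<lambda>\<omega>. U \<omega> - U' \<omega>)"
  unfolding mart_diff_def
proof (intro conjI allI impI)
  fix V assume V: "V \<in> borel_measurable (\<F> (j - 1))" "sq_integrable M V"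
  have "(\<integral>\<omega>. (U \<omega> - U' \<omega>) * V \<omega> \<partial>M) = (\<integral>\<omega>. U \<omega> * V \<omega> - U' \<omega> * V \<omega> \<partial>M)"
    by (simp add: left_diff_distrib)
  also have "\<dots> = 0" using mart_diffD[OF U] mart_diffD[OF U'] V
    by (subst Bochner_Integration.integral_diff) (auto intro: sq_integrable_mult_integrable)
  finally show "(\<integral>\<omega>. (U \<omega> - U' \<omega>) * V \<omega> \<partial>M) = 0" .
next
  show "(\<lambda>\<omega>. U \<omega> - U' \<omega>) \<in> borel_measurable (\<F> j)"
    by (intro borel_measurable_diff mart_diffD(1) U U')
  show "sq_integrable M (\<lambda>\<omega>. U \<omega> - U' \<omega>)"
    by (intro sq_integrable_diff mart_diffD(2)[OF U] mart_diffD(2)[OF U'])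
qed

text \<open>The predictable factor \<open>w\<close> is absorbed into the test function. The two
  bounds keep the product and the new test function square integrable.\<close>

lemma mart_diff_mult_predictable:
  assumes U: "mart_diff j U" and L: "AE \<omega> in M. \<bar>U \<omega>\<bar> \<le> L"
    and w: "w \<in> borel_measurable (\<F> (j - 1))" and L': "AE \<omega> in M. \<bar>w \<omega>\<bar> \<le> L'"
  shows "mart_diff j (\<lambda>\<omega>. U \<omega> * w \<omega>)"
  unfolding mart_diff_def
proof (intro conjI allI impI)
  have wM [measurable]: "w \<in> borel_measurable M" using w by (rule measurable_filt)
  have [measurable]: "U \<in> borel_measurable M" using U by (rule mart_diffD)
  have wj: "w \<in> borel_measurable (\<F> j)" by (rule measurable_filt_mono[OF _ w]) simp
  show "(\<lambda>\<omega>. U \<omega> * w \<omega>) \<in> borel_measurable (\<F> j)"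
    using mart_diffD(1)[OF U] wj by (rule borel_measurable_times)
  show "sq_integrable M (\<lambda>\<omega>. U \<omega> * w \<omega>)"
  proof (rule sq_integrable_AE_bounded)
    show "AE \<omega> in M. \<bar>U \<omega> * w \<omega>\<bar> \<le> L * L'"
      using L L' by eventually_elim (auto simp: abs_mult intro: mult_mono)
  qed measurable
  fix V assume V: "V \<in> borel_measurable (\<F> (j - 1))" "sq_integrable M V"
  have [measurable]: "V \<in> borel_measurable M" using V by (auto simp: sq_integrable_def)
  have "sq_integrable M (\<lambda>\<omega>. w \<omega> * V \<omega>)"
    unfolding sq_integrable_def
  proof
    show "integrable M (\<lambda>\<omega>. (w \<omega> * V \<omega>)\<^sup>2)"
    proof (rule Bochner_Integration.integrable_bound)
      show "integrable M (\<lambda>\<omega>. L'\<^sup>2 * (V \<omega>)\<^sup>2)" using V by (simp add: sq_integrable_def)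
      show "AE \<omega> in M. norm ((w \<omega> * V \<omega>)\<^sup>2) \<le> norm (L'\<^sup>2 * (V \<omega>)\<^sup>2)"
        using L'
      proof eventually_elim
        case (elim \<omega>)
        then have "(w \<omega>)\<^sup>2 \<le> L'\<^sup>2" by (simp add: abs_le_square_iff[symmetric])
        then show ?case by (simp add: power_mult_distrib mult_right_mono)
      qed
    qed measurable
  qed measurable
  moreover have "(\<lambda>\<omega>. w \<omega> * V \<omega>) \<in> borel_measurable (\<F> (j - 1))"
    using w V(1) by (rule borel_measurable_times)
  ultimately have "(\<integral>\<omega>. U \<omega> * (w \<omega> * V \<omega>) \<partial>M) = 0" by (intro mart_diffD(4)[OF U])
  then show "(\<integral>\<omega>. U \<omega> * w \<omega> * V \<omega> \<partial>M) = 0" by (simp add: mult.assoc)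
qed

lemma sum_orthogonal_square:
  assumes sq: "\<And>i. i \<in> I \<Longrightarrow> sq_integrable M (f i)"
    and orth: "\<And>i k. i \<in> I \<Longrightarrow> k \<in> I \<Longrightarrow> i \<noteq> k \<Longrightarrow> (\<integral>\<omega>. f i \<omega> * f k \<omega> \<partial>M) = 0"
    and "finite I"
  shows "(\<integral>\<omega>. (\<Sum>i\<in>I. f i \<omega>)\<^sup>2 \<partial>M) = (\<Sum>i\<in>I. \<integral>\<omega>. (f i \<omega>)\<^sup>2 \<partial>M)"
proof -
  have "(\<integral>\<omega>. (\<Sum>i\<in>I. f i \<omega>)\<^sup>2 \<partial>M) = (\<integral>\<omega>. (\<Sum>i\<in>I. \<Sum>k\<in>I. f i \<omega> * f k \<omega>) \<partial>M)"
    by (simp add: power2_eq_square sum_product)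
  also have "\<dots> = (\<Sum>i\<in>I. \<Sum>k\<in>I. \<integral>\<omega>. f i \<omega> * f k \<omega> \<partial>M)"
    using sq by (simp add: sq_integrable_mult_integrable)
  also have "\<dots> = (\<Sum>i\<in>I. \<Sum>k\<in>I. if k = i then \<integral>\<omega>. (f i \<omega>)\<^sup>2 \<partial>M else 0)"
    using orth by (intro sum.cong) (auto simp: power2_eq_square)
  finally show ?thesis using assms(3) by simp
qed

lemma proj_op_mart_diff:
  assumes f: "sq_integrable M f"
  shows "mart_diff j (proj_op M T F0 j f)"
  unfolding mart_diff_def
proof (intro conjI allI impI)
  have [measurable]: "f \<in> borel_measurable M" using f by (simp add: sq_integrable_def)
  show "proj_op M T F0 j f \<in> borel_measurable (\<F> j)"
    unfolding proj_op_def
    by (intro borel_measurable_diff borel_measurable_cond_exp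
        measurable_filt_mono[of "j - 1" j, OF _ borel_measurable_cond_exp]) simp
  show "sq_integrable M (proj_op M T F0 j f)"
    unfolding proj_op_def by (intro sq_integrable_diff sq_integrable_cexp f)
  fix V assume V: "V \<in> borel_measurable (\<F> (j - 1))" "sq_integrable M V"
  have Vj: "V \<in> borel_measurable (\<F> j)" by (rule measurable_filt_mono[OF _ V(1)]) simp
  have int: "integrable M (\<lambda>\<omega>. V \<omega> * f \<omega>)" "integrable M (\<lambda>\<omega>. V \<omega> * cexp k f \<omega>)" for k
    by (intro sq_integrable_mult_integrable V f sq_integrable_cexp)+
  have "(\<integral>\<omega>. proj_op M T F0 j f \<omega> * V \<omega> \<partial>M) = (\<integral>\<omega>. V \<omega> * cexp j f \<omega> - V \<omega> * cexp (j - 1) f \<omega> \<partial>M)"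
    by (simp add: proj_op_def right_diff_distrib mult.commute)
  also have "\<dots> = (\<integral>\<omega>. V \<omega> * cexp j f \<omega> \<partial>M) - (\<integral>\<omega>. V \<omega> * cexp (j - 1) f \<omega> \<partial>M)"
    by (intro Bochner_Integration.integral_diff int)
  also have "\<dots> = 0"
    using filt.real_cond_exp_intg(2)[OF int(1) Vj] filt.real_cond_exp_intg(2)[OF int(1) V(1)] by simp
  finally show "(\<integral>\<omega>. proj_op M T F0 j f \<omega> * V \<omega> \<partial>M) = 0" .
qed

lemma proj_op_eq_self:
  assumes U: "mart_diff j U"
  shows "AE \<omega> in M. proj_op M T F0 j U \<omega> = U \<omega>"
proof -
  have i: "integrable M U" using mart_diffD(2)[OF U] by (rule sq_integrable_integrable)
  have "AE \<omega> in M. cexp (j - 1) U \<omega> = 0"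
  proof (rule filt.real_cond_exp_charact)
    \<comment> \<open>Indicators of sets of \<open>\<F> (j - 1)\<close> are admissible test
      functions, which identifies the conditional expectation of \<open>U\<close> as 0.\<close>
    fix A assume A: "A \<in> sets (\<F> (j - 1))"
    then have "A \<in> sets M" using filt_subalgebra by (auto simp: subalgebra_def)
    then have "(\<integral>\<omega>. U \<omega> * indicator A \<omega> \<partial>M) = 0"
      by (intro mart_diffD(4)[OF U] sq_integrable_AE_bounded[where L = 1])
        (use A in \<open>auto simp: indicator_def\<close>)
    then show "(\<integral>\<omega>\<in>A. U \<omega> \<partial>M) = (\<integral>\<omega>\<in>A. 0 \<partial>M)"
      by (simp add: set_lebesgue_integral_def mult.commute)
  qed (use i in auto)
  moreover have "AE \<omega> in M. cexp j U \<omega> = U \<omega>"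
    by (rule filt.real_cond_exp_F_meas[OF i mart_diffD(1)[OF U]])
  ultimately show ?thesis by eventually_elim (simp add: proj_op_def)
qed

lemma cexp_AE_bounded:
  assumes f: "f \<in> borel_measurable M" and L: "AE \<omega> in M. \<bar>f \<omega>\<bar> \<le> L"
  shows "AE \<omega> in M. \<bar>cexp j f \<omega>\<bar> \<le> L"
proof -
  have i: "integrable M f" by (rule integrable_const_bound[where B = L]) (use f L in auto)
  have "AE \<omega> in M. - L \<le> cexp j f \<omega>"
    by (rule filt.real_cond_exp_ge_c[OF i]) (use L in eventually_elim, simp)
  moreover have "AE \<omega> in M. cexp j f \<omega> \<le> L"
    by (rule filt.real_cond_exp_le_c[OF i]) (use L in eventually_elim, simp)
  ultimately show ?thesis by eventually_elim simp
qed

end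

section \<open>Spectral bounds\<close>

text \<open>Over a stationary process \<open>\<eta>\<close> with a bounded spectral density \<open>f\<close>, the least \<open>A\<^sup>2\<close> is
  \<open>2\<pi> sup f\<close>.\<close>

definition spec_bound :: "'a measure \<Rightarrow> (int \<Rightarrow> 'a \<Rightarrow> real) \<Rightarrow> real \<Rightarrow> bool" where
  "spec_bound M \<eta> A \<longleftrightarrow> 0 \<le> A \<and> (\<forall>i. sq_integrable M (\<eta> i)) \<and>
     (\<forall>I c. finite I \<longrightarrow> L2_norm M (\<lambda>\<omega>. \<Sum>i\<in>I. c i * \<eta> i \<omega>) \<le> A * L2_set c I)"

lemma spec_boundD:
  assumes "spec_bound M \<eta> A"
  shows "0 \<le> A" "sq_integrable M (\<eta> i)" "\<eta> i \<in> borel_measurable M"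
    "finite I \<Longrightarrow> L2_norm M (\<lambda>\<omega>. \<Sum>i\<in>I. c i * \<eta> i \<omega>) \<le> A * L2_set c I"
  using assms by (auto simp: spec_bound_def sq_integrable_def)

lemma spec_bound_square:
  assumes "spec_bound M \<eta> A" "finite I"
  shows "(\<integral>\<omega>. (\<Sum>i\<in>I. c i * \<eta> i \<omega>)\<^sup>2 \<partial>M) \<le> A\<^sup>2 * (\<Sum>i\<in>I. (c i)\<^sup>2)"
  using power_mono[OF spec_boundD(4)[OF assms, of c] L2_norm_nonneg, of 2]
  by (simp add: L2_norm_square L2_set_def power_mult_distrib sum_nonneg)

lemma spec_bound_mono: "spec_bound M \<eta> A \<Longrightarrow> A \<le> B \<Longrightarrow> spec_bound M \<eta> B"
  unfolding spec_bound_def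
  by (meson L2_set_nonneg mult_right_mono order_trans)

lemma spec_bound_zero: "spec_bound M (\<lambda>_ _. 0) 0"
  by (simp add: spec_bound_def sq_integrable_zero L2_norm_zero)

lemma spec_bound_add:
  assumes "spec_bound M \<eta> A" "spec_bound M \<zeta> B"
  shows "spec_bound M (\<lambda>i \<omega>. \<eta> i \<omega> + \<zeta> i \<omega>) (A + B)"
  unfolding spec_bound_def
proof (intro conjI allI impI)
  fix I :: "int set" and c :: "int \<Rightarrow> real" assume I: "finite I"
  have "L2_norm M (\<lambda>\<omega>. (\<Sum>i\<in>I. c i * \<eta> i \<omega>) + (\<Sum>i\<in>I. c i * \<zeta> i \<omega>))
      \<le> L2_norm M (\<lambda>\<omega>. \<Sum>i\<in>I. c i * \<eta> i \<omega>) + L2_norm M (\<lambda>\<omega>. \<Sum>i\<in>I. c i * \<zeta> i \<omega>)"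
    using spec_boundD(2)[OF assms(1)] spec_boundD(2)[OF assms(2)]
    by (intro L2_norm_add_le sq_integrable_sum sq_integrable_cmult)
  also have "\<dots> \<le> A * L2_set c I + B * L2_set c I"
    by (intro add_mono spec_boundD(4)[OF assms(1) I] spec_boundD(4)[OF assms(2) I])
  finally show "L2_norm M (\<lambda>\<omega>. \<Sum>i\<in>I. c i * (\<eta> i \<omega> + \<zeta> i \<omega>)) \<le> (A + B) * L2_set c I"
    by (simp add: distrib_left distrib_right sum.distrib)
qed (use assms in \<open>auto simp: spec_bound_def intro: sq_integrable_add\<close>)

lemma spec_bound_sum:
  assumes "\<And>j. j \<in> J \<Longrightarrow> spec_bound M (\<eta> j) (A j)"
  shows "spec_bound M (\<lambda>i \<omega>. \<Sum>j\<in>J. \<eta> j i \<omega>) (\<Sum>j\<in>J. A j)"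
  using assms
  by (induction J rule: infinite_finite_induct) (auto simp: spec_bound_zero intro: spec_bound_add)

text \<open>Each inequality involves only finitely many variables, so L2 convergence of every single
  variable suffices. This carries the bounds of finite sums of innovations over to their infinite
  series.\<close>

lemma spec_bound_limit:
  assumes sb: "\<And>N::nat. N \<ge> N0 \<Longrightarrow> spec_bound M (\<eta> N) A"
    and lim: "\<And>i. (\<lambda>N. L2_norm M (\<lambda>\<omega>. \<zeta> i \<omega> - \<eta> N i \<omega>)) \<longlonglongrightarrow> 0"
    and sq: "\<And>i. sq_integrable M (\<zeta> i)"
  shows "spec_bound M \<zeta> A"
  unfolding spec_bound_def
proof (intro conjI allI impI)
  fix I :: "int set" and c :: "int \<Rightarrow> real" assume I: "finite I"
  show "L2_norm M (\<lambda>\<omega>. \<Sum>i\<in>I. c i * \<zeta> i \<omega>) \<le> A * L2_set c I"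
  proof (rule LIMSEQ_le_const)
    show "(\<lambda>N. (\<Sum>i\<in>I. \<bar>c i\<bar> * L2_norm M (\<lambda>\<omega>. \<zeta> i \<omega> - \<eta> N i \<omega>)) + A * L2_set c I) \<longlonglongrightarrow> A * L2_set c I"
      by (rule tendsto_eq_intros tendsto_sum tendsto_mult_right_zero lim refl)+ simp
    have "L2_norm M (\<lambda>\<omega>. \<Sum>i\<in>I. c i * \<zeta> i \<omega>)
        \<le> (\<Sum>i\<in>I. \<bar>c i\<bar> * L2_norm M (\<lambda>\<omega>. \<zeta> i \<omega> - \<eta> N i \<omega>)) + A * L2_set c I" if N: "N \<ge> N0" for N
    proof -
      note s = spec_boundD(2)[OF sb[OF N]]
      have "L2_norm M (\<lambda>\<omega>. \<Sum>i\<in>I. c i * \<zeta> i \<omega>)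
          = L2_norm M (\<lambda>\<omega>. (\<Sum>i\<in>I. c i * (\<zeta> i \<omega> - \<eta> N i \<omega>)) + (\<Sum>i\<in>I. c i * \<eta> N i \<omega>))"
        by (simp add: sum.distrib[symmetric] distrib_left[symmetric])
      also have "\<dots> \<le> L2_norm M (\<lambda>\<omega>. \<Sum>i\<in>I. c i * (\<zeta> i \<omega> - \<eta> N i \<omega>)) + L2_norm M (\<lambda>\<omega>. \<Sum>i\<in>I. c i * \<eta> N i \<omega>)"
        by (intro L2_norm_add_le sq_integrable_sum sq_integrable_cmult sq_integrable_diff sq s)
      also have "L2_norm M (\<lambda>\<omega>. \<Sum>i\<in>I. c i * (\<zeta> i \<omega> - \<eta> N i \<omega>))
          \<le> (\<Sum>i\<in>I. L2_norm M (\<lambda>\<omega>. c i * (\<zeta> i \<omega> - \<eta> N i \<omega>)))"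
        by (intro L2_norm_sum_le sq_integrable_cmult sq_integrable_diff sq s)
      also have "L2_norm M (\<lambda>\<omega>. \<Sum>i\<in>I. c i * \<eta> N i \<omega>) \<le> A * L2_set c I"
        by (rule spec_boundD(4)[OF sb[OF N] I])
      finally show ?thesis by (simp add: L2_norm_cmult)
    qed
    then show "\<exists>N. \<forall>n\<ge>N. L2_norm M (\<lambda>\<omega>. \<Sum>i\<in>I. c i * \<zeta> i \<omega>)
        \<le> (\<Sum>i\<in>I. \<bar>c i\<bar> * L2_norm M (\<lambda>\<omega>. \<zeta> i \<omega> - \<eta> n i \<omega>)) + A * L2_set c I" by blast
  qed
qed (use spec_boundD(1)[OF sb[OF order_refl]] sq in auto)

context stationary_filtration
begin

text \<open>The shifts of a martingale difference are orthogonal with equal norms, a white noise;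
  the inequality is even an equality.\<close>

lemma mart_diff_spec_bound:
  assumes U: "mart_diff j U"
  shows "spec_bound M (\<lambda>i \<omega>. U (shift i \<omega>)) (L2_norm M U)"
  unfolding spec_bound_def
proof (intro conjI allI impI)
  show sq: "sq_integrable M (\<lambda>\<omega>. U (shift i \<omega>))" for i
    by (intro sq_integrable_shift mart_diffD(2)[OF U])
  fix I :: "int set" and c :: "int \<Rightarrow> real" assume I: "finite I"
  note md = mart_diff_cmult[OF mart_diff_shift[OF U]]
  have "(\<integral>\<omega>. (\<Sum>i\<in>I. c i * U (shift i \<omega>))\<^sup>2 \<partial>M) = (\<Sum>i\<in>I. \<integral>\<omega>. (c i * U (shift i \<omega>))\<^sup>2 \<partial>M)"
    by (rule sum_orthogonal_square[OF _ _ I]) (auto intro: mart_diffD(2)[OF md] mart_diff_orthogonal[OF md md])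
  also have "\<dots> = (\<Sum>i\<in>I. (c i)\<^sup>2 * (L2_norm M U)\<^sup>2)"
    using L2_norm_shift[OF mart_diffD(2)[OF U]] by (simp add: power_mult_distrib L2_norm_square[symmetric])
  also have "\<dots> = (L2_norm M U * L2_set c I)\<^sup>2"
    by (simp add: L2_set_def power_mult_distrib sum_nonneg sum_distrib_left mult.commute)
  finally show "L2_norm M (\<lambda>\<omega>. \<Sum>i\<in>I. c i * U (shift i \<omega>)) \<le> L2_norm M U * L2_set c I"
    unfolding L2_norm_square[symmetric]
    by (simp add: power2_eq_iff_nonneg L2_norm_nonneg L2_set_nonneg)
qed (rule L2_norm_nonneg)

lemma proj_op_telescope:
  assumes "a \<le> b"
  shows "(\<Sum>m\<in>{a<..b}. proj_op M T F0 m f \<omega>) = cexp b f \<omega> - cexp a f \<omega>"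
  using assms
proof (induction b rule: int_ge_induct)
  case (step b)
  have "{a<..b + 1} = insert (b + 1) {a<..b}" using step.hyps by auto
  then show ?case using step by (simp add: proj_op_def)
qed simp

text \<open>Truncation destroys the martingale property and projection restores it: \<open>V\<close>
  is the projection at time \<open>j\<close> of the truncated variable. As \<open>U\<close> is its
  own projection, \<open>U - V\<close> is the projection of the truncation error. Being a difference
  of two contractions, the projection at most doubles a norm, hence the target
  \<open>\<delta> / 2\<close> in the proof.\<close>

lemma mart_diff_bounded_approx:
  assumes U: "mart_diff j U" and \<delta>: "0 < \<delta>"
  shows "\<exists>V L. mart_diff j V \<and> (AE \<omega> in M. \<bar>V \<omega>\<bar> \<le> L) \<and> L2_norm M (\<lambda>\<omega>. U \<omega> - V \<omega>) \<le> \<delta>"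
proof -
  have Um [measurable]: "U \<in> borel_measurable M" and sqU: "sq_integrable M U"
    using U by (auto intro: mart_diffD)
  define t where "t n \<omega> = max (- real n) (min (real n) (U \<omega>))" for n \<omega>
  have tm [measurable]: "t n \<in> borel_measurable M" for n unfolding t_def by measurable
  have tb: "\<bar>t n \<omega>\<bar> \<le> real n" for n \<omega> by (auto simp: t_def)
  have sqt: "sq_integrable M (t n)" for n
    by (rule sq_integrable_AE_bounded[where L = "real n"]) (auto simp: tb)
  have "(\<lambda>n. \<integral>\<omega>. (U \<omega> - t n \<omega>)\<^sup>2 \<partial>M) \<longlonglongrightarrow> (\<integral>\<omega>. 0 \<partial>M)"
  proof (rule integral_dominated_convergence[where w = "\<lambda>\<omega>. (U \<omega>)\<^sup>2"])
    show "integrable M (\<lambda>\<omega>. (U \<omega>)\<^sup>2)" using sqU by (simp add: sq_integrable_def)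
    show "AE \<omega> in M. (\<lambda>n. (U \<omega> - t n \<omega>)\<^sup>2) \<longlonglongrightarrow> 0"
    proof (intro AE_I2 tendsto_eventually)
      fix \<omega>
      show "\<forall>\<^sub>F n in sequentially. (U \<omega> - t n \<omega>)\<^sup>2 = 0"
        using eventually_ge_at_top[of "nat \<lceil>\<bar>U \<omega>\<bar>\<rceil>"]
      proof eventually_elim
        case (elim n)
        then have "\<bar>U \<omega>\<bar> \<le> real n" by linarith
        then show ?case by (auto simp: t_def max_def min_def)
      qed
    qed
    have "\<bar>U \<omega> - t n \<omega>\<bar> \<le> \<bar>U \<omega>\<bar>" for n \<omega> by (auto simp: t_def)
    then show "AE \<omega> in M. norm ((U \<omega> - t n \<omega>)\<^sup>2) \<le> (U \<omega>)\<^sup>2" for n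
      by (simp add: abs_le_square_iff)
  qed measurable
  then have "(\<lambda>n. L2_norm M (\<lambda>\<omega>. U \<omega> - t n \<omega>)) \<longlonglongrightarrow> 0"
    unfolding L2_norm_def using tendsto_real_sqrt by fastforce
  then have "\<forall>\<^sub>F n in sequentially. L2_norm M (\<lambda>\<omega>. U \<omega> - t n \<omega>) < \<delta> / 2"
    using \<delta> by (intro order_tendstoD) auto
  then obtain n where n: "L2_norm M (\<lambda>\<omega>. U \<omega> - t n \<omega>) < \<delta> / 2"
    by (auto simp: eventually_sequentially)
  let ?V = "proj_op M T F0 j (t n)"
  have md: "mart_diff j ?V" by (rule proj_op_mart_diff[OF sqt])
  have "AE \<omega> in M. \<bar>cexp i (t n) \<omega>\<bar> \<le> real n" for i
    by (rule cexp_AE_bounded) (auto simp: tb)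
  from this[of j] this[of "j - 1"] have bd: "AE \<omega> in M. \<bar>?V \<omega>\<bar> \<le> 2 * real n"
    by eventually_elim (auto simp: proj_op_def)
  let ?d = "\<lambda>\<omega>. U \<omega> - t n \<omega>"
  have sqd: "sq_integrable M ?d" by (intro sq_integrable_diff sqU sqt)
  have iU: "integrable M U" and it: "integrable M (t n)"
    using sqU sqt by (auto intro: sq_integrable_integrable)
  have "AE \<omega> in M. U \<omega> - ?V \<omega> = cexp j ?d \<omega> - cexp (j - 1) ?d \<omega>"
    using proj_op_eq_self[OF U] filt.real_cond_exp_diff[OF iU it, of j]
      filt.real_cond_exp_diff[OF iU it, of "j - 1"]
    by eventually_elim (simp add: proj_op_def)
  then have "L2_norm M (\<lambda>\<omega>. U \<omega> - ?V \<omega>) = L2_norm M (\<lambda>\<omega>. cexp j ?d \<omega> - cexp (j - 1) ?d \<omega>)"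
    by (rule L2_norm_cong_AE) (use mart_diffD(3)[OF md] in measurable)
  also have "\<dots> \<le> L2_norm M (cexp j ?d) + L2_norm M (cexp (j - 1) ?d)"
    by (intro L2_norm_diff_le sq_integrable_cexp sqd)
  also have "\<dots> \<le> \<delta>" using sq_integrable_cexp(2)[OF sqd, of j] sq_integrable_cexp(2)[OF sqd, of "j - 1"] n by linarith
  finally show ?thesis using md bd by blast
qed

end

section \<open>Processes satisfying Hannan's condition\<close>

locale hannan_process = stationary_filtration M T F0
  for M :: "'a measure" and T :: "'a \<Rightarrow> 'a" and F0 :: "'a measure" +
  fixes \<epsilon>0 :: "'a \<Rightarrow> real"
  assumes tail_trivial: "\<And>A. A \<in> filt_minus_infty_sets M T F0 \<Longrightarrow> prob A = 0 \<or> prob A = 1"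
    and sq_integrable_\<epsilon>0: "sq_integrable M \<epsilon>0"
    and mean_zero: "(\<integral>\<omega>. \<epsilon>0 \<omega> \<partial>M) = 0"
    and \<epsilon>0_filt_infty: "\<epsilon>0 \<in> borel_measurable (filt_infty M T F0)"
    and hannan: "(\<lambda>i. L2_norm M (proj_op M T F0 0 (error M T \<epsilon>0 i))) summable_on UNIV"
begin

abbreviation \<epsilon> :: "int \<Rightarrow> 'a \<Rightarrow> real" where "\<epsilon> \<equiv> error M T \<epsilon>0"

text \<open>The event that \<open>G\<close> exceeds its mean lies in the tail. Probability 1 would
  make the mean larger than itself, so the probability is 0; then mean minus \<open>G\<close> is
  almost surely nonnegative with integral 0 and vanishes.\<close>

lemma tail_measurable_const:
  fixes G :: "'a \<Rightarrow> real"
  assumes G: "\<And>r::nat. G \<in> borel_measurable (\<F> (- int r))" and i: "integrable M G"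
  shows "AE \<omega> in M. G \<omega> = expectation G"
proof -
  let ?m = "expectation G"
  have GM [measurable]: "G \<in> borel_measurable M" using G[of 0] by (rule measurable_filt)
  have "{\<omega> \<in> space M. ?m < G \<omega>} \<in> sets (\<F> i)" for i
  proof -
    \<comment> \<open>The hypothesis speaks about nonpositive indices; monotonicity yields all
      integers, as membership in the tail demands.\<close>
    have [measurable]: "G \<in> borel_measurable (\<F> i)"
      by (rule measurable_filt_mono[OF _ G[of "nat (- i)"]]) simp
    have "{\<omega> \<in> space (\<F> i). ?m < G \<omega>} \<in> sets (\<F> i)" by measurable
    then show ?thesis by simp
  qed
  then have "{\<omega> \<in> space M. ?m < G \<omega>} \<in> filt_minus_infty_sets M T F0"
    by (simp add: filt_minus_infty_sets_def)
  then consider "prob {\<omega> \<in> space M. ?m < G \<omega>} = 0" | "prob {\<omega> \<in> space M. ?m < G \<omega>} = 1"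
    using tail_trivial by blast
  then have "AE \<omega> in M. G \<omega> \<le> ?m"
  proof cases
    case 1
    then have "AE \<omega> in M. \<not> ?m < G \<omega>" by (subst AE_iff_measurable[OF _ refl]) (auto simp: emeasure_eq_measure)
    then show ?thesis by eventually_elim simp
  next
    case 2
    have "AE \<omega> in M. ?m < G \<omega>" using AE_prob_1[OF 2] by eventually_elim simp
    then have "expectation (\<lambda>_. ?m) < expectation G"
      using i emeasure_space_1 by (intro integral_less_AE_space) simp_all
    then show ?thesis by (simp add: prob_space)
  qed
  moreover have "(\<integral>\<omega>. ?m - G \<omega> \<partial>M) = 0" using i by (simp add: prob_space)
  ultimately have "AE \<omega> in M. ?m - G \<omega> = 0"
    by (subst integral_nonneg_eq_0_iff_AE[symmetric]) (use i in auto)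
  then show ?thesis by eventually_elim simp
qed

text \<open>Squared norms decrease, so a subsequence converges rapidly, hence almost surely; its limit is
  tail measurable.\<close>

lemma reverse_martingale:
  fixes f :: "'a \<Rightarrow> real"
  assumes f: "sq_integrable M f"
  shows "(\<lambda>r::nat. L2_norm M (\<lambda>\<omega>. cexp (- int r) f \<omega> - expectation f)) \<longlonglongrightarrow> 0"
proof -
  define g where "g r = cexp (- int r) f" for r :: nat
  define a where "a r = (\<integral>\<omega>. (g r \<omega>)\<^sup>2 \<partial>M)" for r
  have sqg: "sq_integrable M (g r)" for r unfolding g_def by (rule sq_integrable_cexp(1)[OF f])
  have gm [measurable]: "g r \<in> borel_measurable (\<F> (- int r))" for r unfolding g_def by simp
  have gM: "g r \<in> borel_measurable M" for r using sqg by (simp add: sq_integrable_def)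
  have if': "integrable M f" using f by (rule sq_integrable_integrable)
  have Eg: "expectation (g r) = expectation f" for r
    unfolding g_def by (rule filt.real_cond_exp_int(2)[OF if'])
  \<comment> \<open>Tower property: the coarser \<open>g s\<close> is a projection of the finer
    \<open>g r\<close>. Squared distances thereby become differences of the numbers
    \<open>a\<close>.\<close>
  have prod: "(\<integral>\<omega>. g s \<omega> * g r \<omega> \<partial>M) = a s" if "r \<le> s" for r s
  proof -
    have int: "integrable M (\<lambda>\<omega>. g s \<omega> * f \<omega>)" by (intro sq_integrable_mult_integrable sqg f)
    have gs: "g s \<in> borel_measurable (\<F> (- int r))" by (rule measurable_filt_mono[OF _ gm]) (use that in simp)
    have "(\<integral>\<omega>. g s \<omega> * g r \<omega> \<partial>M) = (\<integral>\<omega>. g s \<omega> * f \<omega> \<partial>M)"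
      unfolding g_def[of r] using f by (intro filt.real_cond_exp_intg(2) int gs) (simp add: sq_integrable_def)
    also have "\<dots> = (\<integral>\<omega>. g s \<omega> * g s \<omega> \<partial>M)"
      unfolding g_def[of s] using f int unfolding g_def
      by (intro filt.real_cond_exp_intg(2)[symmetric] borel_measurable_cond_exp) (simp_all add: sq_integrable_def)
    finally show ?thesis by (simp add: a_def power2_eq_square)
  qed
  have dist: "(L2_norm M (\<lambda>\<omega>. g r \<omega> - g s \<omega>))\<^sup>2 = a r - a s" if "r \<le> s" for r s
  proof -
    have i: "integrable M (\<lambda>\<omega>. (g r \<omega>)\<^sup>2)" for r using sqg by (simp add: sq_integrable_def)
    have i2: "integrable M (\<lambda>\<omega>. g s \<omega> * g r \<omega>)" by (intro sq_integrable_mult_integrable sqg)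
    have "(L2_norm M (\<lambda>\<omega>. g r \<omega> - g s \<omega>))\<^sup>2 = (\<integral>\<omega>. ((g r \<omega>)\<^sup>2 + (g s \<omega>)\<^sup>2) - 2 * (g s \<omega> * g r \<omega>) \<partial>M)"
      unfolding L2_norm_square by (simp add: power2_diff mult_ac)
    also have "\<dots> = a r + a s - 2 * (\<integral>\<omega>. g s \<omega> * g r \<omega> \<partial>M)"
      using i i2 by (simp add: a_def)
    finally show ?thesis using prod[OF that] by linarith
  qed
  have dec: "decseq a"
    unfolding decseq_def using dist by (metis diff_ge_0_iff_ge zero_le_power2)
  have "a r \<ge> 0" for r by (simp add: a_def)
  then obtain l where l: "a \<longlonglongrightarrow> l" "\<And>r. l \<le> a r"
    using decseq_convergent[OF dec] by blast
  \<comment> \<open>A rate of powers of 1/4 for squared norms is a rate of powers of 1/2 for the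
    norms, which is summable.\<close>
  have "\<exists>r>q. a r - l < (1/4) ^ k" for q k
  proof -
    have "(\<lambda>r. a r - l) \<longlonglongrightarrow> 0" using l(1) by (simp add: LIM_zero)
    then have "\<forall>\<^sub>F r in sequentially. a r - l < (1/4) ^ k" by (rule order_tendstoD) simp
    from eventually_happens'[OF sequentially_bot eventually_conj[OF this eventually_gt_at_top[of q]]]
    show ?thesis by blast
  qed
  then obtain nx where nx: "\<And>q k. nx q k > q" "\<And>q k. a (nx q k) - l < (1/4) ^ k" by metis
  define \<phi> where "\<phi> = rec_nat (nx 0 0) (\<lambda>k q. nx q (Suc k))"
  have \<phi>: "\<phi> (Suc k) > \<phi> k" "a (\<phi> k) - l < (1/4) ^ k" for k
  proof -
    have \<phi>0: "\<phi> 0 = nx 0 0" and \<phi>S: "\<And>k. \<phi> (Suc k) = nx (\<phi> k) (Suc k)" by (simp_all add: \<phi>_def)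
    show "\<phi> (Suc k) > \<phi> k" unfolding \<phi>S by (rule nx)
    show "a (\<phi> k) - l < (1/4) ^ k" by (cases k) (simp_all only: \<phi>0 \<phi>S nx)
  qed
  have sm: "strict_mono \<phi>" using \<phi>(1) by (simp add: strict_mono_Suc_iff)
  \<comment> \<open>Increments along the subsequence, preceded by \<open>g (\<phi> 0)\<close>: the
    first \<open>Suc n\<close> terms sum to \<open>g (\<phi> n)\<close>, and completeness of L2
    applies to the series.\<close>
  define h where "h k = (case k of 0 \<Rightarrow> g (\<phi> 0) | Suc k \<Rightarrow> (\<lambda>\<omega>. g (\<phi> (Suc k)) \<omega> - g (\<phi> k) \<omega>))" for k
  have hsq: "sq_integrable M (h k)" for k by (cases k) (auto simp: h_def intro: sqg sq_integrable_diff)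
  have hsum: "(\<Sum>k<Suc n. h k \<omega>) = g (\<phi> n) \<omega>" for n \<omega>
    by (induction n) (auto simp: h_def)
  have hn: "L2_norm M (h (Suc k)) \<le> (1/2) ^ k" for k
  proof (rule power2_le_imp_le)
    have "(L2_norm M (h (Suc k)))\<^sup>2 = a (\<phi> k) - a (\<phi> (Suc k))"
      using dist[OF less_imp_le[OF \<phi>(1)], of k] by (simp add: h_def L2_norm_diff_commute)
    also have "\<dots> \<le> (1/4) ^ k" using \<phi>(2)[of k] l(2)[of "\<phi> (Suc k)"] by linarith
    also have "\<dots> = ((1/2) ^ k)\<^sup>2" by (simp add: power2_eq_square flip: power_mult_distrib)
    finally show "(L2_norm M (h (Suc k)))\<^sup>2 \<le> ((1/2) ^ k)\<^sup>2" .
  qed simp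
  have "summable (\<lambda>k. L2_norm M (h (Suc k)))"
    by (rule summable_comparison_test[where g = "\<lambda>k. (1/2)^k"]) (auto simp: L2_norm_nonneg hn summable_geometric)
  then have summ: "summable (\<lambda>k. L2_norm M (h k))" using summable_Suc_iff by blast
  note conv = L2_series_converges[OF hsq summ]
  define G where "G \<omega> = (\<Sum>k. h k \<omega>)" for \<omega>
  have tail: "(\<lambda>n. L2_norm M (\<lambda>\<omega>. G \<omega> - g (\<phi> n) \<omega>)) \<longlonglongrightarrow> 0"
  proof (rule real_tendsto_sandwich[OF _ _ tendsto_const])
    show "(\<lambda>n. \<Sum>k. L2_norm M (h (k + Suc n))) \<longlonglongrightarrow> 0"
      using suminf_exist_split2[OF summ] by (rule LIMSEQ_Suc)
    show "\<forall>\<^sub>F n in sequentially. L2_norm M (\<lambda>\<omega>. G \<omega> - g (\<phi> n) \<omega>) \<le> (\<Sum>k. L2_norm M (h (k + Suc n)))"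
      using conv(3)[of "Suc _"] unfolding hsum G_def by simp
  qed (simp add: L2_norm_nonneg)
  have sqd: "sq_integrable M (\<lambda>\<omega>. G \<omega> - g (\<phi> n) \<omega>)" for n
    using conv(2)[of "Suc n"] unfolding hsum G_def .
  have sqG: "sq_integrable M G" using sq_integrable_add[OF sqd[of 0] sqg[of "\<phi> 0"]] by simp
  have GM: "G \<in> borel_measurable M" using sqG by (simp add: sq_integrable_def)
  \<comment> \<open>The pointwise limit, defined everywhere. Dropping the first \<open>r\<close>
    terms does not change it and shows that it is measurable for \<open>\<F> (- int r)\<close>,
    because \<open>\<phi> (n + r) \<ge> r\<close>. The series \<open>G\<close> agrees with it only
    almost everywhere.\<close>
  define G' where "G' \<omega> = lim (\<lambda>n. g (\<phi> n) \<omega>)" for \<omega>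
  have G'm: "G' \<in> borel_measurable (\<F> (- int r))" for r
  proof -
    have [measurable]: "g (\<phi> (n + r)) \<in> borel_measurable (\<F> (- int r))" for n
      by (rule measurable_filt_mono[OF _ gm]) (use seq_suble[OF sm, of "n + r"] in simp)
    have "((\<lambda>n. g (\<phi> n) \<omega>) \<longlonglongrightarrow> L) = ((\<lambda>n. g (\<phi> (n + r)) \<omega>) \<longlonglongrightarrow> L)" for \<omega> L
      by (rule iffI, erule LIMSEQ_ignore_initial_segment, erule LIMSEQ_offset)
    note shift_iff = this
    have "G' = (\<lambda>\<omega>. lim (\<lambda>n. g (\<phi> (n + r)) \<omega>))"
      by (rule ext) (simp only: G'_def lim_def shift_iff)
    also have "\<dots> \<in> borel_measurable (\<F> (- int r))" by (rule borel_measurable_lim_metric) measurable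
    finally show ?thesis .
  qed
  have GG': "AE \<omega> in M. G \<omega> = G' \<omega>"
    using conv(1)
  proof eventually_elim
    case (elim \<omega>)
    have "(\<lambda>n. \<Sum>k<Suc n. h k \<omega>) \<longlonglongrightarrow> G \<omega>"
      unfolding G_def by (rule LIMSEQ_Suc[OF summable_LIMSEQ[OF elim]])
    then show ?case unfolding hsum G'_def by (simp add: limI)
  qed
  have G'M: "G' \<in> borel_measurable M" using G'm[of 0] by (rule measurable_filt)
  have iG: "integrable M G" using sqG by (rule sq_integrable_integrable)
  have iG': "integrable M G'" by (rule integrable_cong_AE_imp[OF iG G'M GG'])
  have EGG': "expectation G' = expectation G" by (rule integral_cong_AE) (use GG' GM G'M in auto)
  have EGf: "expectation G = expectation f"
  proof -
    have "\<bar>expectation G - expectation f\<bar> \<le> L2_norm M (\<lambda>\<omega>. G \<omega> - g (\<phi> n) \<omega>)" for n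
    proof -
      have "expectation G - expectation f = (\<integral>\<omega>. G \<omega> - g (\<phi> n) \<omega> \<partial>M)"
        using iG sq_integrable_integrable[OF sqg] Eg by simp
      then show ?thesis using abs_integral_le_L2_norm[OF sqd] by simp
    qed
    then have "\<bar>expectation G - expectation f\<bar> \<le> 0" by (intro LIMSEQ_le_const[OF tail]) auto
    then show ?thesis by simp
  qed
  have "AE \<omega> in M. G \<omega> = expectation f"
    using tail_measurable_const[OF G'm iG'] GG' by eventually_elim (simp add: EGG' EGf)
  then have "L2_norm M (\<lambda>\<omega>. G \<omega> - g (\<phi> n) \<omega>) = L2_norm M (\<lambda>\<omega>. expectation f - g (\<phi> n) \<omega>)" for n
    by (intro L2_norm_cong_AE) (use GM gM in auto)
  then have sub: "(\<lambda>n. L2_norm M (\<lambda>\<omega>. g (\<phi> n) \<omega> - expectation f)) \<longlonglongrightarrow> 0"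
    using tail by (simp add: L2_norm_diff_commute)
  \<comment> \<open>The squared distance to the mean is \<open>a r\<close> minus a constant and so
    converges along the full sequence; the subsequence shows that its limit is 0.\<close>
  have sqr: "(L2_norm M (\<lambda>\<omega>. g r \<omega> - expectation f))\<^sup>2 = a r - (expectation f)\<^sup>2" for r
  proof -
    have "integrable M (\<lambda>\<omega>. (g r \<omega>)\<^sup>2)" "integrable M (g r)" using sqg sq_integrable_integrable[OF sqg] by (simp_all add: sq_integrable_def)
    then show ?thesis using Eg[of r] unfolding L2_norm_square
      by (simp add: power2_diff a_def prob_space) (simp add: power2_eq_square)
  qed
  have "(\<lambda>n. a (\<phi> n) - (expectation f)\<^sup>2) \<longlonglongrightarrow> 0"
    using tendsto_power[OF sub, of 2] by (simp add: sqr)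
  moreover have "(\<lambda>n. a (\<phi> n) - (expectation f)\<^sup>2) \<longlonglongrightarrow> l - (expectation f)\<^sup>2"
    by (intro tendsto_intros LIMSEQ_subseq_LIMSEQ[OF l(1) sm, unfolded o_def])
  ultimately have "l - (expectation f)\<^sup>2 = 0" by (metis LIMSEQ_unique)
  then have "(\<lambda>r. (L2_norm M (\<lambda>\<omega>. g r \<omega> - expectation f))\<^sup>2) \<longlonglongrightarrow> 0"
    unfolding sqr using l(1) by (auto intro!: tendsto_eq_intros)
  from tendsto_real_sqrt[OF this] show ?thesis by (simp add: L2_norm_nonneg g_def)
qed


section \<open>Innovations of the errors\<close>

lemma \<epsilon>_eq: "\<epsilon> i \<omega> = \<epsilon>0 (shift i \<omega>)"
  by (simp add: error_def)

lemma sq_integrable_\<epsilon>: "sq_integrable M (\<epsilon> i)"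
  unfolding error_def by (rule sq_integrable_shift[OF sq_integrable_\<epsilon>0])

abbreviation innov :: "int \<Rightarrow> 'a \<Rightarrow> real" where "innov m \<equiv> proj_op M T F0 m \<epsilon>0"

lemma mart_diff_innov: "mart_diff m (innov m)"
  by (rule proj_op_mart_diff[OF sq_integrable_\<epsilon>0])

text \<open>By stationarity the projection at time 0 of the error at time \<open>- m\<close> is a
  shift of the projection at time \<open>m\<close> of the error at time 0. Hannan's condition thus
  becomes a statement about the expansion of the single variable \<open>\<epsilon>0\<close>.\<close>

lemma L2_norm_innov: "L2_norm M (innov m) = L2_norm M (proj_op M T F0 0 (\<epsilon> (- m)))"
proof -
  have i: "integrable M \<epsilon>0" using sq_integrable_\<epsilon>0 by (rule sq_integrable_integrable)
  have m: "innov m \<in> borel_measurable M" by (rule mart_diffD[OF mart_diff_innov])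
  have "AE \<omega> in M. proj_op M T F0 0 (\<epsilon> (- m)) \<omega> = innov m (shift (- m) \<omega>)"
    using cexp_shift[OF i, of m "- m"] cexp_shift[OF i, of "m - 1" "- m"]
    by eventually_elim (simp add: proj_op_def error_def)
  then have "L2_norm M (proj_op M T F0 0 (\<epsilon> (- m))) = L2_norm M (\<lambda>\<omega>. innov m (shift (- m) \<omega>))"
    by (rule L2_norm_cong_AE)
      (auto intro: mart_diffD(3)[OF proj_op_mart_diff[OF sq_integrable_\<epsilon>]] measurable_shift m)
  also have "\<dots> = L2_norm M (innov m)" by (rule L2_norm_shift[OF mart_diffD(2)[OF mart_diff_innov]])
  finally show ?thesis by simp
qed

lemma innov_summable: "(\<lambda>m. L2_norm M (innov m)) summable_on UNIV"
proof -
  have "(\<lambda>m. L2_norm M (proj_op M T F0 0 (\<epsilon> (- m)))) summable_on UNIV"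
    using summable_on_reindex_bij_betw[of uminus UNIV UNIV "\<lambda>m. L2_norm M (proj_op M T F0 0 (\<epsilon> m))"] hannan
    by (simp add: bij_uminus)
  then show ?thesis by (simp add: L2_norm_innov)
qed

definition hannan_const :: real where "hannan_const = (\<Sum>\<^sub>\<infinity>m. L2_norm M (innov m))"

lemma innov_sum_le: "finite J \<Longrightarrow> (\<Sum>m\<in>J. L2_norm M (innov m)) \<le> hannan_const"
  unfolding hannan_const_def
  by (rule finite_sum_le_infsum[OF innov_summable]) (auto simp: L2_norm_nonneg)

text \<open>Smallness is asked of all finite sets off \<open>J\<close>, because the remainder will
  be a limit of sums over windows with \<open>J\<close> removed.\<close>

lemma innov_tail:
  assumes "0 < \<delta>"
  shows "\<exists>J. finite J \<and> (\<forall>K. finite K \<longrightarrow> K \<inter> J = {} \<longrightarrow> (\<Sum>m\<in>K. L2_norm M (innov m)) \<le> \<delta>)"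
proof -
  have "(sum (\<lambda>m. L2_norm M (innov m)) \<longlongrightarrow> hannan_const) (finite_subsets_at_top UNIV)"
    unfolding hannan_const_def using has_sum_infsum[OF innov_summable] by (simp add: has_sum_def)
  then have "\<forall>\<^sub>F J in finite_subsets_at_top UNIV. hannan_const - \<delta> < (\<Sum>m\<in>J. L2_norm M (innov m))"
    by (rule order_tendstoD) (use assms in simp)
  then obtain J where J: "finite J" "hannan_const - \<delta> < (\<Sum>m\<in>J. L2_norm M (innov m))"
    unfolding eventually_finite_subsets_at_top by blast
  have "(\<Sum>m\<in>K. L2_norm M (innov m)) \<le> \<delta>" if K: "finite K" "K \<inter> J = {}" for K
  proof -
    have "(\<Sum>m\<in>K. L2_norm M (innov m)) + (\<Sum>m\<in>J. L2_norm M (innov m)) = (\<Sum>m\<in>K \<union> J. L2_norm M (innov m))"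
      by (rule sum.union_disjoint[symmetric]) (use K J in auto)
    also have "\<dots> \<le> hannan_const" by (rule innov_sum_le) (use K J in auto)
    finally show ?thesis using J by simp
  qed
  with J show ?thesis by blast
qed

lemma filt_infty_sets: "sets (filt_infty M T F0) = sigma_sets (space M) (\<Union>i. sets (\<F> i))"
  and filt_infty_space: "space (filt_infty M T F0) = space M"
proof -
  have "(\<Union>i. sets (\<F> i)) \<subseteq> Pow (space M)"
    using sets.sets_into_space[of _ "\<F> _"] by fastforce
  then show "sets (filt_infty M T F0) = sigma_sets (space M) (\<Union>i. sets (\<F> i))"
    "space (filt_infty M T F0) = space M" by (auto simp: filt_infty_def)
qed

lemma filt_infty_subalgebra: "subalgebra M (filt_infty M T F0)"
  unfolding subalgebra_def filt_infty_sets filt_infty_space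
  using filt_subalgebra by (auto simp: subalgebra_def intro!: sets.sigma_sets_subset)

text \<open>Hannan's condition makes the increments absolutely summable in L2, so completeness
  provides a limit \<open>G\<close>. It has the same integrals as \<open>\<epsilon>0\<close> over
  every set of every \<open>\<F> i\<close>, hence over every set of the algebra they generate. Both
  variables are measurable for that algebra and therefore agree almost surely.\<close>

lemma forward_martingale: "(\<lambda>n. L2_norm M (\<lambda>\<omega>. \<epsilon>0 \<omega> - cexp (int n) \<epsilon>0 \<omega>)) \<longlonglongrightarrow> 0"
proof -
  let ?Finf = "filt_infty M T F0"
  have i0: "integrable M \<epsilon>0" using sq_integrable_\<epsilon>0 by (rule sq_integrable_integrable)
  have e0m [measurable]: "\<epsilon>0 \<in> borel_measurable M" using sq_integrable_\<epsilon>0 by (simp add: sq_integrable_def)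
  define h where "h k = (case k of 0 \<Rightarrow> cexp 0 \<epsilon>0 | Suc k \<Rightarrow> innov (int (Suc k)))" for k
  have hsq: "sq_integrable M (h k)" for k
    by (cases k) (auto simp: h_def intro: sq_integrable_cexp sq_integrable_\<epsilon>0 mart_diffD[OF mart_diff_innov])
  have hsum: "(\<Sum>k<Suc n. h k \<omega>) = cexp (int n) \<epsilon>0 \<omega>" for n \<omega>
    by (induction n) (auto simp: h_def proj_op_def)
  have "(\<lambda>m. L2_norm M (innov m)) summable_on range (\<lambda>k. int (Suc k))"
    by (rule summable_on_subset_banach[OF innov_summable]) simp
  then have "((\<lambda>m. L2_norm M (innov m)) \<circ> (\<lambda>k. int (Suc k))) summable_on UNIV"
    by (subst (asm) summable_on_reindex) (auto simp: inj_def)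
  then have "summable (\<lambda>k. L2_norm M (h (Suc k)))"
    unfolding o_def h_def using summable_on_imp_summable by auto
  then have summ: "summable (\<lambda>k. L2_norm M (h k))" using summable_Suc_iff by blast
  note conv = L2_series_converges[OF hsq summ]
  define G where "G \<omega> = (\<Sum>k. h k \<omega>)" for \<omega>
  have tail: "(\<lambda>n. L2_norm M (\<lambda>\<omega>. G \<omega> - cexp (int n) \<epsilon>0 \<omega>)) \<longlonglongrightarrow> 0"
  proof (rule real_tendsto_sandwich[OF _ _ tendsto_const])
    show "(\<lambda>n. \<Sum>k. L2_norm M (h (k + Suc n))) \<longlonglongrightarrow> 0"
      using suminf_exist_split2[OF summ] by (rule LIMSEQ_Suc)
    show "\<forall>\<^sub>F n in sequentially. L2_norm M (\<lambda>\<omega>. G \<omega> - cexp (int n) \<epsilon>0 \<omega>) \<le> (\<Sum>k. L2_norm M (h (k + Suc n)))"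
      using conv(3)[of "Suc _"] unfolding hsum G_def by simp
  qed (simp add: L2_norm_nonneg)
  have sqd: "sq_integrable M (\<lambda>\<omega>. G \<omega> - cexp (int n) \<epsilon>0 \<omega>)" for n
    using conv(2)[of "Suc n"] unfolding hsum G_def .
  have sqG: "sq_integrable M G" using sq_integrable_add[OF sqd[of 0] sq_integrable_cexp(1)[OF sq_integrable_\<epsilon>0, of 0]] by simp
  have GM [measurable]: "G \<in> borel_measurable M" using sqG by (simp add: sq_integrable_def)
  let ?d = "\<lambda>\<omega>. G \<omega> - \<epsilon>0 \<omega>"
  have sqd': "sq_integrable M ?d" by (intro sq_integrable_diff sqG sq_integrable_\<epsilon>0)
  have id: "integrable M ?d" using sqd' by (rule sq_integrable_integrable)
  have sub: "subalgebra ?Finf (\<F> i)" for i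
    unfolding subalgebra_def filt_infty_sets filt_infty_space by auto
  have dm: "?d \<in> borel_measurable ?Finf"
  proof -
    have "h k \<in> borel_measurable ?Finf" for k
      by (cases k) (auto simp: h_def intro: measurable_from_subalg[OF sub] borel_measurable_cond_exp mart_diffD(1)[OF mart_diff_innov])
    then have "G \<in> borel_measurable ?Finf" unfolding G_def by (rule borel_measurable_suminf)
    then show ?thesis using \<epsilon>0_filt_infty by (rule borel_measurable_diff)
  qed
  have base: "(\<integral>\<omega>\<in>A. ?d \<omega> \<partial>M) = 0" if A: "A \<in> sets (\<F> i)" for A i
  proof -
    have AM: "A \<in> sets M" using A filt_subalgebra by (auto simp: subalgebra_def)
    \<comment> \<open>As soon as \<open>A\<close> belongs to \<open>\<F> (int n)\<close>, the
      variable may be replaced over \<open>A\<close> by its conditional expectation, and the right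
      side tends to 0.\<close>
    have bound: "\<bar>\<integral>\<omega>\<in>A. ?d \<omega> \<partial>M\<bar> \<le> L2_norm M (\<lambda>\<omega>. G \<omega> - cexp (int n) \<epsilon>0 \<omega>)" if n: "n \<ge> nat i" for n
    proof -
      have A': "A \<in> sets (\<F> (int n))" by (rule subsetD[OF filt_mono A]) (use n in simp)
      have ic: "integrable M (cexp (int n) \<epsilon>0)" by (rule filt.real_cond_exp_int(1)[OF i0])
      have iG: "integrable M G" using sqG by (rule sq_integrable_integrable)
      have si: "set_integrable M A f" if "integrable M f" for f :: "'a \<Rightarrow> real"
        using that AM unfolding set_integrable_def by (rule integrable_mult_indicator[rotated])
      have "(\<integral>\<omega>\<in>A. ?d \<omega> \<partial>M) = (\<integral>\<omega>\<in>A. G \<omega> \<partial>M) - (\<integral>\<omega>\<in>A. \<epsilon>0 \<omega> \<partial>M)"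
        by (intro set_integral_diff si iG i0)
      also have "\<dots> = (\<integral>\<omega>\<in>A. G \<omega> \<partial>M) - (\<integral>\<omega>\<in>A. cexp (int n) \<epsilon>0 \<omega> \<partial>M)"
        using filt.real_cond_exp_intA[OF i0 A'] by simp
      also have "\<dots> = (\<integral>\<omega>\<in>A. G \<omega> - cexp (int n) \<epsilon>0 \<omega> \<partial>M)"
        by (intro set_integral_diff(2)[symmetric] si iG ic)
      also have "\<dots> = (\<integral>\<omega>. indicator A \<omega> * (G \<omega> - cexp (int n) \<epsilon>0 \<omega>) \<partial>M)"
        by (simp add: set_lebesgue_integral_def)
      also have "\<bar>\<dots>\<bar> \<le> (\<integral>\<omega>. \<bar>indicator A \<omega> * (G \<omega> - cexp (int n) \<epsilon>0 \<omega>)\<bar> \<partial>M)"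
        by (rule integral_abs_bound)
      also have "\<dots> \<le> (\<integral>\<omega>. \<bar>G \<omega> - cexp (int n) \<epsilon>0 \<omega>\<bar> \<partial>M)"
      proof (rule integral_mono)
        show "integrable M (\<lambda>\<omega>. \<bar>indicator A \<omega> * (G \<omega> - cexp (int n) \<epsilon>0 \<omega>)\<bar>)"
          using integrable_mult_indicator[OF AM, of "\<lambda>\<omega>. G \<omega> - cexp (int n) \<epsilon>0 \<omega>"] iG ic
          by (intro integrable_abs) simp
      qed (use iG ic in \<open>auto simp: indicator_def\<close>)
      also have "\<dots> \<le> L2_norm M (\<lambda>\<omega>. G \<omega> - cexp (int n) \<epsilon>0 \<omega>)" by (rule integral_abs_le_L2_norm[OF sqd])
      finally show ?thesis .
    qed
    have "\<bar>\<integral>\<omega>\<in>A. ?d \<omega> \<partial>M\<bar> \<le> 0" by (rule LIMSEQ_le_const[OF tail]) (use bound in blast)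
    then show ?thesis by simp
  qed
  have base': "(\<integral>\<omega>\<in>A. ?d \<omega> \<partial>M) = 0" if A: "A \<in> sets ?Finf" for A
  proof -
    have "Int_stable (\<Union>i. sets (\<F> i))"
    proof (rule Int_stableI)
      fix a b assume "a \<in> (\<Union>i. sets (\<F> i))" "b \<in> (\<Union>i. sets (\<F> i))"
      then obtain i j where "a \<in> sets (\<F> i)" "b \<in> sets (\<F> j)" by auto
      then have "a \<in> sets (\<F> (max i j))" "b \<in> sets (\<F> (max i j))"
        using filt_mono[of i "max i j"] filt_mono[of j "max i j"] by auto
      then show "a \<inter> b \<in> (\<Union>i. sets (\<F> i))" by blast
    qed
    moreover have "(\<Union>i. sets (\<F> i)) \<subseteq> Pow (space M)"
      using sets.sets_into_space[of _ "\<F> _"] by fastforce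
    ultimately show ?thesis using A unfolding filt_infty_sets
    proof (induction rule: sigma_sets_induct_disjoint)
      case (basic A) then show ?case using base by auto
    next
      case empty then show ?case by (simp add: set_lebesgue_integral_def)
    next
      case (compl A)
      have AM: "A \<in> sets M"
        using compl(1) filt_infty_subalgebra unfolding subalgebra_def filt_infty_sets by blast
      have "(\<integral>\<omega>\<in>space M. ?d \<omega> \<partial>M) = 0"
        by (rule base[of "space M" 0]) (use sets.top[of "\<F> 0"] in simp)
      then have "(\<integral>\<omega>. ?d \<omega> \<partial>M) = 0" using set_integral_space[OF id] by simp
      moreover have "(\<integral>\<omega>\<in>space M - A. ?d \<omega> \<partial>M) = (\<integral>\<omega>. ?d \<omega> - indicator A \<omega> * ?d \<omega> \<partial>M)"
        unfolding set_lebesgue_integral_def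
        by (intro Bochner_Integration.integral_cong) (auto simp: indicator_def)
      moreover have "\<dots> = (\<integral>\<omega>. ?d \<omega> \<partial>M) - (\<integral>\<omega>. indicator A \<omega> * ?d \<omega> \<partial>M)"
        using integrable_mult_indicator[OF AM id] id by (intro Bochner_Integration.integral_diff) simp_all
      ultimately show ?case using compl(2) by (simp add: set_lebesgue_integral_def)
    next
      case (union A)
      have AM: "A n \<in> sets M" for n
        using union(2) filt_infty_subalgebra unfolding subalgebra_def filt_infty_sets by blast
      have "(\<integral>\<omega>\<in>(\<Union>i. A i). ?d \<omega> \<partial>M) = (\<Sum>i. \<integral>\<omega>\<in>A i. ?d \<omega> \<partial>M)"
      proof (rule lebesgue_integral_countable_add)
        show "set_integrable M (\<Union>i. A i) ?d"
          unfolding set_integrable_def using AM id by (intro integrable_mult_indicator) auto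
      qed (use union AM in \<open>auto simp: disjoint_family_on_def\<close>)
      then show ?case using union by simp
    qed
  qed
  interpret S: finite_measure_subalgebra M ?Finf
    by unfold_locales (rule filt_infty_subalgebra)
  \<comment> \<open>The conditional expectation of \<open>?d\<close> is 0 because the integrals
    vanish, and it is \<open>?d\<close> itself by measurability.\<close>
  have "AE \<omega> in M. real_cond_exp M ?Finf ?d \<omega> = 0"
    by (rule S.real_cond_exp_charact) (use base' id in \<open>auto simp: set_lebesgue_integral_def\<close>)
  moreover have "AE \<omega> in M. real_cond_exp M ?Finf ?d \<omega> = ?d \<omega>"
    by (rule S.real_cond_exp_F_meas[OF id dm])
  ultimately have ae: "AE \<omega> in M. G \<omega> = \<epsilon>0 \<omega>" by eventually_elim simp
  have "L2_norm M (\<lambda>\<omega>. \<epsilon>0 \<omega> - cexp (int n) \<epsilon>0 \<omega>) = L2_norm M (\<lambda>\<omega>. G \<omega> - cexp (int n) \<epsilon>0 \<omega>)" for n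
    by (rule L2_norm_cong_AE) (use ae in auto)
  then show ?thesis using tail by simp
qed

text \<open>The sum over the window telescopes to a difference of two conditional expectations of
  \<open>\<epsilon>0\<close>. The one at time \<open>N\<close> tends to \<open>\<epsilon>0\<close>,
  the one at time \<open>- N\<close> to the mean, which is 0.\<close>

lemma innov_expansion:
  "(\<lambda>N. L2_norm M (\<lambda>\<omega>. \<epsilon>0 \<omega> - (\<Sum>m\<in>{- int N<..int N}. innov m \<omega>))) \<longlonglongrightarrow> 0"
proof (rule real_tendsto_sandwich[OF _ _ tendsto_const])
  note sq = sq_integrable_cexp(1)[OF sq_integrable_\<epsilon>0]
  show "(\<lambda>N. L2_norm M (\<lambda>\<omega>. \<epsilon>0 \<omega> - cexp (int N) \<epsilon>0 \<omega>) + L2_norm M (cexp (- int N) \<epsilon>0)) \<longlonglongrightarrow> 0"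
    using tendsto_add[OF forward_martingale reverse_martingale[OF sq_integrable_\<epsilon>0]] mean_zero by simp
  show "\<forall>\<^sub>F N in sequentially. L2_norm M (\<lambda>\<omega>. \<epsilon>0 \<omega> - (\<Sum>m\<in>{- int N<..int N}. innov m \<omega>))
     \<le> L2_norm M (\<lambda>\<omega>. \<epsilon>0 \<omega> - cexp (int N) \<epsilon>0 \<omega>) + L2_norm M (cexp (- int N) \<epsilon>0)"
  proof (intro always_eventually allI)
    fix N
    have "(\<lambda>\<omega>. \<epsilon>0 \<omega> - (\<Sum>m\<in>{- int N<..int N}. innov m \<omega>))
        = (\<lambda>\<omega>. (\<epsilon>0 \<omega> - cexp (int N) \<epsilon>0 \<omega>) + cexp (- int N) \<epsilon>0 \<omega>)"
      by (subst proj_op_telescope) auto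
    then show "L2_norm M (\<lambda>\<omega>. \<epsilon>0 \<omega> - (\<Sum>m\<in>{- int N<..int N}. innov m \<omega>))
     \<le> L2_norm M (\<lambda>\<omega>. \<epsilon>0 \<omega> - cexp (int N) \<epsilon>0 \<omega>) + L2_norm M (cexp (- int N) \<epsilon>0)"
      using L2_norm_add_le[OF sq_integrable_diff[OF sq_integrable_\<epsilon>0 sq[of "int N"]] sq[of "- int N"]] by simp
  qed
qed (simp add: L2_norm_nonneg)

text \<open>In L2 the remainder is a limit of sums of innovations over growing windows with
  \<open>J\<close> removed. Each of these is a finite sum of white noises, and their spectral bounds
  add up to at most \<open>\<delta>\<close>.\<close>

lemma spec_bound_remainder:
  assumes J: "finite J" and \<delta>: "\<And>K. finite K \<Longrightarrow> K \<inter> J = {} \<Longrightarrow> (\<Sum>m\<in>K. L2_norm M (innov m)) \<le> \<delta>"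
  shows "spec_bound M (\<lambda>i \<omega>. \<epsilon> i \<omega> - (\<Sum>m\<in>J. innov m (shift i \<omega>))) \<delta>"
proof (rule spec_bound_limit)
  let ?K = "\<lambda>N::nat. {- int N<..int N} - J"
  \<comment> \<open>From \<open>N0\<close> on the half-open window contains all of \<open>J\<close>,
    so that the two sums to be compared agree.\<close>
  obtain N0 where N0: "\<And>m. m \<in> J \<Longrightarrow> \<bar>m\<bar> < int N0"
  proof -
    have "\<bar>m\<bar> < int (nat (\<Sum>m\<in>J. \<bar>m\<bar>) + 1)" if "m \<in> J" for m
      using member_le_sum[OF that, of "\<lambda>m. \<bar>m\<bar>"] J by simp
    then show ?thesis using that by blast
  qed
  note sqi = mart_diffD(2)[OF mart_diff_innov]
  show "spec_bound M (\<lambda>i \<omega>. \<Sum>m\<in>?K N. innov m (shift i \<omega>)) \<delta>" for N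
    by (rule spec_bound_mono[OF spec_bound_sum[OF mart_diff_spec_bound[OF mart_diff_innov]]]) (auto intro: \<delta>)
  show "sq_integrable M (\<lambda>\<omega>. \<epsilon> i \<omega> - (\<Sum>m\<in>J. innov m (shift i \<omega>)))" for i
    by (intro sq_integrable_diff sq_integrable_\<epsilon> sq_integrable_sum sq_integrable_shift sqi)
  fix i
  show "(\<lambda>N. L2_norm M (\<lambda>\<omega>. \<epsilon> i \<omega> - (\<Sum>m\<in>J. innov m (shift i \<omega>)) - (\<Sum>m\<in>?K N. innov m (shift i \<omega>)))) \<longlonglongrightarrow> 0"
  proof (rule Lim_transform_eventually[OF innov_expansion])
    show "\<forall>\<^sub>F N in sequentially. L2_norm M (\<lambda>\<omega>. \<epsilon>0 \<omega> - (\<Sum>m\<in>{- int N<..int N}. innov m \<omega>))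
      = L2_norm M (\<lambda>\<omega>. \<epsilon> i \<omega> - (\<Sum>m\<in>J. innov m (shift i \<omega>)) - (\<Sum>m\<in>?K N. innov m (shift i \<omega>)))"
      using eventually_ge_at_top[of N0]
    proof eventually_elim
      case (elim N)
      have JK: "{- int N<..int N} = J \<union> ?K N" using N0 elim by force
      have "(\<Sum>m\<in>{- int N<..int N}. innov m \<omega>) = (\<Sum>m\<in>J. innov m \<omega>) + (\<Sum>m\<in>?K N. innov m \<omega>)" for \<omega>
        by (subst JK, rule sum.union_disjoint) (use J in auto)
      then have "(\<lambda>\<omega>. \<epsilon> i \<omega> - (\<Sum>m\<in>J. innov m (shift i \<omega>)) - (\<Sum>m\<in>?K N. innov m (shift i \<omega>)))
        = (\<lambda>\<omega>. \<epsilon>0 (shift i \<omega>) - (\<Sum>m\<in>{- int N<..int N}. innov m (shift i \<omega>)))"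
        by (simp add: \<epsilon>_eq diff_diff_eq)
      then show ?case
        using L2_norm_shift[of "\<lambda>\<omega>. \<epsilon>0 \<omega> - (\<Sum>m\<in>{- int N<..int N}. innov m \<omega>)" i]
        by (simp add: sq_integrable_diff sq_integrable_\<epsilon>0 sq_integrable_sum sqi)
    qed
  qed
qed

lemma spec_bound_\<epsilon>: "spec_bound M \<epsilon> hannan_const"
  using spec_bound_remainder[of "{}" hannan_const] innov_sum_le by simp

lemma bounded_mart_diff_approx:
  assumes "0 < \<delta>"
  shows "\<exists>J V. finite J \<and> (\<forall>j\<in>J. mart_diff j (V j) \<and> (\<exists>L. AE \<omega> in M. \<bar>V j \<omega>\<bar> \<le> L)) \<and>
     spec_bound M (\<lambda>i \<omega>. \<epsilon> i \<omega> - (\<Sum>j\<in>J. V j (shift i \<omega>))) \<delta>"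
proof -
  obtain J where J: "finite J" "\<And>K. finite K \<Longrightarrow> K \<inter> J = {} \<Longrightarrow> (\<Sum>m\<in>K. L2_norm M (innov m)) \<le> \<delta> / 2"
    using innov_tail[of "\<delta> / 2"] assms by auto
  \<comment> \<open>Half of \<open>\<delta>\<close> pays for the innovations off \<open>J\<close>,
    the other half is shared evenly by those in \<open>J\<close>. The added 1 keeps the denominator
    positive for empty \<open>J\<close>.\<close>
  define d where "d = \<delta> / (2 * (real (card J) + 1))"
  have d: "0 < d" "real (card J) * d \<le> \<delta> / 2" using assms by (auto simp: d_def field_simps)
  have "\<forall>j. \<exists>V. mart_diff j V \<and> (\<exists>L. AE \<omega> in M. \<bar>V \<omega>\<bar> \<le> L) \<and> L2_norm M (\<lambda>\<omega>. innov j \<omega> - V \<omega>) \<le> d"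
    using mart_diff_bounded_approx[OF mart_diff_innov d(1)] by blast
  from choice[OF this] obtain V where V: "\<And>j. mart_diff j (V j)" "\<And>j. \<exists>L. AE \<omega> in M. \<bar>V j \<omega>\<bar> \<le> L"
    "\<And>j. L2_norm M (\<lambda>\<omega>. innov j \<omega> - V j \<omega>) \<le> d" by blast
  have "spec_bound M (\<lambda>i \<omega>. \<Sum>j\<in>J. innov j (shift i \<omega>) - V j (shift i \<omega>)) (\<Sum>j\<in>J. L2_norm M (\<lambda>\<omega>. innov j \<omega> - V j \<omega>))"
    by (rule spec_bound_sum) (rule mart_diff_spec_bound[OF mart_diff_diff[OF mart_diff_innov V(1)]])
  moreover have "(\<Sum>j\<in>J. L2_norm M (\<lambda>\<omega>. innov j \<omega> - V j \<omega>)) \<le> \<delta> / 2"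
    using sum_bounded_above[of J "\<lambda>j. L2_norm M (\<lambda>\<omega>. innov j \<omega> - V j \<omega>)" d] V(3) d(2) by simp
  ultimately have "spec_bound M (\<lambda>i \<omega>. \<Sum>j\<in>J. innov j (shift i \<omega>) - V j (shift i \<omega>)) (\<delta> / 2)"
    by (rule spec_bound_mono)
  from spec_bound_add[OF spec_bound_remainder[OF J] this]
  have "spec_bound M (\<lambda>i \<omega>. \<epsilon> i \<omega> - (\<Sum>j\<in>J. V j (shift i \<omega>))) \<delta>"
    by (simp add: sum_subtractf)
  then show ?thesis by (intro exI[of _ J] exI[of _ V] conjI ballI J(1) V(1,2))
qed

text \<open>The variable \<open>Z - E Z\<close> is a sum of finitely many martingale differences and of
  \<open>E(Z | \<F>\<^sub>-\<^sub>r) - E Z\<close>, which is small since the tail is trivial.\<close>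

lemma law_of_large_numbers:
  fixes Z :: "'a \<Rightarrow> real"
  assumes Z: "sq_integrable M Z" "Z \<in> borel_measurable (\<F> q)" and \<delta>: "0 < \<delta>"
  shows "\<exists>N. \<forall>n\<ge>N. \<forall>I\<subseteq>{1..int n}. (\<integral>\<omega>. \<bar>\<Sum>i\<in>I. Z (shift i \<omega>) - expectation Z\<bar> \<partial>M) \<le> \<delta> * real n"
proof -
  have iZ: "integrable M Z" using Z(1) by (rule sq_integrable_integrable)
  have "\<forall>\<^sub>F r in sequentially. L2_norm M (\<lambda>\<omega>. cexp (- int r) Z \<omega> - expectation Z) < \<delta> / 2"
    using reverse_martingale[OF Z(1)] by (rule order_tendstoD) (use \<delta> in simp)
  from eventually_happens'[OF sequentially_bot eventually_conj[OF this eventually_ge_at_top[of "nat (- q)"]]]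
  obtain r where r': "L2_norm M (\<lambda>\<omega>. cexp (- int r) Z \<omega> - expectation Z) < \<delta> / 2" "nat (- q) \<le> r" by blast
  note r = r'(1)
  have rq: "- int r \<le> q" using r'(2) by linarith
  let ?m = "{- int r<..q}"
  let ?R = "\<lambda>\<omega>. cexp (- int r) Z \<omega> - expectation Z"
  define A where "A = (\<Sum>m\<in>?m. L2_norm M (proj_op M T F0 m Z))"
  have A: "spec_bound M (\<lambda>i \<omega>. \<Sum>m\<in>?m. proj_op M T F0 m Z (shift i \<omega>)) A"
    unfolding A_def by (rule spec_bound_sum) (rule mart_diff_spec_bound[OF proj_op_mart_diff[OF Z(1)]])
  have sqR: "sq_integrable M ?R"
    using sq_integrable_cexp(1)[OF Z(1)] by (intro sq_integrable_diff) (auto simp: sq_integrable_def)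
  have split: "AE \<omega> in M. Z \<omega> - expectation Z = (\<Sum>m\<in>?m. proj_op M T F0 m Z \<omega>) + ?R \<omega>"
    using filt.real_cond_exp_F_meas[OF iZ Z(2)]
    by eventually_elim (simp add: proj_op_telescope[OF rq])
  \<comment> \<open>Only the cardinality of \<open>I\<close> enters. Subsets are allowed because a
    shifted diagonal of a square meets only part of the indices. The martingale part is of order
    \<open>sqrt n\<close>, the rest at most \<open>n\<close> times the small norm of
    \<open>?R\<close>.\<close>
  have main: "(\<integral>\<omega>. \<bar>\<Sum>i\<in>I. Z (shift i \<omega>) - expectation Z\<bar> \<partial>M) \<le> A * sqrt (real n) + real n * (\<delta> / 2)"
    if I: "I \<subseteq> {1..int n}" for I n
  proof -
    have fI: "finite I" using I finite_subset by blast
    have cI: "card I \<le> n" using card_mono[OF _ I] by simp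
    let ?S = "\<lambda>\<omega>. \<Sum>i\<in>I. \<Sum>m\<in>?m. proj_op M T F0 m Z (shift i \<omega>)"
    have ae: "AE \<omega> in M. \<forall>i\<in>I. Z (shift i \<omega>) - expectation Z = (\<Sum>m\<in>?m. proj_op M T F0 m Z (shift i \<omega>)) + ?R (shift i \<omega>)"
      by (intro AE_finite_allI fI AE_shift[OF split])
    have sqZ: "sq_integrable M (\<lambda>\<omega>. Z (shift i \<omega>) - expectation Z)" for i
      by (rule sq_integrable_diff[OF sq_integrable_shift[OF Z(1)]]) (simp add: sq_integrable_def)
    have sqS: "sq_integrable M ?S" by (intro sq_integrable_sum spec_boundD(2)[OF A])
    have sqR': "sq_integrable M (\<lambda>\<omega>. \<Sum>i\<in>I. ?R (shift i \<omega>))"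
      by (intro sq_integrable_sum sq_integrable_shift[OF sqR])
    have "(\<integral>\<omega>. \<bar>\<Sum>i\<in>I. Z (shift i \<omega>) - expectation Z\<bar> \<partial>M) \<le> L2_norm M (\<lambda>\<omega>. \<Sum>i\<in>I. Z (shift i \<omega>) - expectation Z)"
      by (intro integral_abs_le_L2_norm sq_integrable_sum sqZ)
    also have "\<dots> = L2_norm M (\<lambda>\<omega>. ?S \<omega> + (\<Sum>i\<in>I. ?R (shift i \<omega>)))"
    proof (rule L2_norm_cong_AE)
      show "AE \<omega> in M. (\<Sum>i\<in>I. Z (shift i \<omega>) - expectation Z) = ?S \<omega> + (\<Sum>i\<in>I. ?R (shift i \<omega>))"
        using ae by eventually_elim (simp only: sum.distrib[symmetric] cong: sum.cong)
      show "(\<lambda>\<omega>. \<Sum>i\<in>I. Z (shift i \<omega>) - expectation Z) \<in> borel_measurable M"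
        by (intro sq_integrable_measurable sq_integrable_sum sqZ)
      show "(\<lambda>\<omega>. ?S \<omega> + (\<Sum>i\<in>I. ?R (shift i \<omega>))) \<in> borel_measurable M"
        by (intro sq_integrable_measurable sq_integrable_add sqS sqR')
    qed
    also have "\<dots> \<le> L2_norm M ?S + L2_norm M (\<lambda>\<omega>. \<Sum>i\<in>I. ?R (shift i \<omega>))"
      by (rule L2_norm_add_le[OF sqS sqR'])
    also have "L2_norm M ?S \<le> A * L2_set (\<lambda>_. 1) I"
      using spec_boundD(4)[OF A fI, of "\<lambda>_. 1"] by simp
    also have "\<dots> \<le> A * sqrt (real n)"
      using cI spec_boundD(1)[OF A] by (intro mult_left_mono) (simp_all add: L2_set_constant)
    also have "L2_norm M (\<lambda>\<omega>. \<Sum>i\<in>I. ?R (shift i \<omega>)) \<le> (\<Sum>i\<in>I. L2_norm M (\<lambda>\<omega>. ?R (shift i \<omega>)))"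
      by (intro L2_norm_sum_le sq_integrable_shift[OF sqR])
    also have "\<dots> = real (card I) * L2_norm M ?R" using L2_norm_shift[OF sqR] by simp
    also have "\<dots> \<le> real n * (\<delta> / 2)"
      using cI r \<delta> by (intro mult_mono) (auto simp: L2_norm_nonneg)
    finally show ?thesis by simp
  qed
  \<comment> \<open>Beyond this \<open>N\<close> the term \<open>A * sqrt n\<close> is at most half
    of \<open>\<delta> * n\<close>.\<close>
  obtain N :: nat where "(2 * A / \<delta>)\<^sup>2 \<le> real N"
    using real_arch_simple by blast
  then have N: "2 * A / \<delta> \<le> sqrt (real N)" by (rule real_le_rsqrt)
  have "A * sqrt (real n) + real n * (\<delta> / 2) \<le> \<delta> * real n" if "n \<ge> N" for n
  proof -
    have "2 * A / \<delta> \<le> sqrt (real n)" by (rule order_trans[OF N]) (use that in simp)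
    then have "2 * A \<le> sqrt (real n) * \<delta>" using \<delta> by (simp only: pos_divide_le_eq)
    then have "2 * A * sqrt (real n) \<le> sqrt (real n) * \<delta> * sqrt (real n)" by (rule mult_right_mono) simp
    also have "\<dots> = \<delta> * (sqrt (real n) * sqrt (real n))" by (simp only: mult_ac)
    also have "sqrt (real n) * sqrt (real n) = real n" by simp
    finally have "2 * (A * sqrt (real n)) \<le> \<delta> * real n" by (simp only: mult.assoc)
    moreover have "real n * (\<delta> / 2) = \<delta> * real n / 2" by simp
    ultimately show ?thesis by linarith
  qed
  note large = this
  show ?thesis
  proof (intro exI allI impI)
    fix n I assume "n \<ge> N" "I \<subseteq> {1..int n}"
    then show "(\<integral>\<omega>. \<bar>\<Sum>i\<in>I. Z (shift i \<omega>) - expectation Z\<bar> \<partial>M) \<le> \<delta> * real n"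
      by (intro order_trans[OF main large])
  qed
qed

end

section \<open>Autocovariances of the errors\<close>

lemma (in hannan_process) integral_\<epsilon>_\<epsilon>: "(\<integral>\<omega>. \<epsilon> a \<omega> * \<epsilon> b \<omega> \<partial>M) = autocov M \<epsilon> (b - a)"
proof -
  have [measurable]: "\<epsilon> k \<in> borel_measurable M" for k
    by (rule sq_integrable_measurable[OF sq_integrable_\<epsilon>])
  have "autocov M \<epsilon> (b - a) = (\<integral>\<omega>. \<epsilon> 0 (shift a \<omega>) * \<epsilon> (b - a) (shift a \<omega>) \<partial>M)"
    unfolding autocov_def by (rule integral_shift[symmetric, of "\<lambda>\<omega>. \<epsilon> 0 \<omega> * \<epsilon> (b - a) \<omega>"]) measurable
  also have "\<dots> = (\<integral>\<omega>. \<epsilon> a \<omega> * \<epsilon> b \<omega> \<partial>M)"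
    by (rule Bochner_Integration.integral_cong) (simp_all add: \<epsilon>_eq shift_add[symmetric])
  finally show ?thesis by simp
qed

lemma (in hannan_process) autocov_minus: "autocov M \<epsilon> (- k) = autocov M \<epsilon> k"
  using integral_\<epsilon>_\<epsilon>[of 0 k] integral_\<epsilon>_\<epsilon>[of k 0] by (simp add: mult.commute)

text \<open>By orthogonality \<open>innov m\<close> meets the shift by \<open>k\<close> of
  \<open>innov m'\<close> only if \<open>k = m - m'\<close>. Summing over \<open>k\<close> thus
  counts each pair of innovations at most once, and the products of norms over all pairs add up to
  at most the square of the Hannan sum.\<close>

lemma (in hannan_process) autocov_sum_le:
  assumes K: "finite K"
  shows "(\<Sum>k\<in>K. \<bar>autocov M \<epsilon> k\<bar>) \<le> hannan_const\<^sup>2"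
proof (rule LIMSEQ_le_const2)
  \<comment> \<open>The counting is done for finite windows, where sums and integrals may be
    exchanged; the L2 limit is taken afterwards, for each lag separately.\<close>
  define X where "X N \<omega> = (\<Sum>m\<in>{- int N<..int N}. innov m \<omega>)" for N \<omega>
  note sqi = mart_diffD(2)[OF mart_diff_innov]
  have sqX: "sq_integrable M (X N)" for N unfolding X_def by (intro sq_integrable_sum sqi)
  let ?g = "\<lambda>N k. \<integral>\<omega>. X N \<omega> * X N (shift k \<omega>) \<partial>M"
  have lim: "(\<lambda>N. L2_norm M (\<lambda>\<omega>. \<epsilon>0 \<omega> - X N \<omega>)) \<longlonglongrightarrow> 0"
    using innov_expansion by (simp add: X_def)
  have lim_g: "(\<lambda>N. ?g N k) \<longlonglongrightarrow> autocov M \<epsilon> k" for k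
  proof -
    define r where "r N = L2_norm M (\<lambda>\<omega>. \<epsilon>0 \<omega> - X N \<omega>)" for N
    have "\<bar>?g N k - autocov M \<epsilon> k\<bar> \<le> r N * L2_norm M \<epsilon>0 + (L2_norm M \<epsilon>0 + r N) * r N" for N
    proof -
      let ?d = "\<lambda>\<omega>. \<epsilon>0 \<omega> - X N \<omega>"
      have sqd: "sq_integrable M ?d" by (intro sq_integrable_diff sq_integrable_\<epsilon>0 sqX)
      have XN: "L2_norm M (X N) \<le> L2_norm M \<epsilon>0 + r N"
        using L2_norm_diff_le[OF sq_integrable_\<epsilon>0 sqd] by (simp add: r_def)
      have "autocov M \<epsilon> k - ?g N k = (\<integral>\<omega>. \<epsilon>0 \<omega> * \<epsilon>0 (shift k \<omega>) - X N \<omega> * X N (shift k \<omega>) \<partial>M)"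
        unfolding autocov_def \<epsilon>_eq shift_0
        by (rule Bochner_Integration.integral_diff[symmetric]; rule sq_integrable_mult_integrable)
          (rule sq_integrable_\<epsilon>0 sqX sq_integrable_shift[OF sqX] sq_integrable_shift[OF sq_integrable_\<epsilon>0])+
      also have "\<dots> = (\<integral>\<omega>. ?d \<omega> * \<epsilon>0 (shift k \<omega>) + X N \<omega> * ?d (shift k \<omega>) \<partial>M)"
        by (simp add: algebra_simps)
      also have "\<dots> = (\<integral>\<omega>. ?d \<omega> * \<epsilon>0 (shift k \<omega>) \<partial>M) + (\<integral>\<omega>. X N \<omega> * ?d (shift k \<omega>) \<partial>M)"
        by (intro Bochner_Integration.integral_add sq_integrable_mult_integrable
            sq_integrable_shift[OF sqd] sq_integrable_shift[OF sq_integrable_\<epsilon>0] sqX sqd)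
      finally have "\<bar>autocov M \<epsilon> k - ?g N k\<bar>
          \<le> L2_norm M ?d * L2_norm M (\<lambda>\<omega>. \<epsilon>0 (shift k \<omega>)) + L2_norm M (X N) * L2_norm M (\<lambda>\<omega>. ?d (shift k \<omega>))"
        using L2_norm_cauchy_schwarz_integral[OF sqd sq_integrable_shift[OF sq_integrable_\<epsilon>0, of k]]
          L2_norm_cauchy_schwarz_integral[OF sqX sq_integrable_shift[OF sqd, of k], of N]
        by linarith
      also have "\<dots> = r N * L2_norm M \<epsilon>0 + L2_norm M (X N) * r N"
        by (simp only: L2_norm_shift[OF sqd] L2_norm_shift[OF sq_integrable_\<epsilon>0] r_def)
      also have "\<dots> \<le> r N * L2_norm M \<epsilon>0 + (L2_norm M \<epsilon>0 + r N) * r N"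
        by (intro add_left_mono mult_right_mono XN) (simp add: r_def L2_norm_nonneg)
      finally show ?thesis by linarith
    qed
    moreover have "(\<lambda>N. r N * L2_norm M \<epsilon>0 + (L2_norm M \<epsilon>0 + r N) * r N) \<longlonglongrightarrow> 0"
      using lim unfolding r_def by (auto intro!: tendsto_eq_intros)
    ultimately have "(\<lambda>N. ?g N k - autocov M \<epsilon> k) \<longlonglongrightarrow> 0"
      by (intro Lim_null_comparison[of "\<lambda>N. ?g N k - autocov M \<epsilon> k"] always_eventually allI) simp_all
    then show ?thesis by (simp add: LIM_zero_cancel)
  qed
  show "(\<lambda>N. \<Sum>k\<in>K. \<bar>?g N k\<bar>) \<longlonglongrightarrow> (\<Sum>k\<in>K. \<bar>autocov M \<epsilon> k\<bar>)"
    by (intro tendsto_sum tendsto_rabs lim_g)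
  have "(\<Sum>k\<in>K. \<bar>?g N k\<bar>) \<le> hannan_const\<^sup>2" for N
  proof -
    let ?J = "{- int N<..int N}" and ?n = "\<lambda>m. L2_norm M (innov m)"
    have entry: "\<bar>\<integral>\<omega>. innov m \<omega> * innov m' (shift k \<omega>) \<partial>M\<bar> \<le> (if k = m - m' then ?n m * ?n m' else 0)" for m m' k
    proof (cases "k = m - m'")
      case True
      then show ?thesis
        using L2_norm_cauchy_schwarz_integral[OF sqi sq_integrable_shift[OF sqi], of m m' k] L2_norm_shift[OF sqi] by simp
    next
      case False
      then show ?thesis using mart_diff_orthogonal[OF mart_diff_innov mart_diff_shift[OF mart_diff_innov], of m m' k] by simp
    qed
    have "\<bar>?g N k\<bar> \<le> (\<Sum>m\<in>?J. \<Sum>m'\<in>?J. if k = m - m' then ?n m * ?n m' else 0)" for k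
    proof -
      have "?g N k = (\<integral>\<omega>. (\<Sum>m\<in>?J. \<Sum>m'\<in>?J. innov m \<omega> * innov m' (shift k \<omega>)) \<partial>M)"
        by (simp add: X_def sum_product)
      also have "\<dots> = (\<Sum>m\<in>?J. \<Sum>m'\<in>?J. \<integral>\<omega>. innov m \<omega> * innov m' (shift k \<omega>) \<partial>M)"
        by (simp only: Bochner_Integration.integral_sum Bochner_Integration.integrable_sum
            sq_integrable_mult_integrable[OF sqi sq_integrable_shift[OF sqi]])
      also have "\<bar>\<dots>\<bar> \<le> (\<Sum>m\<in>?J. \<Sum>m'\<in>?J. \<bar>\<integral>\<omega>. innov m \<omega> * innov m' (shift k \<omega>) \<partial>M\<bar>)"
        by (rule order_trans[OF sum_abs sum_mono[OF sum_abs]])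
      also have "\<dots> \<le> (\<Sum>m\<in>?J. \<Sum>m'\<in>?J. if k = m - m' then ?n m * ?n m' else 0)"
        by (intro sum_mono entry)
      finally show ?thesis .
    qed
    then have "(\<Sum>k\<in>K. \<bar>?g N k\<bar>) \<le> (\<Sum>k\<in>K. \<Sum>m\<in>?J. \<Sum>m'\<in>?J. if k = m - m' then ?n m * ?n m' else 0)"
      by (rule sum_mono)
    also have "\<dots> = (\<Sum>m\<in>?J. \<Sum>m'\<in>?J. \<Sum>k\<in>K. if k = m - m' then ?n m * ?n m' else 0)"
      by (subst sum.swap) (rule sum.cong[OF refl sum.swap])
    also have "\<dots> \<le> (\<Sum>m\<in>?J. \<Sum>m'\<in>?J. ?n m * ?n m')"
      using K by (intro sum_mono) (simp add: L2_norm_nonneg)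
    also have "\<dots> = (\<Sum>m\<in>?J. ?n m)\<^sup>2" by (simp add: sum_product power2_eq_square)
    also have "\<dots> \<le> hannan_const\<^sup>2" by (intro power_mono innov_sum_le sum_nonneg L2_norm_nonneg) simp
    finally show ?thesis .
  qed
  then show "\<exists>N. \<forall>n\<ge>N. (\<Sum>k\<in>K. \<bar>?g n k\<bar>) \<le> hannan_const\<^sup>2" by blast
qed

lemma (in hannan_process) autocov_abs_summable: "(\<lambda>k. \<bar>autocov M \<epsilon> k\<bar>) summable_on UNIV"
  by (rule nonneg_bdd_above_summable_on) (auto intro!: bdd_aboveI[of _ "hannan_const\<^sup>2"] autocov_sum_le)

section \<open>Quadratic forms with Toeplitz weights\<close>

definition qsum :: "nat \<Rightarrow> (int \<Rightarrow> real) \<Rightarrow> (int \<Rightarrow> 'a \<Rightarrow> real) \<Rightarrow> (int \<Rightarrow> 'a \<Rightarrow> real) \<Rightarrow> 'a \<Rightarrow> real" where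
  "qsum n w \<eta> \<zeta> \<omega> = (\<Sum>a\<in>{1..int n}. \<Sum>b\<in>{1..int n}. w (a - b) * (\<eta> a \<omega> * \<zeta> b \<omega>))"

lemma qsum_add_left: "qsum n w (\<lambda>i \<omega>. \<eta> i \<omega> + \<eta>' i \<omega>) \<zeta> \<omega> = qsum n w \<eta> \<zeta> \<omega> + qsum n w \<eta>' \<zeta> \<omega>"
  by (simp add: qsum_def sum.distrib distrib_left distrib_right)

lemma qsum_add_right: "qsum n w \<eta> (\<lambda>i \<omega>. \<zeta> i \<omega> + \<zeta>' i \<omega>) \<omega> = qsum n w \<eta> \<zeta> \<omega> + qsum n w \<eta> \<zeta>' \<omega>"
  by (simp add: qsum_def sum.distrib distrib_left)

lemma qsum_diff_left: "qsum n w (\<lambda>i \<omega>. \<eta> i \<omega> - \<eta>' i \<omega>) \<zeta> \<omega> = qsum n w \<eta> \<zeta> \<omega> - qsum n w \<eta>' \<zeta> \<omega>"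
  by (simp add: qsum_def sum_subtractf right_diff_distrib left_diff_distrib)

lemma qsum_diff_right: "qsum n w \<eta> (\<lambda>i \<omega>. \<zeta> i \<omega> - \<zeta>' i \<omega>) \<omega> = qsum n w \<eta> \<zeta> \<omega> - qsum n w \<eta> \<zeta>' \<omega>"
  by (simp add: qsum_def sum_subtractf right_diff_distrib)

lemma qsum_transpose: "qsum n w \<eta> \<zeta> \<omega> = qsum n (\<lambda>k. w (- k)) \<zeta> \<eta> \<omega>"
  unfolding qsum_def by (subst sum.swap) (simp add: mult.commute)

lemma qsum_integrable:
  assumes "\<And>i. sq_integrable M (\<eta> i)" "\<And>i. sq_integrable M (\<zeta> i)"
  shows "integrable M (qsum n w \<eta> \<zeta>)"
  unfolding qsum_def
  by (intro Bochner_Integration.integrable_sum integrable_mult_right sq_integrable_mult_integrable assms)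

text \<open>All that the probabilistic argument uses of the lag weights. The sup bound serves the
  diagonal; the row and column bounds \<open>H\<close>, both because the weight need not be even,
  serve the two sides of the diagonal and the residuals; the last clause allows the errors to be
  replaced. \<open>C\<close> will not depend on \<open>n\<close>, while \<open>H\<close> grows like
  the bandwidth.\<close>

definition good_weight :: "'a measure \<Rightarrow> nat \<Rightarrow> real \<Rightarrow> real \<Rightarrow> (int \<Rightarrow> real) \<Rightarrow> bool" where
  "good_weight M n C H w \<longleftrightarrow> 0 \<le> C \<and> (\<forall>k. \<bar>w k\<bar> \<le> C) \<and>
     (\<forall>a\<in>{1..int n}. (\<Sum>b\<in>{1..int n}. (w (a - b))\<^sup>2) \<le> H) \<and>
     (\<forall>a\<in>{1..int n}. (\<Sum>b\<in>{1..int n}. (w (b - a))\<^sup>2) \<le> H) \<and>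
     (\<forall>\<eta> \<zeta> A B. spec_bound M \<eta> A \<longrightarrow> spec_bound M \<zeta> B \<longrightarrow>
        (\<integral>\<omega>. \<bar>qsum n w \<eta> \<zeta> \<omega>\<bar> \<partial>M) \<le> C * real n * A * B)"

context stationary_filtration
begin

text \<open>The inner sums are predictable, so the products \<open>f a\<close> below are again martingale differences.\<close>

lemma off_diagonal_bound:
  assumes U: "mart_diff j U" and L: "AE \<omega> in M. \<bar>U \<omega>\<bar> \<le> L"
    and V: "mart_diff j' V" and L': "AE \<omega> in M. \<bar>V \<omega>\<bar> \<le> L'"
    and H: "\<And>a. a \<in> {1..int n} \<Longrightarrow> (\<Sum>b\<in>{1..int n}. (w (a - b))\<^sup>2) \<le> H"
  shows "(\<integral>\<omega>. \<bar>\<Sum>a\<in>{1..int n}. \<Sum>b\<in>{1..int n}. if b + j' < a + j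
      then w (a - b) * (U (shift a \<omega>) * V (shift b \<omega>)) else 0\<bar> \<partial>M) \<le> \<bar>L\<bar> * L2_norm M V * sqrt (real n * H)"
proof -
  let ?I = "{1..int n}"
  \<comment> \<open>\<open>V\<close> shifted by \<open>b\<close> is known at time
    \<open>b + j'\<close>, and \<open>U\<close> shifted by \<open>a\<close> is an increment at time
    \<open>a + j\<close>; the strict inequality keeps exactly the terms that precede this
    increment.\<close>
  define c where "c a b = (if b + j' < a + j then w (a - b) else 0)" for a b
  define W where "W a \<omega> = (\<Sum>b\<in>?I. c a b * V (shift b \<omega>))" for a \<omega>
  define f where "f a \<omega> = U (shift a \<omega>) * W a \<omega>" for a \<omega>
  note sV = mart_diff_spec_bound[OF V]
  have Wm: "W a \<in> borel_measurable (\<F> (j + a - 1))" for a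
    unfolding W_def
  proof (intro borel_measurable_sum)
    fix b
    show "(\<lambda>\<omega>. c a b * V (shift b \<omega>)) \<in> borel_measurable (\<F> (j + a - 1))"
    proof (cases "b + j' < a + j")
      case True
      then have "(\<lambda>\<omega>. V (shift b \<omega>)) \<in> borel_measurable (\<F> (j + a - 1))"
        by (intro measurable_filt_mono[OF _ mart_diffD(1)[OF mart_diff_shift[OF V]]]) simp
      then show ?thesis by (intro borel_measurable_times) simp_all
    qed (simp add: c_def)
  qed
  have WM: "W a \<in> borel_measurable M" for a using Wm by (rule measurable_filt)
  have Wb: "AE \<omega> in M. \<bar>W a \<omega>\<bar> \<le> (\<Sum>b\<in>?I. \<bar>c a b\<bar> * L')" for a
  proof -
    have "AE \<omega> in M. \<forall>b\<in>?I. \<bar>V (shift b \<omega>)\<bar> \<le> L'"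
      by (intro AE_finite_allI AE_shift[OF L']) simp
    then show ?thesis
    proof eventually_elim
      case (elim \<omega>)
      then show ?case unfolding W_def
        by (intro order_trans[OF sum_abs] sum_mono) (auto simp: abs_mult intro: mult_left_mono)
    qed
  qed
  have fd: "mart_diff (j + a) (f a)" for a
    unfolding f_def
    by (rule mart_diff_mult_predictable[OF mart_diff_shift[OF U] AE_shift[OF L] Wm Wb])
  have sqW: "sq_integrable M (W a)" for a by (rule sq_integrable_AE_bounded[OF WM Wb])
  \<comment> \<open>The bounded factor is replaced by its bound and \<open>W a\<close> by the white
    noise estimate. A product of two merely square integrable factors need not have a second moment,
    which is why bounded differences are used.\<close>
  have f2: "(\<integral>\<omega>. (f a \<omega>)\<^sup>2 \<partial>M) \<le> L\<^sup>2 * ((L2_norm M V)\<^sup>2 * H)" if a: "a \<in> ?I" for a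
  proof -
    have "(\<integral>\<omega>. (f a \<omega>)\<^sup>2 \<partial>M) \<le> (\<integral>\<omega>. L\<^sup>2 * (W a \<omega>)\<^sup>2 \<partial>M)"
    proof (rule integral_mono_AE)
      show "integrable M (\<lambda>\<omega>. (f a \<omega>)\<^sup>2)" using mart_diffD(2)[OF fd] by (simp add: sq_integrable_def)
      show "integrable M (\<lambda>\<omega>. L\<^sup>2 * (W a \<omega>)\<^sup>2)" using sqW by (simp add: sq_integrable_def)
      show "AE \<omega> in M. (f a \<omega>)\<^sup>2 \<le> L\<^sup>2 * (W a \<omega>)\<^sup>2"
        using AE_shift[OF L, of a]
      proof eventually_elim
        case (elim \<omega>)
        then have "(U (shift a \<omega>))\<^sup>2 \<le> L\<^sup>2" by (simp add: abs_le_square_iff[symmetric])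
        then show ?case by (simp add: f_def power_mult_distrib mult_right_mono)
      qed
    qed
    also have "\<dots> = L\<^sup>2 * (\<integral>\<omega>. (W a \<omega>)\<^sup>2 \<partial>M)" by simp
    also have "(\<integral>\<omega>. (W a \<omega>)\<^sup>2 \<partial>M) \<le> (L2_norm M V)\<^sup>2 * (\<Sum>b\<in>?I. (c a b)\<^sup>2)"
      unfolding W_def by (rule spec_bound_square[OF sV]) simp
    also have "(\<Sum>b\<in>?I. (c a b)\<^sup>2) \<le> (\<Sum>b\<in>?I. (w (a - b))\<^sup>2)" by (intro sum_mono) (simp add: c_def)
    also have "\<dots> \<le> H" by (rule H[OF a])
    finally show ?thesis by (simp add: mult_left_mono)
  qed
  have "(\<integral>\<omega>. (\<Sum>a\<in>?I. f a \<omega>)\<^sup>2 \<partial>M) = (\<Sum>a\<in>?I. \<integral>\<omega>. (f a \<omega>)\<^sup>2 \<partial>M)"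
    by (rule sum_orthogonal_square) (auto intro: mart_diffD(2)[OF fd] mart_diff_orthogonal[OF fd fd])
  also have "\<dots> \<le> (\<Sum>a\<in>?I. L\<^sup>2 * ((L2_norm M V)\<^sup>2 * H))" by (rule sum_mono[OF f2])
  also have "\<dots> = (\<bar>L\<bar> * L2_norm M V)\<^sup>2 * (real n * H)" by (simp add: power_mult_distrib)
  finally have "L2_norm M (\<lambda>\<omega>. \<Sum>a\<in>?I. f a \<omega>) \<le> sqrt ((\<bar>L\<bar> * L2_norm M V)\<^sup>2 * (real n * H))"
    unfolding L2_norm_def by (rule real_sqrt_le_mono)
  also have "\<dots> = \<bar>L\<bar> * L2_norm M V * sqrt (real n * H)"
    by (simp add: real_sqrt_mult L2_norm_nonneg)
  finally have "L2_norm M (\<lambda>\<omega>. \<Sum>a\<in>?I. f a \<omega>) \<le> \<bar>L\<bar> * L2_norm M V * sqrt (real n * H)" .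
  moreover have "(\<Sum>a\<in>?I. \<Sum>b\<in>?I. if b + j' < a + j
      then w (a - b) * (U (shift a \<omega>) * V (shift b \<omega>)) else 0) = (\<Sum>a\<in>?I. f a \<omega>)" for \<omega>
    unfolding f_def W_def sum_distrib_left c_def by (intro sum.cong refl) auto
  moreover have "(\<integral>\<omega>. \<bar>\<Sum>a\<in>?I. f a \<omega>\<bar> \<partial>M) \<le> L2_norm M (\<lambda>\<omega>. \<Sum>a\<in>?I. f a \<omega>)"
    by (intro integral_abs_le_L2_norm sq_integrable_sum mart_diffD(2)[OF fd])
  ultimately show ?thesis by (simp only:)
qed

end

section \<open>Concentration of quadratic forms\<close>

lemma spec_bound_minus:
  assumes "spec_bound M \<eta> A"
  shows "spec_bound M (\<lambda>i \<omega>. - \<eta> i \<omega>) A"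
  using assms by (auto simp: spec_bound_def sq_integrable_minus sum_negf L2_norm_minus)

text \<open>The centring constant \<open>c\<close> is left free: the processes approximating the errors have
  other means, and the best constant is the mean up to a factor 2 in the error.\<close>

definition concentrates ::
  "'a measure \<Rightarrow> (nat \<Rightarrow> int \<Rightarrow> real) \<Rightarrow> (int \<Rightarrow> 'a \<Rightarrow> real) \<Rightarrow> (int \<Rightarrow> 'a \<Rightarrow> real) \<Rightarrow> bool" where
  "concentrates M w \<eta> \<zeta> \<longleftrightarrow>
     (\<forall>e>0. \<forall>\<^sub>F n in sequentially. \<exists>c. (\<integral>\<omega>. \<bar>qsum n (w n) \<eta> \<zeta> \<omega> - c\<bar> \<partial>M) \<le> e * real n)"

context finite_measure
begin

lemma integral_abs_triangle:
  fixes f g :: "'a \<Rightarrow> real"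
  assumes "integrable M f" "integrable M g"
  shows "(\<integral>\<omega>. \<bar>f \<omega> + g \<omega>\<bar> \<partial>M) \<le> (\<integral>\<omega>. \<bar>f \<omega>\<bar> \<partial>M) + (\<integral>\<omega>. \<bar>g \<omega>\<bar> \<partial>M)"
proof -
  have "(\<integral>\<omega>. \<bar>f \<omega> + g \<omega>\<bar> \<partial>M) \<le> (\<integral>\<omega>. \<bar>f \<omega>\<bar> + \<bar>g \<omega>\<bar> \<partial>M)"
    by (rule integral_mono) (use assms in \<open>auto simp: abs_triangle_ineq\<close>)
  then show ?thesis using assms by simp
qed

text \<open>The decomposition enters as the hypothesis \<open>eq\<close>, so that one lemma serves
  additivity in the left and in the right argument. The centring constants add.\<close>

lemma concentrates_add:
  assumes 1: "concentrates M w \<eta> \<zeta>" and 2: "concentrates M w \<eta>' \<zeta>'"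
    and sq: "\<And>i. sq_integrable M (\<eta> i)" "\<And>i. sq_integrable M (\<zeta> i)" "\<And>i. sq_integrable M (\<eta>' i)" "\<And>i. sq_integrable M (\<zeta>' i)"
    and eq: "\<And>n \<omega>. qsum n (w n) \<eta>'' \<zeta>'' \<omega> = qsum n (w n) \<eta> \<zeta> \<omega> + qsum n (w n) \<eta>' \<zeta>' \<omega>"
  shows "concentrates M w \<eta>'' \<zeta>''"
  unfolding concentrates_def
proof (intro allI impI)
  fix e :: real assume e: "0 < e"
  have "\<forall>\<^sub>F n in sequentially. \<exists>c. (\<integral>\<omega>. \<bar>qsum n (w n) \<eta> \<zeta> \<omega> - c\<bar> \<partial>M) \<le> e/2 * real n"
    "\<forall>\<^sub>F n in sequentially. \<exists>c. (\<integral>\<omega>. \<bar>qsum n (w n) \<eta>' \<zeta>' \<omega> - c\<bar> \<partial>M) \<le> e/2 * real n"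
    using 1 2 e unfolding concentrates_def by (meson half_gt_zero)+
  then show "\<forall>\<^sub>F n in sequentially. \<exists>c. (\<integral>\<omega>. \<bar>qsum n (w n) \<eta>'' \<zeta>'' \<omega> - c\<bar> \<partial>M) \<le> e * real n"
  proof eventually_elim
    case (elim n)
    then obtain c c' where c: "(\<integral>\<omega>. \<bar>qsum n (w n) \<eta> \<zeta> \<omega> - c\<bar> \<partial>M) \<le> e/2 * real n"
      "(\<integral>\<omega>. \<bar>qsum n (w n) \<eta>' \<zeta>' \<omega> - c'\<bar> \<partial>M) \<le> e/2 * real n" by blast
    have "(\<integral>\<omega>. \<bar>qsum n (w n) \<eta>'' \<zeta>'' \<omega> - (c + c')\<bar> \<partial>M)
        = (\<integral>\<omega>. \<bar>(qsum n (w n) \<eta> \<zeta> \<omega> - c) + (qsum n (w n) \<eta>' \<zeta>' \<omega> - c')\<bar> \<partial>M)"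
      by (simp add: eq algebra_simps)
    also have "\<dots> \<le> (\<integral>\<omega>. \<bar>qsum n (w n) \<eta> \<zeta> \<omega> - c\<bar> \<partial>M) + (\<integral>\<omega>. \<bar>qsum n (w n) \<eta>' \<zeta>' \<omega> - c'\<bar> \<partial>M)"
      by (rule integral_abs_triangle) (use qsum_integrable[OF sq(1,2)] qsum_integrable[OF sq(3,4)] in auto)
    also have "\<dots> \<le> e * real n" using c by simp
    finally show ?case by blast
  qed
qed

lemma concentrates_zero: "concentrates M w (\<lambda>_ _. 0) \<zeta>" "concentrates M w \<eta> (\<lambda>_ _. 0)"
  unfolding concentrates_def qsum_def by (auto intro!: always_eventually exI[of _ 0])

lemma concentrates_sum:
  assumes "\<And>j k. j \<in> J \<Longrightarrow> k \<in> K \<Longrightarrow> concentrates M w (\<eta> j) (\<zeta> k)"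
    and sq: "\<And>j i. sq_integrable M (\<eta> j i)" "\<And>j i. sq_integrable M (\<zeta> j i)"
  shows "concentrates M w (\<lambda>i \<omega>. \<Sum>j\<in>J. \<eta> j i \<omega>) (\<lambda>i \<omega>. \<Sum>k\<in>K. \<zeta> k i \<omega>)"
  using assms(1)
proof (induction J rule: infinite_finite_induct)
  case (insert j J)
  have "concentrates M w (\<eta> j) (\<lambda>i \<omega>. \<Sum>k\<in>K. \<zeta> k i \<omega>)"
    using insert(4)
  proof (induction K rule: infinite_finite_induct)
    case (insert k K)
    show ?case
      by (rule concentrates_add[of w "\<eta> j" "\<zeta> k" "\<eta> j" "\<lambda>i \<omega>. \<Sum>k\<in>K. \<zeta> k i \<omega>"])
        (use insert sq in \<open>auto intro: sq_integrable_sum simp: qsum_add_right\<close>)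
  qed (auto simp: concentrates_zero)
  then show ?case
    by (rule concentrates_add[of w "\<eta> j" _ "\<lambda>i \<omega>. \<Sum>j\<in>J. \<eta> j i \<omega>" "\<lambda>i \<omega>. \<Sum>k\<in>K. \<zeta> k i \<omega>"])
      (use insert sq in \<open>auto intro: sq_integrable_sum simp: qsum_add_left\<close>)
qed (auto simp: concentrates_zero)

end

context hannan_process
begin

text \<open>Sorting the pairs \<open>a\<close>, \<open>b\<close> by the order of the times
  \<open>a + j\<close> and \<open>b + j'\<close> gives two martingale transforms of order
  \<open>sqrt (n * H n)\<close>, small against \<open>n\<close>, and one diagonal. There the weight
  is constant and the products are shifts of the single variable \<open>Z\<close>.\<close>

lemma concentrates_mart_diff:
  fixes w :: "nat \<Rightarrow> int \<Rightarrow> real" and H :: "nat \<Rightarrow> real"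
  assumes w: "\<forall>\<^sub>F n in sequentially. good_weight M n C (H n) (w n)"
    and H: "(\<lambda>n. H n / real n) \<longlonglongrightarrow> 0"
    and U: "mart_diff j U" and L: "AE \<omega> in M. \<bar>U \<omega>\<bar> \<le> L"
    and V: "mart_diff j' V" and L': "AE \<omega> in M. \<bar>V \<omega>\<bar> \<le> L'"
  shows "concentrates M w (\<lambda>i \<omega>. U (shift i \<omega>)) (\<lambda>i \<omega>. V (shift i \<omega>))"
  unfolding concentrates_def
proof (intro allI impI)
  fix e :: real assume e: "0 < e"
  have C0: "0 \<le> C" using eventually_happens'[OF sequentially_bot w] by (auto simp: good_weight_def)
  \<comment> \<open>At the offset \<open>d\<close> both factors are increments at the same time:
    \<open>V\<close> shifted by \<open>d\<close> is a difference at time \<open>j\<close>.\<close>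
  define d where "d = j - j'"
  define Z where "Z \<omega> = U \<omega> * V (shift d \<omega>)" for \<omega>
  have [measurable]: "U \<in> borel_measurable M" "V \<in> borel_measurable M" using U V by (auto intro: mart_diffD)
  have Vd: "mart_diff j (\<lambda>\<omega>. V (shift d \<omega>))" using mart_diff_shift[OF V, of d] by (simp add: d_def)
  have Zm: "Z \<in> borel_measurable (\<F> j)"
    unfolding Z_def by (intro borel_measurable_times mart_diffD(1)[OF U] mart_diffD(1)[OF Vd])
  have Zb: "AE \<omega> in M. \<bar>Z \<omega>\<bar> \<le> L * L'"
    using L AE_shift[OF L', of d] by eventually_elim (auto simp: Z_def abs_mult intro: mult_mono)
  have sqZ: "sq_integrable M Z" by (rule sq_integrable_AE_bounded[OF measurable_filt[OF Zm] Zb])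
  define \<delta> where "\<delta> = e / (2 * (C + 1))"
  have \<delta>: "0 < \<delta>" "C * \<delta> \<le> e / 2" using e C0 by (auto simp: \<delta>_def field_simps)
  obtain N where N: "\<And>n I. n \<ge> N \<Longrightarrow> I \<subseteq> {1..int n} \<Longrightarrow> (\<integral>\<omega>. \<bar>\<Sum>i\<in>I. Z (shift i \<omega>) - expectation Z\<bar> \<partial>M) \<le> \<delta> * real n"
    using law_of_large_numbers[OF sqZ Zm \<delta>(1)] by blast
  define B where "B = \<bar>L\<bar> * L2_norm M V + \<bar>L'\<bar> * L2_norm M U"
  have "(\<lambda>n. B * sqrt (H n / real n)) \<longlonglongrightarrow> B * sqrt 0"
    by (intro tendsto_mult tendsto_real_sqrt tendsto_const H)
  then have "\<forall>\<^sub>F n in sequentially. B * sqrt (H n / real n) < e / 2"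
    by (rule order_tendstoD) (use e in simp)
  with w show "\<forall>\<^sub>F n in sequentially. \<exists>c. (\<integral>\<omega>. \<bar>qsum n (w n) (\<lambda>i \<omega>. U (shift i \<omega>)) (\<lambda>i \<omega>. V (shift i \<omega>)) \<omega> - c\<bar> \<partial>M) \<le> e * real n"
    using eventually_ge_at_top[of "max N 1"]
  proof eventually_elim
    case (elim n)
    then have n: "n \<ge> N" "n > 0" by auto
    let ?S = "{1..int n}" and ?u = "\<lambda>a \<omega>. U (shift a \<omega>)" and ?v = "\<lambda>a \<omega>. V (shift a \<omega>)"
    define I where "I = {a\<in>?S. a + d \<in> ?S}"
    define o1 where "o1 \<omega> = (\<Sum>a\<in>?S. \<Sum>b\<in>?S. if b + j' < a + j then w n (a - b) * (?u a \<omega> * ?v b \<omega>) else 0)" for \<omega>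
    \<comment> \<open>The other side of the diagonal, written with \<open>U\<close> and
      \<open>V\<close> exchanged and the weight reflected, so that \<open>off_diagonal_bound\<close>
      applies to it literally.\<close>
    define o2 where "o2 \<omega> = (\<Sum>b\<in>?S. \<Sum>a\<in>?S. if a + j < b + j' then (\<lambda>k. w n (- k)) (b - a) * (?v b \<omega> * ?u a \<omega>) else 0)" for \<omega>
    define D where "D \<omega> = w n (- d) * (\<Sum>a\<in>I. Z (shift a \<omega>) - expectation Z)" for \<omega>
    define c where "c = w n (- d) * (real (card I) * expectation Z)"
    have dec: "qsum n (w n) ?u ?v \<omega> - c = o1 \<omega> + o2 \<omega> + D \<omega>" if \<omega>: "\<omega> \<in> space M" for \<omega>
    proof -
      have "(\<Sum>a\<in>?S. \<Sum>b\<in>?S. if b = a + d then w n (- d) * Z (shift a \<omega>) else 0)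
          = (\<Sum>a\<in>?S. if a + d \<in> ?S then w n (- d) * Z (shift a \<omega>) else 0)"
        by (simp add: sum.delta)
      also have "\<dots> = (\<Sum>a\<in>I. w n (- d) * Z (shift a \<omega>))"
        unfolding I_def by (rule sum.inter_filter[symmetric]) simp
      also have "\<dots> = D \<omega> + c"
        by (simp add: D_def c_def sum_subtractf sum_distrib_left right_diff_distrib)
      finally have diag: "(\<Sum>a\<in>?S. \<Sum>b\<in>?S. if b = a + d then w n (- d) * Z (shift a \<omega>) else 0) = D \<omega> + c" .
      have o2': "o2 \<omega> = (\<Sum>a\<in>?S. \<Sum>b\<in>?S. if a + j < b + j' then w n (a - b) * (?u a \<omega> * ?v b \<omega>) else 0)"
        unfolding o2_def by (subst sum.swap) (intro sum.cong refl, simp add: mult.commute)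
      have "qsum n (w n) ?u ?v \<omega> = o1 \<omega> + o2 \<omega> + (\<Sum>a\<in>?S. \<Sum>b\<in>?S. if b = a + d then w n (- d) * Z (shift a \<omega>) else 0)"
        unfolding o2' o1_def qsum_def sum.distrib[symmetric]
      proof (intro sum.cong refl)
        fix a b
        have "w n (a - b) * (?u a \<omega> * ?v b \<omega>) = w n (- d) * Z (shift a \<omega>)" if "b = a + d"
          using shift_add[OF \<omega>, of d a] by (simp add: that Z_def add.commute)
        moreover have "b = a + d \<longleftrightarrow> \<not> b + j' < a + j \<and> \<not> a + j < b + j'" by (auto simp: d_def)
        ultimately show "w n (a - b) * (?u a \<omega> * ?v b \<omega>) =
          (if b + j' < a + j then w n (a - b) * (?u a \<omega> * ?v b \<omega>) else 0) +
          (if a + j < b + j' then w n (a - b) * (?u a \<omega> * ?v b \<omega>) else 0) +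
          (if b = a + d then w n (- d) * Z (shift a \<omega>) else 0)" by auto
      qed
      then show ?thesis using diag by simp
    qed
    have sqU: "sq_integrable M (?u a)" and sqV: "sq_integrable M (?v a)" for a
      by (intro sq_integrable_shift mart_diffD[OF U] mart_diffD[OF V])+
    have iZ: "integrable M (\<lambda>\<omega>. Z (shift a \<omega>))" for a
      by (rule integrable_shift[OF sq_integrable_integrable[OF sqZ]])
    have iD: "integrable M D" unfolding D_def
      by (intro integrable_mult_right Bochner_Integration.integrable_sum Bochner_Integration.integrable_diff iZ) simp
    have iuv: "integrable M (\<lambda>\<omega>. if P then r * (?u a \<omega> * ?v b \<omega>) else 0)" for P r a b
      by (cases P) (simp_all add: sq_integrable_mult_integrable[OF sqU sqV])
    have i1: "integrable M o1" unfolding o1_def by (intro Bochner_Integration.integrable_sum iuv)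
    have i2: "integrable M o2" unfolding o2_def mult.commute[of "?v _ _"]
      by (intro Bochner_Integration.integrable_sum iuv)
    have "(\<integral>\<omega>. \<bar>qsum n (w n) ?u ?v \<omega> - c\<bar> \<partial>M) = (\<integral>\<omega>. \<bar>o1 \<omega> + o2 \<omega> + D \<omega>\<bar> \<partial>M)"
      by (rule Bochner_Integration.integral_cong) (simp_all add: dec)
    also have "\<dots> \<le> (\<integral>\<omega>. \<bar>o1 \<omega>\<bar> \<partial>M) + (\<integral>\<omega>. \<bar>o2 \<omega>\<bar> \<partial>M) + (\<integral>\<omega>. \<bar>D \<omega>\<bar> \<partial>M)"
      using integral_abs_triangle[OF Bochner_Integration.integrable_add[OF i1 i2] iD] integral_abs_triangle[OF i1 i2] by linarith
    also have "(\<integral>\<omega>. \<bar>o1 \<omega>\<bar> \<partial>M) \<le> \<bar>L\<bar> * L2_norm M V * sqrt (real n * H n)"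
      unfolding o1_def by (rule off_diagonal_bound[OF U L V L']) (use elim in \<open>auto simp: good_weight_def\<close>)
    also have "(\<integral>\<omega>. \<bar>o2 \<omega>\<bar> \<partial>M) \<le> \<bar>L'\<bar> * L2_norm M U * sqrt (real n * H n)"
      unfolding o2_def by (rule off_diagonal_bound[OF V L' U L]) (use elim in \<open>auto simp: good_weight_def\<close>)
    also have "(\<integral>\<omega>. \<bar>D \<omega>\<bar> \<partial>M) = \<bar>w n (- d)\<bar> * (\<integral>\<omega>. \<bar>\<Sum>a\<in>I. Z (shift a \<omega>) - expectation Z\<bar> \<partial>M)"
      by (simp add: D_def abs_mult)
    also have "\<dots> \<le> C * (\<delta> * real n)"
      by (intro mult_mono N n) (use elim C0 in \<open>auto simp: good_weight_def I_def\<close>)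
    also have "\<dots> \<le> e / 2 * real n" using mult_right_mono[OF \<delta>(2) of_nat_0_le_iff[of n]] by (simp only: mult.assoc)
    also have "\<bar>L\<bar> * L2_norm M V * sqrt (real n * H n) + \<bar>L'\<bar> * L2_norm M U * sqrt (real n * H n) + e / 2 * real n
        = B * sqrt (real n * H n) + e / 2 * real n" by (simp add: B_def algebra_simps)
    also have "sqrt (real n * H n) = real n * sqrt (H n / real n)"
    proof -
      have "real n * H n = (real n)\<^sup>2 * (H n / real n)" using n by (simp add: power2_eq_square)
      then show ?thesis by (simp only: real_sqrt_mult) simp
    qed
    also have "B * (real n * sqrt (H n / real n)) = real n * (B * sqrt (H n / real n))" by simp
    also have "real n * (B * sqrt (H n / real n)) \<le> real n * (e / 2)" using elim by (intro mult_left_mono) auto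
    finally have "(\<integral>\<omega>. \<bar>qsum n (w n) ?u ?v \<omega> - c\<bar> \<partial>M) \<le> e * real n" by (simp add: field_simps)
    then show ?case by blast
  qed
qed

lemma qsum_mean: "(\<integral>\<omega>. qsum n w \<epsilon> \<epsilon> \<omega> \<partial>M) = (\<Sum>a\<in>{1..int n}. \<Sum>b\<in>{1..int n}. w (a - b) * autocov M \<epsilon> (a - b))"
proof -
  have i: "integrable M (\<lambda>\<omega>. w (a - b) * (\<epsilon> a \<omega> * \<epsilon> b \<omega>))" for a b
    by (intro integrable_mult_right sq_integrable_mult_integrable sq_integrable_\<epsilon>)
  have "(\<integral>\<omega>. qsum n w \<epsilon> \<epsilon> \<omega> \<partial>M) = (\<Sum>a\<in>{1..int n}. \<Sum>b\<in>{1..int n}. \<integral>\<omega>. w (a - b) * (\<epsilon> a \<omega> * \<epsilon> b \<omega>) \<partial>M)"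
    unfolding qsum_def by (simp only: Bochner_Integration.integral_sum Bochner_Integration.integrable_sum i)
  moreover have "(\<integral>\<omega>. w (a - b) * (\<epsilon> a \<omega> * \<epsilon> b \<omega>) \<partial>M) = w (a - b) * autocov M \<epsilon> (a - b)" for a b
    using integral_\<epsilon>_\<epsilon>[of a b] autocov_minus[of "a - b"] by simp
  ultimately show ?thesis by (simp only:)
qed

text \<open>With \<open>z\<close> the finite sum of bounded differences and \<open>r\<close> the
  rest, the splitting Q(z, z) + Q(r, \<epsilon>) + Q(z, r) has just two error terms, each with one
  factor of small spectral bound; the bilinear clause of \<open>good_weight\<close> controls
  them.\<close>

theorem quadratic_form_concentration:
  fixes w :: "nat \<Rightarrow> int \<Rightarrow> real" and H :: "nat \<Rightarrow> real"
  assumes w: "\<forall>\<^sub>F n in sequentially. good_weight M n C (H n) (w n)"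
    and H: "(\<lambda>n. H n / real n) \<longlonglongrightarrow> 0"
  shows "(\<lambda>n. (\<integral>\<omega>. \<bar>qsum n (w n) \<epsilon> \<epsilon> \<omega>
     - (\<Sum>a\<in>{1..int n}. \<Sum>b\<in>{1..int n}. w n (a - b) * autocov M \<epsilon> (a - b))\<bar> \<partial>M) / real n) \<longlonglongrightarrow> 0"
proof (rule tendstoI)
  fix e :: real assume e: "0 < e"
  have C0: "0 \<le> C" using eventually_happens'[OF sequentially_bot w] by (auto simp: good_weight_def)
  have hc: "0 \<le> hannan_const" using spec_boundD(1)[OF spec_bound_\<epsilon>] .
  \<comment> \<open>The two error terms add up to
    \<open>C * \<delta> * (2 * hannan_const + \<delta>) * n\<close>. The cap at 1 bounds the inner
    \<open>\<delta>\<close>, and the quotient brings the result below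
    \<open>e / 8 * n\<close>.\<close>
  define \<delta> where "\<delta> = min 1 (e / (8 * (C + 1) * (2 * hannan_const + 1)))"
  have \<delta>: "0 < \<delta>" "\<delta> \<le> 1" using e C0 hc by (auto simp: \<delta>_def)
  have Ce: "C * \<delta> * (2 * hannan_const + 1) \<le> e / 8"
  proof -
    have p: "0 < 2 * hannan_const + 1" "0 < C + 1" using hc C0 by auto
    have "C * \<delta> * (2 * hannan_const + 1) \<le> (C + 1) * (e / (8 * (C + 1) * (2 * hannan_const + 1))) * (2 * hannan_const + 1)"
      using p \<delta> by (intro mult_right_mono mult_mono) (auto simp: \<delta>_def)
    also have "\<dots> = e / 8"
    proof -
      have "u * (e / (8 * u * v)) * v = e / 8" if "0 < u" "0 < v" for u v :: real
        using that by (simp add: field_simps)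
      from this[OF p(2,1)] show ?thesis .
    qed
    finally show ?thesis .
  qed
  obtain J V where J: "finite J" "\<And>j. j \<in> J \<Longrightarrow> mart_diff j (V j)" "\<And>j. j \<in> J \<Longrightarrow> \<exists>L. AE \<omega> in M. \<bar>V j \<omega>\<bar> \<le> L"
    "spec_bound M (\<lambda>i \<omega>. \<epsilon> i \<omega> - (\<Sum>j\<in>J. V j (shift i \<omega>))) \<delta>"
    using bounded_mart_diff_approx[OF \<delta>(1)] by blast
  \<comment> \<open>Extended by zero because \<open>concentrates_sum\<close> asks for square
    integrability at all indices.\<close>
  define V' where "V' j = (if j \<in> J then V j else (\<lambda>_. 0))" for j
  let ?z = "\<lambda>i \<omega>. \<Sum>j\<in>J. V' j (shift i \<omega>)"
  have V'eq: "(\<Sum>j\<in>J. V j (shift i \<omega>)) = ?z i \<omega>" for i \<omega> by (simp add: V'_def)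
  have sqV: "sq_integrable M (\<lambda>\<omega>. V' j (shift i \<omega>))" for j i
    using sq_integrable_shift[OF mart_diffD(2)[OF J(2)]] by (cases "j \<in> J") (simp_all add: V'_def sq_integrable_zero)
  have conc: "concentrates M w ?z ?z"
  proof (rule concentrates_sum)
    fix j k assume jk: "j \<in> J" "k \<in> J"
    obtain L L' where "AE \<omega> in M. \<bar>V j \<omega>\<bar> \<le> L" "AE \<omega> in M. \<bar>V k \<omega>\<bar> \<le> L'" using J(3) jk by blast
    then show "concentrates M w (\<lambda>i \<omega>. V' j (shift i \<omega>)) (\<lambda>i \<omega>. V' k (shift i \<omega>))"
      using concentrates_mart_diff[OF w H J(2)[OF jk(1)] _ J(2)[OF jk(2)]] jk by (simp add: V'_def)
  qed (rule sqV)+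
  have s1: "spec_bound M (\<lambda>i \<omega>. \<epsilon> i \<omega> - ?z i \<omega>) \<delta>" using J(4) unfolding V'eq .
  have sqz: "sq_integrable M (?z i)" for i by (intro sq_integrable_sum sqV)
  from spec_bound_add[OF spec_bound_\<epsilon> spec_bound_minus[OF s1]] have s2: "spec_bound M ?z (hannan_const + \<delta>)" by simp
  have "\<forall>\<^sub>F n in sequentially. \<exists>c. (\<integral>\<omega>. \<bar>qsum n (w n) ?z ?z \<omega> - c\<bar> \<partial>M) \<le> e/8 * real n"
    using conc e unfolding concentrates_def by (meson divide_pos_pos zero_less_numeral)
  with w show "\<forall>\<^sub>F n in sequentially. dist ((\<integral>\<omega>. \<bar>qsum n (w n) \<epsilon> \<epsilon> \<omega>
     - (\<Sum>a\<in>{1..int n}. \<Sum>b\<in>{1..int n}. w n (a - b) * autocov M \<epsilon> (a - b))\<bar> \<partial>M) / real n) 0 < e"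
    using eventually_gt_at_top[of 0]
  proof eventually_elim
    case (elim n)
    then obtain c where c: "(\<integral>\<omega>. \<bar>qsum n (w n) ?z ?z \<omega> - c\<bar> \<partial>M) \<le> e/8 * real n" by blast
    let ?Q = "qsum n (w n) \<epsilon> \<epsilon>" and ?r = "\<lambda>i \<omega>. \<epsilon> i \<omega> - ?z i \<omega>"
    have gw: "(\<integral>\<omega>. \<bar>qsum n (w n) \<eta> \<zeta> \<omega>\<bar> \<partial>M) \<le> C * real n * A * B" if "spec_bound M \<eta> A" "spec_bound M \<zeta> B" for \<eta> \<zeta> A B
      using elim(1) that unfolding good_weight_def by blast
    have sqr: "sq_integrable M (?r i)" for i by (rule spec_boundD(2)[OF s1])
    have iQ: "integrable M ?Q" by (rule qsum_integrable[OF sq_integrable_\<epsilon> sq_integrable_\<epsilon>])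
    have i1: "integrable M (\<lambda>\<omega>. qsum n (w n) ?z ?z \<omega> - c)" using qsum_integrable[OF sqz sqz] by simp
    have i2: "integrable M (qsum n (w n) ?r \<epsilon>)" by (rule qsum_integrable[OF sqr sq_integrable_\<epsilon>])
    have i3: "integrable M (qsum n (w n) ?z ?r)" by (rule qsum_integrable[OF sqz sqr])
    have "?Q \<omega> - c = (qsum n (w n) ?z ?z \<omega> - c) + qsum n (w n) ?r \<epsilon> \<omega> + qsum n (w n) ?z ?r \<omega>" for \<omega>
      by (simp only: qsum_diff_left qsum_diff_right)
    note split = this
    have "(\<integral>\<omega>. \<bar>?Q \<omega> - c\<bar> \<partial>M) \<le> (\<integral>\<omega>. \<bar>qsum n (w n) ?z ?z \<omega> - c\<bar> \<partial>M) + (\<integral>\<omega>. \<bar>qsum n (w n) ?r \<epsilon> \<omega>\<bar> \<partial>M) + (\<integral>\<omega>. \<bar>qsum n (w n) ?z ?r \<omega>\<bar> \<partial>M)"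
      using integral_abs_triangle[OF Bochner_Integration.integrable_add[OF i1 i2] i3] integral_abs_triangle[OF i1 i2]
      unfolding split by linarith
    also have "\<dots> \<le> e/8 * real n + C * real n * \<delta> * hannan_const + C * real n * (hannan_const + \<delta>) * \<delta>"
      by (intro add_mono c gw s1 s2 spec_bound_\<epsilon>)
    also have "\<dots> = e/8 * real n + C * \<delta> * (2 * hannan_const + \<delta>) * real n" by (simp add: algebra_simps)
    also have "\<dots> \<le> e/8 * real n + C * \<delta> * (2 * hannan_const + 1) * real n"
      using \<delta> C0 by (intro add_left_mono mult_right_mono mult_left_mono) auto
    also have "\<dots> \<le> e/8 * real n + e/8 * real n" by (intro add_left_mono mult_right_mono Ce) simp
    finally have Qc: "(\<integral>\<omega>. \<bar>?Q \<omega> - c\<bar> \<partial>M) \<le> e/4 * real n" by simp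
    have iQc: "integrable M (\<lambda>\<omega>. ?Q \<omega> - c)" using iQ by simp
    \<comment> \<open>Passing from the free constant \<open>c\<close> to the mean at most doubles
      the error, from \<open>e / 4\<close> to \<open>e / 2\<close>.\<close>
    have "\<bar>expectation ?Q - c\<bar> \<le> (\<integral>\<omega>. \<bar>?Q \<omega> - c\<bar> \<partial>M)"
      using integral_abs_bound[of M "\<lambda>\<omega>. ?Q \<omega> - c"] iQ by (simp add: prob_space)
    moreover have "(\<integral>\<omega>. \<bar>?Q \<omega> - expectation ?Q\<bar> \<partial>M) \<le> (\<integral>\<omega>. \<bar>?Q \<omega> - c\<bar> \<partial>M) + \<bar>expectation ?Q - c\<bar>"
      using integral_abs_triangle[OF iQc, of "\<lambda>_. c - expectation ?Q"] by (simp add: prob_space abs_minus_commute)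
    ultimately have "(\<integral>\<omega>. \<bar>?Q \<omega> - expectation ?Q\<bar> \<partial>M) \<le> e/2 * real n" using Qc by linarith
    also have "\<dots> < e * real n" using e elim by simp
    finally have "(\<integral>\<omega>. \<bar>?Q \<omega> - expectation ?Q\<bar> \<partial>M) / real n < e" using elim by (simp add: pos_divide_less_eq)
    then show ?case by (simp add: qsum_mean)
  qed
qed

end

section \<open>Fourier inversion for lag kernels\<close>

text \<open>Characteristic function of the standard normal law at \<open>s / \<sigma>\<close>, after
  the substitution \<open>x = \<sigma> * u\<close>.\<close>

lemma gaussian_fourier:
  fixes s \<sigma> :: real
  assumes "0 < \<sigma>"
  shows "(CLINT u|lborel. complex_of_real (exp (- (\<sigma> * u)\<^sup>2 / 2)) * cis (s * u))
     = complex_of_real (sqrt (2 * pi) / \<sigma> * exp (- (s / \<sigma>)\<^sup>2 / 2))"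
proof -
  have "complex_of_real (exp (- (s / \<sigma>)\<^sup>2 / 2)) = char std_normal_distribution (s / \<sigma>)"
    by (simp add: char_std_normal_distribution)
  also have "\<dots> = (CLINT x|lborel. std_normal_density x *\<^sub>R cis (s / \<sigma> * x))"
    unfolding char_def by (subst integral_density) (auto simp: cis_conv_exp)
  also have "\<dots> = \<sigma> *\<^sub>R (CLINT u|lborel. std_normal_density (\<sigma> * u) *\<^sub>R cis (s / \<sigma> * (\<sigma> * u)))"
    using lborel_integral_real_affine[of \<sigma> "\<lambda>x. std_normal_density x *\<^sub>R cis (s / \<sigma> * x)" 0] assms by simp
  also have "(\<lambda>u. std_normal_density (\<sigma> * u) *\<^sub>R cis (s / \<sigma> * (\<sigma> * u)))
      = (\<lambda>u. complex_of_real (1 / sqrt (2 * pi)) * (complex_of_real (exp (- (\<sigma> * u)\<^sup>2 / 2)) * cis (s * u)))"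
    using assms by (auto simp: std_normal_density_def scaleR_conv_of_real)
  also have "(CLINT u|lborel. complex_of_real (1 / sqrt (2 * pi)) * (complex_of_real (exp (- (\<sigma> * u)\<^sup>2 / 2)) * cis (s * u)))
      = complex_of_real (1 / sqrt (2 * pi)) * (CLINT u|lborel. complex_of_real (exp (- (\<sigma> * u)\<^sup>2 / 2)) * cis (s * u))"
    by (rule integral_mult_right_zero)
  finally show ?thesis
    using assms by (simp add: scaleR_conv_of_real field_simps)
qed

lemma cis_measurable [measurable]: "cis \<in> borel_measurable borel"
  by (intro borel_measurable_continuous_onI continuous_intros)

text \<open>The identity \<open>smooth\<close> in the proof is the inversion formula for the convolution of \<open>K\<close> with a
  centred normal density of standard deviation \<open>\<sigma>\<close>.\<close>

theorem fourier_inversion: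
  fixes K :: "real \<Rightarrow> real" and t :: real
  defines "k \<equiv> \<lambda>u. CLINT t|lborel. complex_of_real (K t) * cis (- (u * t))"
  assumes cont: "continuous_on UNIV K" and bdd: "\<And>t. \<bar>K t\<bar> \<le> B"
    and int: "integrable lborel K" and ik: "integrable lborel k"
  shows "complex_of_real (2 * pi * K t) = (CLINT u|lborel. k u * cis (u * t))"
proof -
  have Km [measurable]: "K \<in> borel_measurable borel" using cont by (rule borel_measurable_continuous_onI)
  have km [measurable]: "k \<in> borel_measurable borel" using ik by (auto dest: borel_measurable_integrable)
  \<comment> \<open>Gaussian damping: with this factor the double integral over \<open>s\<close> and
    \<open>u\<close> converges absolutely, so that Fubini applies. Its own transform is again
    Gaussian and produces the convolution with a normal density.\<close>
  define G where "G \<sigma> u = exp (- (\<sigma> * u)\<^sup>2 / 2)" for \<sigma> u :: real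
  have G01: "0 \<le> G \<sigma> u" "G \<sigma> u \<le> 1" for \<sigma> u by (auto simp: G_def)
  have Gm [measurable]: "G \<sigma> \<in> borel_measurable borel" for \<sigma> unfolding G_def by measurable
  have Gint: "integrable lborel (G \<sigma>)" if "0 < \<sigma>" for \<sigma>
  proof -
    have "integrable lborel (\<lambda>u. sqrt (2 * pi) * normal_density 0 1 (0 + \<sigma> * u))"
      using that by (intro integrable_mult_right lborel_integrable_real_affine) auto
    then show ?thesis by (simp add: G_def[abs_def] std_normal_density_def)
  qed
  have smooth: "(CLINT u|lborel. k u * cis (u * t) * complex_of_real (G \<sigma> u))
     = complex_of_real (2 * pi * (\<integral>x. K (t + \<sigma> * x) * std_normal_density x \<partial>lborel))" if \<sigma>: "0 < \<sigma>" for \<sigma>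
  proof -
    let ?f = "\<lambda>s u. complex_of_real (K s * G \<sigma> u) * cis ((t - s) * u)"
    have intf: "integrable (lborel \<Otimes>\<^sub>M lborel) (\<lambda>(s, u). ?f s u)"
    proof (rule lborel_pair.Fubini_integrable)
      show "(\<lambda>(s, u). ?f s u) \<in> borel_measurable (lborel \<Otimes>\<^sub>M lborel)" by measurable
      show "integrable lborel (\<lambda>s. \<integral>u. norm (case (s, u) of (s, u) \<Rightarrow> ?f s u) \<partial>lborel)"
        using int G01 by (simp add: norm_mult abs_mult)
      show "AE s in lborel. integrable lborel (\<lambda>u. case (s, u) of (s, u) \<Rightarrow> ?f s u)"
      proof (intro AE_I2)
        fix s
        have "integrable lborel (\<lambda>u. K s * G \<sigma> u)" using Gint[OF \<sigma>] by simp
        then have "integrable lborel (\<lambda>u. ?f s u)"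
          by (rule Bochner_Integration.integrable_bound) (auto simp: norm_mult)
        then show "integrable lborel (\<lambda>u. case (s, u) of (s, u) \<Rightarrow> ?f s u)" by simp
      qed
    qed
    have "(CLINT u|lborel. k u * cis (u * t) * complex_of_real (G \<sigma> u)) = (CLINT u|lborel. CLINT s|lborel. ?f s u)"
    proof (rule Bochner_Integration.integral_cong[OF refl])
      fix u
      have "k u * cis (u * t) * complex_of_real (G \<sigma> u)
         = (CLINT s|lborel. complex_of_real (K s) * cis (- (u * s)) * (cis (u * t) * complex_of_real (G \<sigma> u)))"
        unfolding k_def by (simp only: mult.assoc integral_mult_left_zero[symmetric])
      also have "\<dots> = (CLINT s|lborel. ?f s u)"
      proof (rule Bochner_Integration.integral_cong[OF refl])
        fix s
        have "complex_of_real (K s) * cis (- (u * s)) * (cis (u * t) * complex_of_real (G \<sigma> u))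
            = complex_of_real (K s * G \<sigma> u) * (cis (- (u * s)) * cis (u * t))"
          by (simp only: of_real_mult mult_ac)
        also have "cis (- (u * s)) * cis (u * t) = cis ((t - s) * u)" by (simp add: cis_mult algebra_simps)
        finally show "complex_of_real (K s) * cis (- (u * s)) * (cis (u * t) * complex_of_real (G \<sigma> u)) = ?f s u" .
      qed
      finally show "k u * cis (u * t) * complex_of_real (G \<sigma> u) = (CLINT s|lborel. ?f s u)" .
    qed
    also have "\<dots> = (CLINT s|lborel. CLINT u|lborel. ?f s u)"
      by (rule lborel_pair.Fubini_integral[OF intf])
    also have "\<dots> = (CLINT s|lborel. complex_of_real (K s * (sqrt (2 * pi) / \<sigma> * exp (- ((t - s) / \<sigma>)\<^sup>2 / 2))))"
    proof (rule Bochner_Integration.integral_cong[OF refl])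
      fix s
      have "(CLINT u|lborel. ?f s u) = complex_of_real (K s) * (CLINT u|lborel. complex_of_real (exp (- (\<sigma> * u)\<^sup>2 / 2)) * cis ((t - s) * u))"
        by (simp only: G_def of_real_mult mult.assoc integral_mult_right_zero)
      then show "(CLINT u|lborel. ?f s u) = complex_of_real (K s * (sqrt (2 * pi) / \<sigma> * exp (- ((t - s) / \<sigma>)\<^sup>2 / 2)))"
        by (simp only: gaussian_fourier[OF \<sigma>] of_real_mult)
    qed
    also have "\<dots> = complex_of_real (\<integral>s. K s * (sqrt (2 * pi) / \<sigma> * exp (- ((t - s) / \<sigma>)\<^sup>2 / 2)) \<partial>lborel)"
      by (rule integral_complex_of_real)
    also have "(\<integral>s. K s * (sqrt (2 * pi) / \<sigma> * exp (- ((t - s) / \<sigma>)\<^sup>2 / 2)) \<partial>lborel)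
        = \<sigma> * (\<integral>x. K (t + \<sigma> * x) * (sqrt (2 * pi) / \<sigma> * exp (- x\<^sup>2 / 2)) \<partial>lborel)"
      using lborel_integral_real_affine[of \<sigma> "\<lambda>s. K s * (sqrt (2 * pi) / \<sigma> * exp (- ((t - s) / \<sigma>)\<^sup>2 / 2))" t] \<sigma> by simp
    also have "\<dots> = (\<integral>x. \<sigma> * (K (t + \<sigma> * x) * (sqrt (2 * pi) / \<sigma> * exp (- x\<^sup>2 / 2))) \<partial>lborel)"
      by (rule integral_mult_right_zero[symmetric])
    also have "\<dots> = (\<integral>x. 2 * pi * (K (t + \<sigma> * x) * std_normal_density x) \<partial>lborel)"
    proof (rule Bochner_Integration.integral_cong[OF refl])
      fix x
      have "2 * pi / sqrt (2 * pi) = sqrt (2 * pi)" by (rule real_div_sqrt) simp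
      moreover have "\<sigma> * (r / \<sigma>) = r" for r using \<sigma> by simp
      ultimately have eq: "\<sigma> * (sqrt (2 * pi) / \<sigma>) = 2 * pi * (1 / sqrt (2 * pi))"
        by (simp only: times_divide_eq_right mult_1_right)
      have "\<sigma> * (K (t + \<sigma> * x) * (sqrt (2 * pi) / \<sigma> * exp (- x\<^sup>2 / 2)))
          = \<sigma> * (sqrt (2 * pi) / \<sigma>) * (K (t + \<sigma> * x) * exp (- x\<^sup>2 / 2))" by (simp only: mult_ac)
      also have "\<dots> = 2 * pi * (K (t + \<sigma> * x) * std_normal_density x)"
        unfolding eq std_normal_density_def by (simp only: mult_ac)
      finally show "\<sigma> * (K (t + \<sigma> * x) * (sqrt (2 * pi) / \<sigma> * exp (- x\<^sup>2 / 2))) = 2 * pi * (K (t + \<sigma> * x) * std_normal_density x)" .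
    qed
    also have "\<dots> = 2 * pi * (\<integral>x. K (t + \<sigma> * x) * std_normal_density x \<partial>lborel)" by simp
    finally show ?thesis .
  qed
  \<comment> \<open>As the width tends to 0, the damping disappears on the frequency side, with
    majorant \<open>norm (k u)\<close>. On the other side the normal density concentrates at
    \<open>t\<close>, where continuity and boundedness of \<open>K\<close> give the limit.\<close>
  let ?\<sigma> = "\<lambda>n. 1 / real (Suc n)"
  have \<sigma>0: "?\<sigma> \<longlonglongrightarrow> 0" using LIMSEQ_inverse_real_of_nat by (simp add: inverse_eq_divide)
  have l1: "(\<lambda>n. CLINT u|lborel. k u * cis (u * t) * complex_of_real (G (?\<sigma> n) u)) \<longlonglongrightarrow> (CLINT u|lborel. k u * cis (u * t))"
  proof (rule integral_dominated_convergence[where w = "\<lambda>u. norm (k u)"])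
    show "AE u in lborel. (\<lambda>n. k u * cis (u * t) * complex_of_real (G (?\<sigma> n) u)) \<longlonglongrightarrow> k u * cis (u * t)"
    proof (intro AE_I2)
      fix u
      have "(\<lambda>n. G (?\<sigma> n) u) \<longlonglongrightarrow> exp (- (0 * u)\<^sup>2 / 2)"
        unfolding G_def by (intro tendsto_intros \<sigma>0) simp
      then have "(\<lambda>n. k u * cis (u * t) * complex_of_real (G (?\<sigma> n) u)) \<longlonglongrightarrow> k u * cis (u * t) * complex_of_real 1"
        by (intro tendsto_intros) simp
      then show "(\<lambda>n. k u * cis (u * t) * complex_of_real (G (?\<sigma> n) u)) \<longlonglongrightarrow> k u * cis (u * t)" by simp
    qed
    show "AE u in lborel. norm (k u * cis (u * t) * complex_of_real (G (?\<sigma> n) u)) \<le> norm (k u)" for n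
      using G01 by (intro AE_I2) (simp add: norm_mult mult_left_le)
  qed (use ik in auto)
  have l2: "(\<lambda>n. \<integral>x. K (t + ?\<sigma> n * x) * std_normal_density x \<partial>lborel) \<longlonglongrightarrow> (\<integral>x. K t * std_normal_density x \<partial>lborel)"
  proof (rule integral_dominated_convergence[where w = "\<lambda>x. B * std_normal_density x"])
    show "AE x in lborel. (\<lambda>n. K (t + ?\<sigma> n * x) * std_normal_density x) \<longlonglongrightarrow> K t * std_normal_density x"
    proof (intro AE_I2 tendsto_mult tendsto_const)
      fix x
      have "isCont K t" using cont by (simp add: continuous_on_eq_continuous_at)
      moreover have "(\<lambda>n. t + ?\<sigma> n * x) \<longlonglongrightarrow> t + 0 * x" by (intro tendsto_intros \<sigma>0)
      ultimately show "(\<lambda>n. K (t + ?\<sigma> n * x)) \<longlonglongrightarrow> K t" by (intro isCont_tendsto_compose[of t K]) simp_all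
    qed
    show "AE x in lborel. norm (K (t + ?\<sigma> n * x) * std_normal_density x) \<le> B * std_normal_density x" for n
      using bdd by (intro AE_I2) (simp add: abs_mult mult_right_mono)
  qed auto
  have "(\<lambda>n. CLINT u|lborel. k u * cis (u * t) * complex_of_real (G (?\<sigma> n) u)) \<longlonglongrightarrow> complex_of_real (2 * pi * (\<integral>x. K t * std_normal_density x \<partial>lborel))"
    by (subst smooth, simp) (intro tendsto_of_real tendsto_mult tendsto_const l2)
  from LIMSEQ_unique[OF l1 this] show ?thesis by simp
qed

lemma lag_kernel_properties:
  assumes K: "lag_kernel K"
  obtains c B :: real and \<kappa> :: "real \<Rightarrow> complex"
  where "0 \<le> c" "\<And>t. K t \<noteq> 0 \<Longrightarrow> \<bar>t\<bar> \<le> c" "\<And>t. \<bar>K t\<bar> \<le> B" "integrable lborel \<kappa>"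
    "\<And>t. complex_of_real (K t) = (CLINT u|lborel. \<kappa> u * cis (u * t))"
proof -
  have cont: "continuous_on UNIV K" and comp: "compact (closure {t. K t \<noteq> 0})"
    and ik: "integrable lborel (\<lambda>u. CLINT t|lborel. complex_of_real (K t) * cis (- (u * t)))"
    using K by (auto simp: lag_kernel_def)
  obtain c0 where c0: "\<And>t. t \<in> closure {t. K t \<noteq> 0} \<Longrightarrow> norm t \<le> c0"
    using compact_imp_bounded[OF comp] unfolding bounded_iff by blast
  define c where "c = max 0 c0"
  have c: "0 \<le> c" "\<And>t. K t \<noteq> 0 \<Longrightarrow> \<bar>t\<bar> \<le> c"
  proof -
    show "0 \<le> c" by (simp add: c_def)
    fix t assume "K t \<noteq> 0"
    then have "norm t \<le> c0" by (intro c0 subsetD[OF closure_subset]) simp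
    then show "\<bar>t\<bar> \<le> c" by (simp add: c_def)
  qed
  have "compact (K ` {-c..c})"
    by (rule compact_continuous_image[OF continuous_on_subset[OF cont]]) simp_all
  from compact_imp_bounded[OF this] obtain B0 where B0: "\<And>x. x \<in> K ` {-c..c} \<Longrightarrow> norm x \<le> B0"
    unfolding bounded_iff by blast
  have B: "\<bar>K t\<bar> \<le> max 0 B0" for t
  proof (cases "K t = 0")
    case False
    then have "t \<in> {-c..c}" using c(2)[of t] by (simp add: abs_le_iff)
    then show ?thesis using B0[of "K t"] by auto
  qed simp
  have "integrable lborel (\<lambda>t. indicator {-c..c} t *\<^sub>R K t)"
    by (rule borel_integrable_compact[OF _ continuous_on_subset[OF cont]]) simp_all
  also have "(\<lambda>t. indicator {-c..c} t *\<^sub>R K t) = K"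
  proof
    fix t show "indicator {-c..c} t *\<^sub>R K t = K t"
      using c(2)[of t] by (cases "K t = 0") (auto simp: indicator_def abs_le_iff)
  qed
  finally have int: "integrable lborel K" .
  \<comment> \<open>The factor \<open>2 * pi\<close> of the inversion formula is absorbed, so that
    \<open>K\<close> is literally the Fourier integral of \<open>\<kappa>\<close>.\<close>
  define \<kappa> where "\<kappa> u = (CLINT t|lborel. complex_of_real (K t) * cis (- (u * t))) / complex_of_real (2 * pi)" for u
  show thesis
  proof
    show "integrable lborel \<kappa>" unfolding \<kappa>_def using ik by (rule integrable_divide_zero)
    fix t
    have "(CLINT u|lborel. \<kappa> u * cis (u * t)) = complex_of_real (2 * pi * K t) / complex_of_real (2 * pi)"
      by (subst fourier_inversion[OF cont B int ik]) (simp only: \<kappa>_def times_divide_eq_left integral_divide_zero)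
    then show "complex_of_real (K t) = (CLINT u|lborel. \<kappa> u * cis (u * t))" by simp
  qed (use c B in blast)+
qed

section \<open>Lag weights\<close>

text \<open>Vanishing outside \<open>{1..int n}\<close> makes changes of the summation range free.
  The length is only bounded by 1, since a zero column of the design divided by its norm 0 is again
  0.\<close>

definition unit_column :: "nat \<Rightarrow> (int \<Rightarrow> real) \<Rightarrow> bool" where
  "unit_column n y \<longleftrightarrow> (\<forall>t. t \<notin> {1..int n} \<longrightarrow> y t = 0) \<and> (\<Sum>t\<in>{1..int n}. (y t)\<^sup>2) \<le> 1"

definition lag_product :: "nat \<Rightarrow> (int \<Rightarrow> real) \<Rightarrow> (int \<Rightarrow> real) \<Rightarrow> int \<Rightarrow> real" where
  "lag_product n y z k = (\<Sum>t\<in>{1..int n}. y (t + k) * z t)"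

definition lag_weight :: "(real \<Rightarrow> real) \<Rightarrow> real \<Rightarrow> nat \<Rightarrow> (int \<Rightarrow> real) \<Rightarrow> (int \<Rightarrow> real) \<Rightarrow> int \<Rightarrow> real" where
  "lag_weight K h n y z k = K (of_int k / h) * lag_product n y z k"

lemma unit_column_shift_sum:
  assumes y: "unit_column n y" and S: "finite S"
  shows "(\<Sum>t\<in>S. (y (t + k))\<^sup>2) \<le> 1"
proof -
  have "(\<Sum>t\<in>S. (y (t + k))\<^sup>2) = (\<Sum>t\<in>(\<lambda>t. t + k) ` S. (y t)\<^sup>2)"
    by (subst sum.reindex) (auto simp: inj_on_def)
  also have "\<dots> = (\<Sum>t\<in>(\<lambda>t. t + k) ` S \<inter> {1..int n}. (y t)\<^sup>2)"
    by (rule sum.mono_neutral_right) (use S y in \<open>auto simp: unit_column_def\<close>)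
  also have "\<dots> \<le> (\<Sum>t\<in>{1..int n}. (y t)\<^sup>2)" by (rule sum_mono2) auto
  finally show ?thesis using y by (simp add: unit_column_def)
qed

lemma abs_lag_product_le:
  assumes "unit_column n y" "unit_column n z"
  shows "\<bar>lag_product n y z k\<bar> \<le> 1"
proof -
  have "\<bar>lag_product n y z k\<bar> \<le> (\<Sum>t\<in>{1..int n}. \<bar>y (t + k)\<bar> * \<bar>z t\<bar>)"
    unfolding lag_product_def by (rule order_trans[OF sum_abs]) (simp add: abs_mult)
  also have "\<dots> \<le> L2_set (\<lambda>t. y (t + k)) {1..int n} * L2_set z {1..int n}"
    by (rule L2_set_mult_ineq)
  also have "\<dots> \<le> 1 * 1"
    unfolding L2_set_def
    by (intro mult_mono) (use unit_column_shift_sum[OF assms(1), of "{1..int n}" k] assms(2) in \<open>auto simp: unit_column_def sum_nonneg\<close>)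
  finally show ?thesis by simp
qed

text \<open>The range of \<open>s\<close> does not depend on \<open>a\<close> and \<open>b\<close>,
  which is what allows the sums to be exchanged later. It is wide enough because
  \<open>z (b + s)\<close> vanishes off an interval contained in it.\<close>

lemma lag_product_eq:
  assumes z: "unit_column n z" and ab: "a \<in> {1..int n}" "b \<in> {1..int n}"
  shows "lag_product n y z (a - b) = (\<Sum>s\<in>{- int n..int n}. y (a + s) * z (b + s))"
proof -
  have "lag_product n y z (a - b) = (\<Sum>s\<in>{1 - b..int n - b}. y (a + s) * z (b + s))"
    unfolding lag_product_def
    by (rule sum.reindex_bij_witness[where i = "\<lambda>s. s + b" and j = "\<lambda>t. t - b"]) (auto simp: algebra_simps)
  also have "\<dots> = (\<Sum>s\<in>{- int n..int n}. y (a + s) * z (b + s))"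
    by (rule sum.mono_neutral_left) (use z ab in \<open>auto simp: unit_column_def\<close>)
  finally show ?thesis .
qed

section \<open>Bilinear bounds uniform in the bandwidth\<close>

context finite_measure
begin

text \<open>As \<open>lag_product n y z (a - b) = \<Sum>\<^sub>s y(a + s) z(b + s)\<close>, the form factorises for each \<open>s\<close>.\<close>

lemma lag_product_phase_bound:
  fixes \<theta> :: real
  assumes \<eta>: "spec_bound M \<eta> A" and \<zeta>: "spec_bound M \<zeta> B" and pos: "0 < A" "0 < B"
    and y: "unit_column n y" and z: "unit_column n z"
  shows "(\<integral>\<omega>. cmod (\<Sum>a\<in>{1..int n}. \<Sum>b\<in>{1..int n}.
      complex_of_real (lag_product n y z (a - b) * (\<eta> a \<omega> * \<zeta> b \<omega>)) * cis (\<theta> * of_int (a - b))) \<partial>M) \<le> real n * A * B"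
proof -
  let ?I = "{1..int n}" and ?S = "{- int n..int n}"
  define P where "P s \<omega> = (\<Sum>a\<in>?I. complex_of_real (y (a + s) * \<eta> a \<omega>) * cis (\<theta> * of_int a))" for s \<omega>
  define Q where "Q s \<omega> = (\<Sum>b\<in>?I. complex_of_real (z (b + s) * \<zeta> b \<omega>) * cis (- (\<theta> * of_int b)))" for s \<omega>
  have dec: "(\<Sum>a\<in>?I. \<Sum>b\<in>?I. complex_of_real (lag_product n y z (a - b) * (\<eta> a \<omega> * \<zeta> b \<omega>)) * cis (\<theta> * of_int (a - b)))
      = (\<Sum>s\<in>?S. P s \<omega> * Q s \<omega>)" for \<omega>
  proof -
    have "(\<Sum>s\<in>?S. P s \<omega> * Q s \<omega>) = (\<Sum>s\<in>?S. \<Sum>a\<in>?I. \<Sum>b\<in>?I. complex_of_real (y (a + s) * z (b + s)) *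
        (complex_of_real (\<eta> a \<omega> * \<zeta> b \<omega>) * cis (\<theta> * of_int (a - b))))"
      unfolding P_def Q_def sum_product
    proof (intro sum.cong refl)
      fix s a b
      have "cis (\<theta> * of_int (a - b)) = cis (\<theta> * of_int a) * cis (- (\<theta> * of_int b))"
        by (simp add: cis_mult right_diff_distrib)
      then show "complex_of_real (y (a + s) * \<eta> a \<omega>) * cis (\<theta> * of_int a) * (complex_of_real (z (b + s) * \<zeta> b \<omega>) * cis (- (\<theta> * of_int b)))
        = complex_of_real (y (a + s) * z (b + s)) * (complex_of_real (\<eta> a \<omega> * \<zeta> b \<omega>) * cis (\<theta> * of_int (a - b)))"
        by (simp only: of_real_mult mult_ac)
    qed
    also have "\<dots> = (\<Sum>a\<in>?I. \<Sum>b\<in>?I. \<Sum>s\<in>?S. complex_of_real (y (a + s) * z (b + s)) *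
        (complex_of_real (\<eta> a \<omega> * \<zeta> b \<omega>) * cis (\<theta> * of_int (a - b))))"
      by (subst sum.swap) (rule sum.cong[OF refl sum.swap])
    also have "\<dots> = (\<Sum>a\<in>?I. \<Sum>b\<in>?I. complex_of_real (lag_product n y z (a - b)) * (complex_of_real (\<eta> a \<omega> * \<zeta> b \<omega>) * cis (\<theta> * of_int (a - b))))"
      by (intro sum.cong refl) (simp only: lag_product_eq[OF z] of_real_sum sum_distrib_right)
    finally show ?thesis by (simp only: of_real_mult mult.assoc)
  qed
  \<comment> \<open>Real and imaginary part are real linear forms, with coefficients multiplied by a
    cosine and a sine; in the sum of the squared coefficients the phases disappear.\<close>
  have sq_cmod: "(cmod (\<Sum>a\<in>?I. complex_of_real (x a * f a) * cis (g a)))\<^sup>2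
      = (\<Sum>a\<in>?I. (x a * cos (g a)) * f a)\<^sup>2 + (\<Sum>a\<in>?I. (x a * sin (g a)) * f a)\<^sup>2" for x f g :: "int \<Rightarrow> real"
    by (simp add: cmod_power2 mult_ac)
  have norm_bound: "integrable M (\<lambda>\<omega>. (cmod (\<Sum>a\<in>?I. complex_of_real (x a * \<xi> a \<omega>) * cis (g a)))\<^sup>2)"
    "(\<integral>\<omega>. (cmod (\<Sum>a\<in>?I. complex_of_real (x a * \<xi> a \<omega>) * cis (g a)))\<^sup>2 \<partial>M) \<le> D\<^sup>2 * (\<Sum>a\<in>?I. (x a)\<^sup>2)"
    if \<xi>: "spec_bound M \<xi> D" for x g \<xi> D
  proof -
    note sq = spec_boundD(2)[OF \<xi>]
    have i: "integrable M (\<lambda>\<omega>. (\<Sum>a\<in>?I. c a * \<xi> a \<omega>)\<^sup>2)" for c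
      by (intro sq_integrable_integrable_square sq_integrable_sum sq_integrable_cmult sq)
    show "integrable M (\<lambda>\<omega>. (cmod (\<Sum>a\<in>?I. complex_of_real (x a * \<xi> a \<omega>) * cis (g a)))\<^sup>2)"
      unfolding sq_cmod by (intro Bochner_Integration.integrable_add i)
    have "(\<integral>\<omega>. (cmod (\<Sum>a\<in>?I. complex_of_real (x a * \<xi> a \<omega>) * cis (g a)))\<^sup>2 \<partial>M)
      = (\<integral>\<omega>. (\<Sum>a\<in>?I. (x a * cos (g a)) * \<xi> a \<omega>)\<^sup>2 \<partial>M) + (\<integral>\<omega>. (\<Sum>a\<in>?I. (x a * sin (g a)) * \<xi> a \<omega>)\<^sup>2 \<partial>M)"
      unfolding sq_cmod by (intro Bochner_Integration.integral_add i)
    also have "\<dots> \<le> D\<^sup>2 * (\<Sum>a\<in>?I. (x a * cos (g a))\<^sup>2) + D\<^sup>2 * (\<Sum>a\<in>?I. (x a * sin (g a))\<^sup>2)"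
      by (intro add_mono spec_bound_square[OF \<xi>]) simp_all
    also have "\<dots> = D\<^sup>2 * (\<Sum>a\<in>?I. (x a)\<^sup>2 * ((cos (g a))\<^sup>2 + (sin (g a))\<^sup>2))"
      by (simp add: distrib_left sum.distrib power_mult_distrib del: sin_cos_squared_add2)
    finally show "(\<integral>\<omega>. (cmod (\<Sum>a\<in>?I. complex_of_real (x a * \<xi> a \<omega>) * cis (g a)))\<^sup>2 \<partial>M) \<le> D\<^sup>2 * (\<Sum>a\<in>?I. (x a)\<^sup>2)"
      by simp
  qed
  \<comment> \<open>For fixed \<open>a\<close> the sum over \<open>s\<close> sees at most the whole
    unit mass of the column, so the total is at most the number \<open>n\<close> of values of
    \<open>a\<close>, although \<open>s\<close> takes \<open>2 * n + 1\<close> values.\<close>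
  have tot: "(\<Sum>s\<in>?S. \<Sum>a\<in>?I. (y' (a + s))\<^sup>2) \<le> real n" if "unit_column n y'" for y'
  proof -
    have "(\<Sum>s\<in>?S. \<Sum>a\<in>?I. (y' (a + s))\<^sup>2) = (\<Sum>a\<in>?I. \<Sum>s\<in>?S. (y' (s + a))\<^sup>2)"
      by (subst sum.swap) (simp add: add.commute)
    also have "\<dots> \<le> (\<Sum>a\<in>?I. 1)" by (intro sum_mono unit_column_shift_sum[OF that]) simp
    finally show ?thesis by simp
  qed
  have iP: "integrable M (\<lambda>\<omega>. (cmod (P s \<omega>))\<^sup>2)" and iQ: "integrable M (\<lambda>\<omega>. (cmod (Q s \<omega>))\<^sup>2)" for s
    unfolding P_def Q_def by (rule norm_bound[OF \<eta>] norm_bound[OF \<zeta>])+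
  \<comment> \<open>This weight makes each of the two terms equal to half of
    \<open>n * A * B\<close>.\<close>
  let ?u = "B / A"
  have "(\<integral>\<omega>. cmod (\<Sum>s\<in>?S. P s \<omega> * Q s \<omega>) \<partial>M)
      \<le> (\<integral>\<omega>. (\<Sum>s\<in>?S. (?u * (cmod (P s \<omega>))\<^sup>2 + (cmod (Q s \<omega>))\<^sup>2 / ?u) / 2) \<partial>M)"
  proof (rule integral_mono_AE')
    show "integrable M (\<lambda>\<omega>. \<Sum>s\<in>?S. (?u * (cmod (P s \<omega>))\<^sup>2 + (cmod (Q s \<omega>))\<^sup>2 / ?u) / 2)"
      by (intro Bochner_Integration.integrable_sum integrable_divide Bochner_Integration.integrable_add integrable_mult_right iP iQ)
    show "AE \<omega> in M. cmod (\<Sum>s\<in>?S. P s \<omega> * Q s \<omega>) \<le> (\<Sum>s\<in>?S. (?u * (cmod (P s \<omega>))\<^sup>2 + (cmod (Q s \<omega>))\<^sup>2 / ?u) / 2)"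
    proof (intro AE_I2 order_trans[OF norm_sum] sum_mono)
      fix \<omega> s
      have "\<bar>cmod (P s \<omega>) * cmod (Q s \<omega>)\<bar> \<le> (?u * (cmod (P s \<omega>))\<^sup>2 + (cmod (Q s \<omega>))\<^sup>2 / ?u) / 2"
        by (rule abs_mult_le_weighted_squares) (use pos in simp)
      then show "norm (P s \<omega> * Q s \<omega>) \<le> (?u * (cmod (P s \<omega>))\<^sup>2 + (cmod (Q s \<omega>))\<^sup>2 / ?u) / 2"
        by (simp add: norm_mult)
    qed
  qed (use pos in \<open>auto intro!: sum_nonneg\<close>)
  also have "\<dots> = (?u * (\<Sum>s\<in>?S. \<integral>\<omega>. (cmod (P s \<omega>))\<^sup>2 \<partial>M) + (\<Sum>s\<in>?S. \<integral>\<omega>. (cmod (Q s \<omega>))\<^sup>2 \<partial>M) / ?u) / 2"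
  proof -
    have "(\<Sum>s\<in>?S. (r * f s + g s / r) / 2) = (r * sum f ?S + sum g ?S / r) / 2" for f g :: "int \<Rightarrow> real" and r
      by (simp only: sum_divide_distrib[symmetric] sum.distrib sum_distrib_left[symmetric])
    from this[of ?u "\<lambda>s. \<integral>\<omega>. (cmod (P s \<omega>))\<^sup>2 \<partial>M" "\<lambda>s. \<integral>\<omega>. (cmod (Q s \<omega>))\<^sup>2 \<partial>M"] show ?thesis
      using iP iQ by simp
  qed
  also have "\<dots> \<le> (?u * (A\<^sup>2 * real n) + (B\<^sup>2 * real n) / ?u) / 2"
  proof -
    have "(\<Sum>s\<in>?S. \<integral>\<omega>. (cmod (P s \<omega>))\<^sup>2 \<partial>M) \<le> (\<Sum>s\<in>?S. A\<^sup>2 * (\<Sum>a\<in>?I. (y (a + s))\<^sup>2))"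
      unfolding P_def by (intro sum_mono norm_bound[OF \<eta>])
    also have "\<dots> \<le> A\<^sup>2 * real n"
      unfolding sum_distrib_left[symmetric] by (intro mult_left_mono tot y) simp
    finally have 1: "(\<Sum>s\<in>?S. \<integral>\<omega>. (cmod (P s \<omega>))\<^sup>2 \<partial>M) \<le> A\<^sup>2 * real n" .
    have "(\<Sum>s\<in>?S. \<integral>\<omega>. (cmod (Q s \<omega>))\<^sup>2 \<partial>M) \<le> (\<Sum>s\<in>?S. B\<^sup>2 * (\<Sum>a\<in>?I. (z (a + s))\<^sup>2))"
      unfolding Q_def by (intro sum_mono norm_bound[OF \<zeta>])
    also have "\<dots> \<le> B\<^sup>2 * real n"
      unfolding sum_distrib_left[symmetric] by (intro mult_left_mono tot z) simp
    finally have 2: "(\<Sum>s\<in>?S. \<integral>\<omega>. (cmod (Q s \<omega>))\<^sup>2 \<partial>M) \<le> B\<^sup>2 * real n" .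
    show ?thesis using pos by (intro divide_right_mono add_mono mult_left_mono 1 2) auto
  qed
  also have "\<dots> = real n * A * B" using pos by (simp add: field_simps power2_eq_square)
  finally show ?thesis unfolding dec .
qed

text \<open>With \<open>\<sigma> = sgn Q\<close>, the mean of \<open>|Q| = \<sigma> Q\<close> is linear in the numbers \<open>c a b\<close> below, so that the
  Fourier integral is only taken of a finite sum of constants.\<close>

lemma lag_weight_bilinear_bound_pos:
  assumes \<kappa>: "integrable lborel \<kappa>" and K: "\<And>t. complex_of_real (K t) = (CLINT u|lborel. \<kappa> u * cis (u * t))"
    and \<eta>: "spec_bound M \<eta> A" and \<zeta>: "spec_bound M \<zeta> B" and pos: "0 < A" "0 < B"
    and y: "unit_column n y" and z: "unit_column n z"
  shows "(\<integral>\<omega>. \<bar>qsum n (lag_weight K h n y z) \<eta> \<zeta> \<omega>\<bar> \<partial>M) \<le> (\<integral>u. cmod (\<kappa> u) \<partial>lborel) * (real n * A * B)"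
proof -
  let ?I = "{1..int n}" and ?w = "lag_weight K h n y z"
  let ?Q = "qsum n ?w \<eta> \<zeta>"
  have iQ: "integrable M ?Q" by (rule qsum_integrable[OF spec_boundD(2)[OF \<eta>] spec_boundD(2)[OF \<zeta>]])
  have Qm: "?Q \<in> borel_measurable M" using iQ by simp
  define \<sigma> where "\<sigma> \<omega> = sgn (?Q \<omega>)" for \<omega>
  have \<sigma>m: "\<sigma> \<in> borel_measurable M" unfolding \<sigma>_def using Qm by measurable
  have \<sigma>b: "\<bar>\<sigma> \<omega>\<bar> \<le> 1" for \<omega> by (simp add: \<sigma>_def abs_sgn_eq)
  have i\<sigma>: "integrable M (\<lambda>\<omega>. \<sigma> \<omega> * f \<omega>)" if f: "integrable M f" for f
  proof (rule Bochner_Integration.integrable_bound[OF f])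
    show "(\<lambda>\<omega>. \<sigma> \<omega> * f \<omega>) \<in> borel_measurable M" using \<sigma>m f by measurable
    show "AE \<omega> in M. norm (\<sigma> \<omega> * f \<omega>) \<le> norm (f \<omega>)"
      using \<sigma>b by (intro AE_I2) (simp add: abs_mult mult_left_le_one_le)
  qed
  have i: "integrable M (\<lambda>\<omega>. \<eta> a \<omega> * \<zeta> b \<omega>)" for a b
    using sq_integrable_mult_integrable[OF spec_boundD(2)[OF \<eta>, of a] spec_boundD(2)[OF \<zeta>, of b]] .
  define c where "c a b = (\<integral>\<omega>. \<sigma> \<omega> * (\<eta> a \<omega> * \<zeta> b \<omega>) \<partial>M)" for a b
  have "(\<integral>\<omega>. \<bar>?Q \<omega>\<bar> \<partial>M) = (\<integral>\<omega>. (\<Sum>a\<in>?I. \<Sum>b\<in>?I. ?w (a - b) * (\<sigma> \<omega> * (\<eta> a \<omega> * \<zeta> b \<omega>))) \<partial>M)"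
  proof (rule Bochner_Integration.integral_cong[OF refl])
    fix \<omega>
    have "\<bar>?Q \<omega>\<bar> = \<sigma> \<omega> * ?Q \<omega>" unfolding \<sigma>_def by (subst abs_sgn) (rule mult.commute)
    also have "\<dots> = (\<Sum>a\<in>?I. \<Sum>b\<in>?I. ?w (a - b) * (\<sigma> \<omega> * (\<eta> a \<omega> * \<zeta> b \<omega>)))"
      unfolding qsum_def sum_distrib_left by (intro sum.cong refl) (simp only: mult_ac)
    finally show "\<bar>?Q \<omega>\<bar> = (\<Sum>a\<in>?I. \<Sum>b\<in>?I. ?w (a - b) * (\<sigma> \<omega> * (\<eta> a \<omega> * \<zeta> b \<omega>)))" .
  qed
  also have "\<dots> = (\<Sum>a\<in>?I. \<Sum>b\<in>?I. ?w (a - b) * c a b)"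
    unfolding c_def
    by (simp only: Bochner_Integration.integral_sum Bochner_Integration.integrable_sum integrable_mult_right i\<sigma>[OF i] integral_mult_right_zero)
  finally have real: "(\<integral>\<omega>. \<bar>?Q \<omega>\<bar> \<partial>M) = (\<Sum>a\<in>?I. \<Sum>b\<in>?I. ?w (a - b) * c a b)" .
  \<comment> \<open>The form at the single frequency \<open>u\<close>, averaged against the sign.
    The phase bound with angle \<open>u / h\<close> controls it uniformly in \<open>u\<close> and
    \<open>h\<close>.\<close>
  define E where "E u = (\<Sum>a\<in>?I. \<Sum>b\<in>?I. complex_of_real (lag_product n y z (a - b) * c a b) * cis (u / h * of_int (a - b)))" for u
  have Eb: "cmod (E u) \<le> real n * A * B" for u
  proof -
    let ?S = "\<lambda>\<omega>. \<Sum>a\<in>?I. \<Sum>b\<in>?I. complex_of_real (lag_product n y z (a - b) * (\<eta> a \<omega> * \<zeta> b \<omega>)) * cis (u / h * of_int (a - b))"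
    have ic: "integrable M (\<lambda>\<omega>. complex_of_real (\<sigma> \<omega> * (\<eta> a \<omega> * \<zeta> b \<omega>)))" for a b
      by (rule integrable_of_real[OF i\<sigma>[OF i]])
    have "E u = (\<Sum>a\<in>?I. \<Sum>b\<in>?I. complex_of_real (c a b) * (complex_of_real (lag_product n y z (a - b)) * cis (u / h * of_int (a - b))))"
      unfolding E_def by (intro sum.cong refl) (simp only: of_real_mult mult_ac)
    also have "\<dots> = (\<Sum>a\<in>?I. \<Sum>b\<in>?I. (CLINT \<omega>|M. complex_of_real (\<sigma> \<omega> * (\<eta> a \<omega> * \<zeta> b \<omega>))) * (complex_of_real (lag_product n y z (a - b)) * cis (u / h * of_int (a - b))))"
      by (simp only: c_def integral_complex_of_real)
    also have "\<dots> = (CLINT \<omega>|M. (\<Sum>a\<in>?I. \<Sum>b\<in>?I. complex_of_real (\<sigma> \<omega> * (\<eta> a \<omega> * \<zeta> b \<omega>)) * (complex_of_real (lag_product n y z (a - b)) * cis (u / h * of_int (a - b)))))"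
      by (simp only: Bochner_Integration.integral_sum Bochner_Integration.integrable_sum integrable_mult_left ic integral_mult_left_zero)
    also have "\<dots> = (CLINT \<omega>|M. complex_of_real (\<sigma> \<omega>) * ?S \<omega>)"
      unfolding sum_distrib_left
      by (rule Bochner_Integration.integral_cong[OF refl], rule sum.cong[OF refl], rule sum.cong[OF refl]) (simp only: of_real_mult mult_ac)
    finally have E_eq: "E u = (CLINT \<omega>|M. complex_of_real (\<sigma> \<omega>) * ?S \<omega>)" .
    have "cmod (E u) \<le> (\<integral>\<omega>. cmod (complex_of_real (\<sigma> \<omega>) * ?S \<omega>) \<partial>M)"
      unfolding E_eq by (rule integral_norm_bound)
    also have "\<dots> \<le> (\<integral>\<omega>. cmod (?S \<omega>) \<partial>M)"
    proof (rule integral_mono_AE')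
      show "integrable M (\<lambda>\<omega>. cmod (?S \<omega>))"
        by (simp only: integrable_norm Bochner_Integration.integrable_sum integrable_mult_left integrable_of_real integrable_mult_right i)
      show "AE \<omega> in M. cmod (complex_of_real (\<sigma> \<omega>) * ?S \<omega>) \<le> cmod (?S \<omega>)"
        using \<sigma>b by (intro AE_I2) (simp only: norm_mult norm_of_real mult_left_le_one_le norm_ge_zero abs_ge_zero)
    qed (intro AE_I2 norm_ge_zero)
    also have "\<dots> \<le> real n * A * B" by (rule lag_product_phase_bound[OF \<eta> \<zeta> pos y z])
    finally show ?thesis .
  qed
  have i\<kappa>: "integrable lborel (\<lambda>u. \<kappa> u * cis (u * t))" for t
  proof (rule Bochner_Integration.integrable_bound[OF \<kappa>])
    have [measurable]: "\<kappa> \<in> borel_measurable borel" using \<kappa> by (auto dest: borel_measurable_integrable)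
    show "(\<lambda>u. \<kappa> u * cis (u * t)) \<in> borel_measurable lborel" by measurable
  qed (simp add: norm_mult)
  have E: "complex_of_real (\<integral>\<omega>. \<bar>?Q \<omega>\<bar> \<partial>M) = (CLINT u|lborel. \<kappa> u * E u)"
  proof -
    have "complex_of_real (\<integral>\<omega>. \<bar>?Q \<omega>\<bar> \<partial>M)
      = (\<Sum>a\<in>?I. \<Sum>b\<in>?I. (CLINT u|lborel. \<kappa> u * cis (u * (of_int (a - b) / h))) * complex_of_real (lag_product n y z (a - b) * c a b))"
      unfolding real of_real_sum
      by (intro sum.cong refl) (simp only: lag_weight_def K[symmetric] of_real_mult mult.assoc of_int_diff)
    also have "\<dots> = (CLINT u|lborel. (\<Sum>a\<in>?I. \<Sum>b\<in>?I. \<kappa> u * cis (u * (of_int (a - b) / h)) * complex_of_real (lag_product n y z (a - b) * c a b)))"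
      by (simp only: Bochner_Integration.integral_sum Bochner_Integration.integrable_sum integrable_mult_left i\<kappa> integral_mult_left_zero)
    also have "\<dots> = (CLINT u|lborel. \<kappa> u * E u)"
      unfolding E_def sum_distrib_left
    proof (rule Bochner_Integration.integral_cong[OF refl], rule sum.cong[OF refl], rule sum.cong[OF refl])
      fix u a b
      have "u * (of_int (a - b) / h) = u / h * of_int (a - b)" by simp
      then show "\<kappa> u * cis (u * (of_int (a - b) / h)) * complex_of_real (lag_product n y z (a - b) * c a b)
          = \<kappa> u * (complex_of_real (lag_product n y z (a - b) * c a b) * cis (u / h * of_int (a - b)))"
        by (simp only: mult_ac)
    qed
    finally show ?thesis .
  qed
  have "(\<integral>\<omega>. \<bar>?Q \<omega>\<bar> \<partial>M) \<le> cmod (complex_of_real (\<integral>\<omega>. \<bar>?Q \<omega>\<bar> \<partial>M))"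
    unfolding norm_of_real by (rule abs_ge_self)
  also have "\<dots> \<le> (\<integral>u. cmod (\<kappa> u * E u) \<partial>lborel)" unfolding E by (rule integral_norm_bound)
  also have "\<dots> \<le> (\<integral>u. cmod (\<kappa> u) * (real n * A * B) \<partial>lborel)"
  proof (rule integral_mono_AE')
    show "integrable lborel (\<lambda>u. cmod (\<kappa> u) * (real n * A * B))" using \<kappa> by simp
    show "AE u in lborel. cmod (\<kappa> u * E u) \<le> cmod (\<kappa> u) * (real n * A * B)"
      using Eb by (intro AE_I2) (simp only: norm_mult mult_left_mono norm_ge_zero)
  qed (use pos in simp)
  finally show ?thesis by (simp only: integral_mult_left_zero)
qed

text \<open>The weight \<open>B / A\<close> demands positive bounds; enlarging both by
  \<open>1 / (k + 1)\<close> and letting \<open>k\<close> grow covers the bound 0.\<close>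

lemma lag_weight_bilinear_bound:
  assumes \<kappa>: "integrable lborel \<kappa>" and K: "\<And>t. complex_of_real (K t) = (CLINT u|lborel. \<kappa> u * cis (u * t))"
    and \<eta>: "spec_bound M \<eta> A" and \<zeta>: "spec_bound M \<zeta> B"
    and y: "unit_column n y" and z: "unit_column n z"
  shows "(\<integral>\<omega>. \<bar>qsum n (lag_weight K h n y z) \<eta> \<zeta> \<omega>\<bar> \<partial>M) \<le> (\<integral>u. cmod (\<kappa> u) \<partial>lborel) * (real n * A * B)"
proof (rule LIMSEQ_le_const)
  let ?d = "\<lambda>k. 1 / real (Suc k)"
  have d: "?d \<longlonglongrightarrow> 0" using LIMSEQ_inverse_real_of_nat by (simp add: inverse_eq_divide)
  have "(\<lambda>k. (\<integral>u. cmod (\<kappa> u) \<partial>lborel) * (real n * (A + ?d k) * (B + ?d k)))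
      \<longlonglongrightarrow> (\<integral>u. cmod (\<kappa> u) \<partial>lborel) * (real n * (A + 0) * (B + 0))"
    by (intro tendsto_mult tendsto_add tendsto_const d)
  then show "(\<lambda>k. (\<integral>u. cmod (\<kappa> u) \<partial>lborel) * (real n * (A + ?d k) * (B + ?d k)))
      \<longlonglongrightarrow> (\<integral>u. cmod (\<kappa> u) \<partial>lborel) * (real n * A * B)" by simp
  have "(\<integral>\<omega>. \<bar>qsum n (lag_weight K h n y z) \<eta> \<zeta> \<omega>\<bar> \<partial>M)
      \<le> (\<integral>u. cmod (\<kappa> u) \<partial>lborel) * (real n * (A + ?d k) * (B + ?d k))" for k
    by (rule lag_weight_bilinear_bound_pos[OF \<kappa> K spec_bound_mono[OF \<eta>] spec_bound_mono[OF \<zeta>] _ _ y z])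
      (use spec_boundD(1)[OF \<eta>] spec_boundD(1)[OF \<zeta>] in \<open>auto intro: add_nonneg_pos\<close>)
  then show "\<exists>N. \<forall>k\<ge>N. (\<integral>\<omega>. \<bar>qsum n (lag_weight K h n y z) \<eta> \<zeta> \<omega>\<bar> \<partial>M)
      \<le> (\<integral>u. cmod (\<kappa> u) \<partial>lborel) * (real n * (A + ?d k) * (B + ?d k))" by blast
qed

end

text \<open>At most \<open>2 * c + 1\<close> integers lie in the band, and each contributes at most
  \<open>B\<^sup>2\<close>.\<close>

lemma band_sum_le:
  fixes f :: "int \<Rightarrow> real"
  assumes f: "\<And>k. f k \<noteq> 0 \<Longrightarrow> \<bar>of_int k\<bar> \<le> c" and b: "\<And>k. \<bar>f k\<bar> \<le> B" and c: "0 \<le> c" and S: "finite S"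
  shows "(\<Sum>k\<in>S. (f k)\<^sup>2) \<le> B\<^sup>2 * (2 * c + 1)"
proof -
  let ?T = "{- \<lfloor>c\<rfloor>..\<lfloor>c\<rfloor>}"
  have "(\<Sum>k\<in>S. (f k)\<^sup>2) = (\<Sum>k\<in>S \<inter> ?T. (f k)\<^sup>2)"
  proof (rule sum.mono_neutral_right[OF S])
    show "\<forall>k\<in>S - S \<inter> ?T. (f k)\<^sup>2 = 0"
    proof
      fix k assume "k \<in> S - S \<inter> ?T"
      then have "\<not> \<bar>of_int k\<bar> \<le> c" by (auto simp: abs_le_iff le_floor_iff, linarith)
      then show "(f k)\<^sup>2 = 0" using f by auto
    qed
  qed auto
  also have "\<dots> \<le> (\<Sum>k\<in>?T. B\<^sup>2)"
  proof (rule order_trans[OF sum_mono2])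
    show "(\<Sum>k\<in>?T. (f k)\<^sup>2) \<le> (\<Sum>k\<in>?T. B\<^sup>2)"
      using b by (intro sum_mono) (metis abs_ge_zero power2_abs power_mono)
  qed auto
  also have "\<dots> = B\<^sup>2 * of_int (2 * \<lfloor>c\<rfloor> + 1)" using c by simp
  also have "\<dots> \<le> B\<^sup>2 * (2 * c + 1)" proof (rule mult_left_mono)
    show "real_of_int (2 * \<lfloor>c\<rfloor> + 1) \<le> 2 * c + 1" by simp
  qed simp
  finally show ?thesis .
qed

text \<open>One constant \<open>C\<close> dominates both the kernel and the L1 norm of its frequency
  representation, and it is chosen before \<open>n\<close>, \<open>h\<close> and the columns. The
  support of the kernel confines the weight to lags of modulus at most \<open>c * h\<close>, whence
  the form of the row bound.\<close>

lemma (in finite_measure) good_weight_lag_weight: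
  assumes K: "lag_kernel K"
  shows "\<exists>C c. 0 \<le> c \<and> (\<forall>n h y z. 0 < h \<longrightarrow> unit_column n y \<longrightarrow> unit_column n z \<longrightarrow>
     good_weight M n C (C\<^sup>2 * (2 * (c * h) + 1)) (lag_weight K h n y z))"
proof -
  obtain c B \<kappa> where c: "0 \<le> c" "\<And>t. K t \<noteq> 0 \<Longrightarrow> \<bar>t\<bar> \<le> c" and B: "\<And>t. \<bar>K t\<bar> \<le> B"
    and \<kappa>: "integrable lborel \<kappa>" "\<And>t. complex_of_real (K t) = (CLINT u|lborel. \<kappa> u * cis (u * t))"
    using lag_kernel_properties[OF K] by metis
  define C where "C = max B (\<integral>u. cmod (\<kappa> u) \<partial>lborel)"
  have B0: "0 \<le> B" using B[of 0] by linarith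
  have C0: "0 \<le> C" using B0 by (simp add: C_def)
  have "good_weight M n C (C\<^sup>2 * (2 * (c * h) + 1)) (lag_weight K h n y z)"
    if h: "0 < h" and y: "unit_column n y" and z: "unit_column n z" for n h y z
    unfolding good_weight_def
  proof (intro conjI allI ballI impI C0)
    let ?w = "lag_weight K h n y z"
    show w: "\<bar>?w k\<bar> \<le> C" for k
    proof -
      have "\<bar>?w k\<bar> \<le> B * 1"
        unfolding lag_weight_def abs_mult by (intro mult_mono B abs_lag_product_le y z B0) simp
      then show ?thesis by (simp add: C_def)
    qed
    have supp: "\<bar>of_int k\<bar> \<le> c * h" if "?w k \<noteq> 0" for k
    proof -
      have "K (of_int k / h) \<noteq> 0" using that by (auto simp: lag_weight_def)
      then have "\<bar>of_int k / h\<bar> \<le> c" by (rule c(2))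
      then show ?thesis using h by (simp add: abs_divide pos_divide_le_eq)
    qed
    have ch: "0 \<le> c * h" using c(1) h by simp
    have band: "(\<Sum>k\<in>S. (?w k)\<^sup>2) \<le> C\<^sup>2 * (2 * (c * h) + 1)" if "finite S" for S
      by (rule band_sum_le[OF supp w ch that])
    fix a
    have "(\<Sum>b\<in>{1..int n}. (?w (a - b))\<^sup>2) = (\<Sum>k\<in>(\<lambda>b. a - b) ` {1..int n}. (?w k)\<^sup>2)"
      by (subst sum.reindex) (auto simp: inj_on_def)
    then show "(\<Sum>b\<in>{1..int n}. (?w (a - b))\<^sup>2) \<le> C\<^sup>2 * (2 * (c * h) + 1)" using band by simp
    have "(\<Sum>b\<in>{1..int n}. (?w (b - a))\<^sup>2) = (\<Sum>k\<in>(\<lambda>b. b - a) ` {1..int n}. (?w k)\<^sup>2)"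
      by (subst sum.reindex) (auto simp: inj_on_def)
    then show "(\<Sum>b\<in>{1..int n}. (?w (b - a))\<^sup>2) \<le> C\<^sup>2 * (2 * (c * h) + 1)" using band by simp
  next
    fix \<eta> \<zeta> :: "int \<Rightarrow> 'a \<Rightarrow> real" and A D assume e: "spec_bound M \<eta> A" "spec_bound M \<zeta> D"
    have "(\<integral>\<omega>. \<bar>qsum n (lag_weight K h n y z) \<eta> \<zeta> \<omega>\<bar> \<partial>M) \<le> (\<integral>u. cmod (\<kappa> u) \<partial>lborel) * (real n * A * D)"
      by (rule lag_weight_bilinear_bound[OF \<kappa> e y z])
    also have "\<dots> \<le> C * (real n * A * D)"
      using spec_boundD(1)[OF e(1)] spec_boundD(1)[OF e(2)] by (intro mult_right_mono) (auto simp: C_def)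
    finally show "(\<integral>\<omega>. \<bar>qsum n (lag_weight K h n y z) \<eta> \<zeta> \<omega>\<bar> \<partial>M) \<le> C * real n * A * D" by (simp only: mult.assoc)
  qed
  with c(1) show ?thesis by blast
qed

section \<open>Matrix inverses\<close>

lemma matrix_inv_eqI:
  fixes A B :: "'a::field^'n^'n"
  assumes "A ** B = mat 1"
  shows "matrix_inv A = B"
proof -
  have BA: "B ** A = mat 1" using assms matrix_left_right_inverse by blast
  have "A ** matrix_inv A = mat 1 \<and> matrix_inv A ** A = mat 1"
    unfolding matrix_inv_def by (rule someI[of _ B]) (use assms BA in blast)
  then show ?thesis by (metis BA matrix_mul_assoc matrix_mul_lid matrix_mul_rid)
qed

lemma matrix_inv_right:
  fixes A :: "'a::field^'n^'n"
  assumes "det A \<noteq> 0"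
  shows "A ** matrix_inv A = mat 1"
proof -
  obtain B where "A ** B = mat 1" using assms by (metis invertible_det_nz invertible_def)
  then show ?thesis using matrix_inv_eqI by metis
qed

text \<open>Cramer's rule for one entry of the inverse. As a quotient of polynomials in the entries
  of \<open>A\<close> it gives both the continuity and the measurability of
  \<open>matrix_inv\<close>.\<close>

definition cramer_entry :: "'a::field^'n^'n \<Rightarrow> 'n \<Rightarrow> 'n \<Rightarrow> 'a" where
  "cramer_entry A i j = det (\<chi> k l. if l = i then (if k = j then 1 else 0) else A $ k $ l) / det A"

lemma matrix_inv_cramer:
  fixes A :: "'a::field^'n^'n"
  assumes "det A \<noteq> 0"
  shows "matrix_inv A $ i $ j = cramer_entry A i j"
proof -
  have "A *v (\<chi> k. matrix_inv A $ k $ j) = (\<chi> k. if k = j then 1 else 0)"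
  proof (rule vec_eq_iff[THEN iffD2], rule allI)
    fix k
    have "(A *v (\<chi> k. matrix_inv A $ k $ j)) $ k = (A ** matrix_inv A) $ k $ j"
      by (simp add: matrix_vector_mult_def matrix_matrix_mult_def)
    then show "(A *v (\<chi> k. matrix_inv A $ k $ j)) $ k = (\<chi> k. if k = j then 1 else 0) $ k"
      by (simp add: matrix_inv_right[OF assms] mat_def)
  qed
  then have "(\<chi> k. matrix_inv A $ k $ j)
      = (\<chi> i. det (\<chi> k l. if l = i then (\<chi> k. if k = j then 1 else 0) $ k else A $ k $ l) / det A)"
    using cramer[OF assms] by blast
  then have "(\<chi> k. matrix_inv A $ k $ j) $ i
      = (\<chi> i. det (\<chi> k l. if l = i then (\<chi> k. if k = j then 1 else 0) $ k else A $ k $ l) / det A) $ i"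
    by (rule arg_cong)
  then show ?thesis by (simp only: vec_lambda_beta cramer_entry_def)
qed

lemma tendsto_det:
  fixes A :: "'b \<Rightarrow> real^'n^'n"
  assumes "\<And>i j. ((\<lambda>n. A n $ i $ j) \<longlongrightarrow> L $ i $ j) F"
  shows "((\<lambda>n. det (A n)) \<longlongrightarrow> det L) F"
  unfolding det_def by (intro tendsto_intros assms)

lemma tendsto_matrix_inv:
  fixes A :: "'b \<Rightarrow> real^'n^'n"
  assumes A: "\<And>i j. ((\<lambda>n. A n $ i $ j) \<longlongrightarrow> L $ i $ j) F" and L: "det L \<noteq> 0"
  shows "((\<lambda>n. matrix_inv (A n) $ i $ j) \<longlongrightarrow> matrix_inv L $ i $ j) F"
proof (rule Lim_transform_eventually)
  have "\<forall>\<^sub>F n in F. det (A n) \<noteq> 0" by (rule tendsto_imp_eventually_ne[OF tendsto_det[OF A] L])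
  then show "\<forall>\<^sub>F n in F. cramer_entry (A n) i j = matrix_inv (A n) $ i $ j"
    by eventually_elim (simp add: matrix_inv_cramer)
  have "((\<lambda>n. if l = i then (if k = j then 1 else 0) else A n $ k $ l) \<longlongrightarrow>
      (if l = i then (if k = j then 1 else 0) else L $ k $ l)) F" for k l
    using A by simp
  then show "((\<lambda>n. cramer_entry (A n) i j) \<longlongrightarrow> matrix_inv L $ i $ j) F"
    unfolding matrix_inv_cramer[OF L] cramer_entry_def
    by (intro tendsto_divide tendsto_det A L) simp
qed

lemma borel_measurable_det:
  fixes A :: "'b \<Rightarrow> real^'n^'n"
  assumes "\<And>i j. (\<lambda>\<omega>. A \<omega> $ i $ j) \<in> borel_measurable M"
  shows "(\<lambda>\<omega>. det (A \<omega>)) \<in> borel_measurable M"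
  unfolding det_def
  by (intro borel_measurable_sum borel_measurable_times borel_measurable_prod borel_measurable_const assms)

lemma borel_measurable_matrix_inv:
  fixes A :: "'b \<Rightarrow> real^'n^'n"
  assumes A: "\<And>i j. (\<lambda>\<omega>. A \<omega> $ i $ j) \<in> borel_measurable M"
  shows "(\<lambda>\<omega>. matrix_inv (A \<omega>) $ i $ j) \<in> borel_measurable M"
proof -
  \<comment> \<open>The inverse of a singular matrix is an unspecified constant.\<close>
  have "matrix_inv (A \<omega>) $ i $ j
      = (if det (A \<omega>) = 0 then (SOME B :: real^'n^'n. False) $ i $ j else cramer_entry (A \<omega>) i j)" for \<omega>
  proof (cases "det (A \<omega>) = 0")
    case True
    then have "\<not> (A \<omega> ** B = mat 1 \<and> B ** A \<omega> = mat 1)" for B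
      using invertible_det_nz[of "A \<omega>"] by (auto simp: invertible_def)
    then have "(\<lambda>B. A \<omega> ** B = mat 1 \<and> B ** A \<omega> = mat 1) = (\<lambda>B. False)" by blast
    then have "matrix_inv (A \<omega>) = (SOME B :: real^'n^'n. False)" unfolding matrix_inv_def by (rule arg_cong)
    then show ?thesis using True by simp
  qed (simp add: matrix_inv_cramer)
  note eq = this
  have "(\<lambda>\<omega>. if l = i then (if k = j then 1 else 0) else A \<omega> $ k $ l) \<in> borel_measurable M" for k l
    using A by simp
  then have "(\<lambda>\<omega>. cramer_entry (A \<omega>) i j) \<in> borel_measurable M"
    unfolding cramer_entry_def by (intro borel_measurable_divide borel_measurable_det A) simp
  moreover have "{\<omega> \<in> space M. det (A \<omega>) = 0} \<in> sets M"
    using borel_measurable_det[OF A] by measurable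
  ultimately show ?thesis unfolding eq by (intro measurable_If) simp_all
qed

lemma pos_definite_det:
  assumes "pos_definite A"
  shows "det A \<noteq> 0"
proof
  assume "det A = 0"
  then have "\<not> invertible A" by (simp add: invertible_det_nz)
  then obtain v where "v \<noteq> 0" "A *v v = 0"
    using matrix_left_invertible_ker[of A] invertible_left_inverse[of A] by blast
  then show False using assms unfolding pos_definite_def by (metis inner_zero_right less_irrefl)
qed

section \<open>Sums over lags\<close>

text \<open>A Toeplitz double sum sees the two sequences only through their products at each lag.
  Used once in each direction, this moves the lag weights from the design to the residuals in
  \<open>XtMX_Gamma_hat_eq\<close>.\<close>

lemma sum_by_lag:
  assumes f: "\<And>t. t \<notin> {1..int n} \<Longrightarrow> f t = 0"
  shows "(\<Sum>a\<in>{1..int n}. \<Sum>b\<in>{1..int n}. \<phi> (a - b) * (f a * g b)) = (\<Sum>k\<in>{- int n..int n}. \<phi> k * lag_product n f g k)"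
proof -
  have "(\<Sum>a\<in>{1..int n}. \<Sum>b\<in>{1..int n}. \<phi> (a - b) * (f a * g b)) = (\<Sum>b\<in>{1..int n}. \<Sum>a\<in>{1..int n}. \<phi> (a - b) * (f a * g b))"
    by (rule sum.swap)
  also have "\<dots> = (\<Sum>b\<in>{1..int n}. \<Sum>k\<in>{1 - b..int n - b}. \<phi> k * (f (b + k) * g b))"
  proof (rule sum.cong[OF refl])
    fix b
    show "(\<Sum>a\<in>{1..int n}. \<phi> (a - b) * (f a * g b)) = (\<Sum>k\<in>{1 - b..int n - b}. \<phi> k * (f (b + k) * g b))"
      by (rule sum.reindex_bij_witness[where i = "\<lambda>k. k + b" and j = "\<lambda>a. a - b"]) auto
  qed
  also have "\<dots> = (\<Sum>b\<in>{1..int n}. \<Sum>k\<in>{- int n..int n}. \<phi> k * (f (b + k) * g b))"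
    by (rule sum.cong[OF refl], rule sum.mono_neutral_left) (auto simp: f)
  also have "\<dots> = (\<Sum>k\<in>{- int n..int n}. \<phi> k * lag_product n f g k)"
    unfolding lag_product_def sum_distrib_left by (rule sum.swap)
  finally show ?thesis .
qed

lemma sum_nat_eq_sum_int: "(\<Sum>i=1..n. f (int i)) = (\<Sum>t\<in>{1..int n}. f t)"
  by (rule sum.reindex_bij_witness[where i = nat and j = int]) auto

text \<open>Extension by zero gives a lag product at lags of both signs, equal at \<open>k\<close>
  and \<open>- k\<close> by symmetry; this matches the modulus of the lag in
  \<open>gamma_hat\<close>.\<close>

lemma lag_product_residuals:
  fixes r :: "nat \<Rightarrow> real" and n :: nat
  defines "r' \<equiv> \<lambda>t. if t \<in> {1..int n} then r (nat t) else 0"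
  assumes k: "\<bar>k\<bar> \<le> int n"
  shows "lag_product n r' r' k = (\<Sum>i=1..n - nat \<bar>k\<bar>. r i * r (i + nat \<bar>k\<bar>))"
proof -
  have "(\<Sum>i=1..n - nat \<bar>k\<bar>. r i * r (i + nat \<bar>k\<bar>)) = (\<Sum>t\<in>{1..int n - \<bar>k\<bar>}. r' t * r' (t + \<bar>k\<bar>))"
    by (rule sum.reindex_bij_witness[where i = nat and j = int])
      (use k in \<open>auto simp: r'_def nat_add_distrib\<close>)
  also have "\<dots> = lag_product n r' r' k"
  proof (cases "0 \<le> k")
    case True
    have "lag_product n r' r' k = (\<Sum>t\<in>{1..int n - k}. r' (t + k) * r' t)"
      unfolding lag_product_def by (rule sum.mono_neutral_right) (use True in \<open>auto simp: r'_def\<close>)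
    with True show ?thesis by (simp add: mult.commute)
  next
    case False
    have "lag_product n r' r' k = (\<Sum>t\<in>{1 - k..int n}. r' (t + k) * r' t)"
      unfolding lag_product_def by (rule sum.mono_neutral_right) (use False in \<open>auto simp: r'_def\<close>)
    also have "\<dots> = (\<Sum>t\<in>{1..int n - \<bar>k\<bar>}. r' t * r' (t + \<bar>k\<bar>))"
      by (rule sum.reindex_bij_witness[where i = "\<lambda>t. t - k" and j = "\<lambda>t. t + k"]) (use False in auto)
    finally show ?thesis by simp
  qed
  finally show ?thesis by simp
qed

text \<open>The number of pairs at lag \<open>k\<close> in the square. Divided by \<open>n\<close>
  it is the factor that tends to 1 in the limit of the means.\<close>

lemma lag_count:
  assumes "\<bar>k\<bar> \<le> int n"
  shows "lag_product n (\<lambda>t. if t \<in> {1..int n} then 1 else 0) (\<lambda>_. 1) k = real n - \<bar>of_int k\<bar>"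
proof -
  have "lag_product n (\<lambda>t. if t \<in> {1..int n} then 1 else 0) (\<lambda>_. 1) k = (\<Sum>t\<in>{t \<in> {1..int n}. t + k \<in> {1..int n}}. 1)"
    unfolding lag_product_def by (subst sum.inter_filter) auto
  also have "{t \<in> {1..int n}. t + k \<in> {1..int n}} = {max 1 (1 - k)..min (int n) (int n - k)}" by auto
  also have "(\<Sum>t\<in>{max 1 (1 - k)..min (int n) (int n - k)}. 1::real) = real n - \<bar>of_int k\<bar>"
    using assms by (cases "0 \<le> k") (auto simp: of_nat_diff)
  finally show ?thesis .
qed

section \<open>The limit of the means\<close>

text \<open>Tannery's theorem for the sum over lags. At a fixed lag the kernel tends to
  \<open>K 0 = 1\<close> by continuity, the lag product to \<open>\<rho> k\<close> and the
  proportion of pairs to 1; a bound of the kernel times \<open>\<bar>\<gamma> k\<bar>\<close> is a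
  summable majorant.\<close>

lemma lag_sum_tendsto:
  fixes K :: "real \<Rightarrow> real" and h :: "nat \<Rightarrow> real" and \<gamma> :: "int \<Rightarrow> real" and y z :: "nat \<Rightarrow> int \<Rightarrow> real"
  assumes K: "lag_kernel K" and h: "filterlim h at_top sequentially"
    and \<gamma>: "summable (\<lambda>m. \<bar>\<gamma> (int_decode m)\<bar>)"
    and y: "\<And>n. unit_column n (y n)" and z: "\<And>n. unit_column n (z n)"
    and \<rho>: "\<And>k. (\<lambda>n. lag_product n (y n) (z n) k) \<longlonglongrightarrow> \<rho> k"
  shows "(\<lambda>n. (\<Sum>a\<in>{1..int n}. \<Sum>b\<in>{1..int n}. lag_weight K (h n) n (y n) (z n) (a - b) * \<gamma> (a - b)) / real n)
     \<longlonglongrightarrow> (\<Sum>m. \<gamma> (int_decode m) * \<rho> (int_decode m))"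
proof -
  obtain B where B: "\<And>t. \<bar>K t\<bar> \<le> B" using lag_kernel_properties[OF K] by metis
  have B0: "0 \<le> B" using B[of 0] by linarith
  \<comment> \<open>For fixed \<open>n\<close> only lags up to \<open>n\<close> count; the extension
    by 0 gives a series over all integers, enumerated by \<open>int_decode\<close>.\<close>
  define t where "t k n = (if \<bar>k\<bar> \<le> int n then lag_weight K (h n) n (y n) (z n) k * \<gamma> k * ((real n - \<bar>of_int k\<bar>) / real n) else 0)" for k n
  have eq: "(\<Sum>a\<in>{1..int n}. \<Sum>b\<in>{1..int n}. lag_weight K (h n) n (y n) (z n) (a - b) * \<gamma> (a - b)) / real n = (\<Sum>m. t (int_decode m) n)" for n
  proof -
    let ?\<phi> = "\<lambda>k. lag_weight K (h n) n (y n) (z n) k * \<gamma> k" and ?one = "\<lambda>t::int. if t \<in> {1..int n} then 1 else 0 :: real"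
    have "(\<Sum>a\<in>{1..int n}. \<Sum>b\<in>{1..int n}. ?\<phi> (a - b)) = (\<Sum>a\<in>{1..int n}. \<Sum>b\<in>{1..int n}. ?\<phi> (a - b) * (?one a * 1))"
      by (intro sum.cong refl) simp
    also have "\<dots> = (\<Sum>k\<in>{- int n..int n}. ?\<phi> k * lag_product n ?one (\<lambda>_. 1) k)"
      by (rule sum_by_lag) simp
    also have "\<dots> = (\<Sum>k\<in>{- int n..int n}. ?\<phi> k * (real n - \<bar>of_int k\<bar>))"
      by (rule sum.cong[OF refl]) (subst lag_count, auto)
    finally have "(\<Sum>a\<in>{1..int n}. \<Sum>b\<in>{1..int n}. ?\<phi> (a - b)) / real n = (\<Sum>k\<in>{- int n..int n}. t k n)"
      by (simp add: sum_divide_distrib t_def abs_le_iff)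
    also have "\<dots> = (\<Sum>m\<in>int_encode ` {- int n..int n}. t (int_decode m) n)"
      by (subst sum.reindex) (auto simp: inj_on_def int_encode_eq)
    also have "\<dots> = (\<Sum>m. t (int_decode m) n)"
    proof (rule suminf_finite[symmetric])
      fix m assume "m \<notin> int_encode ` {- int n..int n}"
      then have "int_decode m \<notin> {- int n..int n}" by (metis image_eqI int_decode_inverse)
      then show "t (int_decode m) n = 0" by (auto simp: t_def)
    qed simp
    finally show ?thesis .
  qed
  have lim: "(\<lambda>n. t k n) \<longlonglongrightarrow> \<gamma> k * \<rho> k" for k
  proof (rule Lim_transform_eventually)
    have cK: "isCont K 0" using K by (simp add: lag_kernel_def continuous_on_eq_continuous_at)
    have "(\<lambda>n. of_int k / h n) \<longlonglongrightarrow> 0" by (rule real_tendsto_divide_at_top[OF tendsto_const h])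
    then have "(\<lambda>n. K (of_int k / h n)) \<longlonglongrightarrow> K 0" by (rule isCont_tendsto_compose[OF cK])
    then have lK: "(\<lambda>n. K (of_int k / h n)) \<longlonglongrightarrow> 1" using K by (simp add: lag_kernel_def)
    have "(\<lambda>n. 1 - \<bar>of_int k\<bar> / real n) \<longlonglongrightarrow> 1 - 0"
      by (rule tendsto_diff[OF tendsto_const real_tendsto_divide_at_top[OF tendsto_const filterlim_real_sequentially]])
    then have "(\<lambda>n. K (of_int k / h n) * lag_product n (y n) (z n) k * \<gamma> k * (1 - \<bar>of_int k\<bar> / real n)) \<longlonglongrightarrow> 1 * \<rho> k * \<gamma> k * (1 - 0)"
      by (intro tendsto_mult lK \<rho> tendsto_const)
    then show "(\<lambda>n. K (of_int k / h n) * lag_product n (y n) (z n) k * \<gamma> k * (1 - \<bar>of_int k\<bar> / real n)) \<longlonglongrightarrow> \<gamma> k * \<rho> k"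
      by (simp add: mult.commute)
    show "\<forall>\<^sub>F n in sequentially. K (of_int k / h n) * lag_product n (y n) (z n) k * \<gamma> k * (1 - \<bar>of_int k\<bar> / real n) = t k n"
      using eventually_ge_at_top[of "Suc (nat \<bar>k\<bar>)"]
    proof eventually_elim
      case (elim n)
      then have "\<bar>k\<bar> \<le> int n" "real n > 0" by linarith+
      then show ?case by (simp add: t_def lag_weight_def diff_divide_distrib)
    qed
  qed
  have bound: "norm (t k n) \<le> B * \<bar>\<gamma> k\<bar>" for k n
  proof (cases "\<bar>k\<bar> \<le> int n")
    case True
    have "\<bar>(real n - \<bar>of_int k\<bar>) / real n\<bar> \<le> 1"
    proof -
      have "\<bar>of_int k :: real\<bar> \<le> real n" using True by linarith
      then show ?thesis by (cases "n = 0") (auto simp: divide_simps)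
    qed
    moreover have "\<bar>lag_weight K (h n) n (y n) (z n) k\<bar> \<le> B * 1"
      unfolding lag_weight_def abs_mult by (intro mult_mono B abs_lag_product_le y z B0) simp
    ultimately have "\<bar>lag_weight K (h n) n (y n) (z n) k\<bar> * \<bar>\<gamma> k\<bar> * \<bar>(real n - \<bar>of_int k\<bar>) / real n\<bar> \<le> (B * 1) * \<bar>\<gamma> k\<bar> * 1"
      using B0 by (intro mult_mono mult_nonneg_nonneg) auto
    with True show ?thesis by (simp add: t_def abs_mult)
  qed (simp add: t_def B0)
  have "(\<lambda>n. \<Sum>m. t (int_decode m) n) \<longlonglongrightarrow> (\<Sum>m. \<gamma> (int_decode m) * \<rho> (int_decode m))"
  proof -
    have "eventually (\<lambda>(m, n). norm (t (int_decode m) n) \<le> B * \<bar>\<gamma> (int_decode m)\<bar>) (at_top \<times>\<^sub>F sequentially)"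
      using bound by (intro always_eventually) auto
    from tannerys_theorem[OF lim this summable_mult[OF \<gamma>] sequentially_bot] show ?thesis by blast
  qed
  then show ?thesis by (simp only: eq)
qed

section \<open>Replacing errors by residuals\<close>

lemma qsum_cong:
  assumes "\<And>i. i \<in> {1..int n} \<Longrightarrow> \<eta> i \<omega> = \<eta>' i \<omega>" "\<And>i. i \<in> {1..int n} \<Longrightarrow> \<zeta> i \<omega> = \<zeta>' i \<omega>"
  shows "qsum n w \<eta> \<zeta> \<omega> = qsum n w \<eta>' \<zeta>' \<omega>"
  unfolding qsum_def by (intro sum.cong refl) (simp add: assms)

lemma qsum_sum_left: "qsum n w (\<lambda>i \<omega>. \<Sum>j\<in>J. f j i \<omega>) \<zeta> \<omega> = (\<Sum>j\<in>J. qsum n w (f j) \<zeta> \<omega>)"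
  by (induction J rule: infinite_finite_induct) (simp_all add: qsum_add_left, simp_all add: qsum_def)

lemma qsum_sum_right: "qsum n w \<eta> (\<lambda>i \<omega>. \<Sum>j\<in>J. f j i \<omega>) \<omega> = (\<Sum>j\<in>J. qsum n w \<eta> (f j) \<omega>)"
  by (induction J rule: infinite_finite_induct) (simp_all add: qsum_add_right, simp_all add: qsum_def)

lemma column_weight_sum_le:
  fixes y :: "int \<Rightarrow> real"
  assumes y: "unit_column n y" and H: "\<And>b. b \<in> {1..int n} \<Longrightarrow> (\<Sum>a\<in>{1..int n}. (w (a - b))\<^sup>2) \<le> H"
  shows "(\<Sum>b\<in>{1..int n}. (\<Sum>a\<in>{1..int n}. y a * w (a - b))\<^sup>2) \<le> real n * H"
proof -
  have "(\<Sum>a\<in>{1..int n}. y a * w (a - b))\<^sup>2 \<le> H" if b: "b \<in> {1..int n}" for b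
  proof -
    have "(\<Sum>a\<in>{1..int n}. y a * w (a - b))\<^sup>2 \<le> (\<Sum>a\<in>{1..int n}. (y a)\<^sup>2) * (\<Sum>a\<in>{1..int n}. (w (a - b))\<^sup>2)"
      by (rule Cauchy_Schwarz_ineq_sum)
    also have "\<dots> \<le> 1 * H" by (rule mult_mono) (use y H[OF b] in \<open>auto simp: unit_column_def sum_nonneg\<close>)
    finally show ?thesis by simp
  qed
  then have "(\<Sum>b\<in>{1..int n}. (\<Sum>a\<in>{1..int n}. y a * w (a - b))\<^sup>2) \<le> (\<Sum>b\<in>{1..int n}. H)" by (rule sum_mono)
  then show ?thesis by simp
qed

text \<open>For a fixed column times one random variable the double sum factorises into
  \<open>v\<close> and a linear form in \<open>\<zeta>\<close>, to which the spectral bound applies.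
  By Cauchy-Schwarz its coefficients have squared length at most \<open>n * H\<close>.\<close>

lemma qsum_column_left:
  assumes y: "unit_column n y" and v: "sq_integrable M v" and \<zeta>: "spec_bound M \<zeta> A"
    and H: "\<And>b. b \<in> {1..int n} \<Longrightarrow> (\<Sum>a\<in>{1..int n}. (w (a - b))\<^sup>2) \<le> H"
  shows "(\<integral>\<omega>. \<bar>qsum n w (\<lambda>i \<omega>. y i * v \<omega>) \<zeta> \<omega>\<bar> \<partial>M) \<le> L2_norm M v * (A * sqrt (real n * H))"
proof -
  let ?I = "{1..int n}"
  let ?c = "\<lambda>b. \<Sum>a\<in>?I. y a * w (a - b)"
  have "qsum n w (\<lambda>i \<omega>. y i * v \<omega>) \<zeta> \<omega> = v \<omega> * (\<Sum>b\<in>?I. ?c b * \<zeta> b \<omega>)" for \<omega>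
    unfolding qsum_def sum_distrib_left sum_distrib_right by (subst sum.swap, intro sum.cong refl) (simp only: mult_ac)
  then have "(\<integral>\<omega>. \<bar>qsum n w (\<lambda>i \<omega>. y i * v \<omega>) \<zeta> \<omega>\<bar> \<partial>M) = (\<integral>\<omega>. \<bar>v \<omega> * (\<Sum>b\<in>?I. ?c b * \<zeta> b \<omega>)\<bar> \<partial>M)"
    by (simp only:)
  also have "\<dots> \<le> L2_norm M v * L2_norm M (\<lambda>\<omega>. \<Sum>b\<in>?I. ?c b * \<zeta> b \<omega>)"
    by (rule L2_norm_cauchy_schwarz[OF v sq_integrable_sum[OF sq_integrable_cmult[OF spec_boundD(2)[OF \<zeta>]]]])
  also have "\<dots> \<le> L2_norm M v * (A * L2_set ?c ?I)"
    by (intro mult_left_mono spec_boundD(4)[OF \<zeta>] L2_norm_nonneg) simp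
  also have "\<dots> \<le> L2_norm M v * (A * sqrt (real n * H))"
    unfolding L2_set_def
    by (intro mult_left_mono real_sqrt_le_mono column_weight_sum_le y H L2_norm_nonneg spec_boundD(1)[OF \<zeta>])
  finally show ?thesis .
qed

lemma qsum_column_right:
  assumes y: "unit_column n y" and v: "sq_integrable M v" and \<zeta>: "spec_bound M \<zeta> A"
    and H: "\<And>a. a \<in> {1..int n} \<Longrightarrow> (\<Sum>b\<in>{1..int n}. (w (a - b))\<^sup>2) \<le> H"
  shows "(\<integral>\<omega>. \<bar>qsum n w \<zeta> (\<lambda>i \<omega>. y i * v \<omega>) \<omega>\<bar> \<partial>M) \<le> L2_norm M v * (A * sqrt (real n * H))"
  unfolding qsum_transpose[of n w] by (rule qsum_column_left[OF y v \<zeta>]) (use H in simp)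

lemma qsum_column_both:
  assumes y: "unit_column n y" and z: "unit_column n z" and v: "sq_integrable M v" and v': "sq_integrable M v'"
    and H: "\<And>b. b \<in> {1..int n} \<Longrightarrow> (\<Sum>a\<in>{1..int n}. (w (a - b))\<^sup>2) \<le> H"
  shows "(\<integral>\<omega>. \<bar>qsum n w (\<lambda>i \<omega>. y i * v \<omega>) (\<lambda>i \<omega>. z i * v' \<omega>) \<omega>\<bar> \<partial>M) \<le> L2_norm M v * L2_norm M v' * sqrt (real n * H)"
proof -
  let ?I = "{1..int n}"
  let ?c = "\<lambda>b. \<Sum>a\<in>?I. y a * w (a - b)"
  have "qsum n w (\<lambda>i \<omega>. y i * v \<omega>) (\<lambda>i \<omega>. z i * v' \<omega>) \<omega> = (\<Sum>b\<in>?I. ?c b * z b) * (v \<omega> * v' \<omega>)" for \<omega>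
    unfolding qsum_def sum_distrib_left sum_distrib_right by (subst sum.swap, intro sum.cong refl) (simp only: mult_ac)
  then have "(\<integral>\<omega>. \<bar>qsum n w (\<lambda>i \<omega>. y i * v \<omega>) (\<lambda>i \<omega>. z i * v' \<omega>) \<omega>\<bar> \<partial>M) = \<bar>\<Sum>b\<in>?I. ?c b * z b\<bar> * (\<integral>\<omega>. \<bar>v \<omega> * v' \<omega>\<bar> \<partial>M)"
    by (simp only: abs_mult[of "sum _ _"] integral_mult_right_zero)
  also have "\<dots> \<le> sqrt (real n * H) * (L2_norm M v * L2_norm M v')"
  proof (rule mult_mono)
    have "\<bar>\<Sum>b\<in>?I. ?c b * z b\<bar> \<le> (\<Sum>b\<in>?I. \<bar>?c b\<bar> * \<bar>z b\<bar>)"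
      by (rule order_trans[OF sum_abs]) (simp add: abs_mult)
    also have "\<dots> \<le> L2_set ?c ?I * L2_set z ?I" by (rule L2_set_mult_ineq)
    also have "\<dots> \<le> sqrt (real n * H) * 1"
    proof (rule mult_mono)
      show "L2_set ?c ?I \<le> sqrt (real n * H)"
        unfolding L2_set_def by (intro real_sqrt_le_mono column_weight_sum_le y H)
      then show "0 \<le> sqrt (real n * H)" by (rule order_trans[OF L2_set_nonneg])
      show "L2_set z ?I \<le> 1" using z by (simp add: L2_set_def unit_column_def)
    qed simp
    finally show "\<bar>\<Sum>b\<in>?I. ?c b * z b\<bar> \<le> sqrt (real n * H)" by simp
    then show "0 \<le> sqrt (real n * H)" by (rule order_trans[OF abs_ge_zero])
    show "(\<integral>\<omega>. \<bar>v \<omega> * v' \<omega>\<bar> \<partial>M) \<le> L2_norm M v * L2_norm M v'" by (rule L2_norm_cauchy_schwarz[OF v v'])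
  qed simp
  finally show ?thesis by (simp add: mult_ac)
qed

lemma (in finite_measure) integral_abs_sum_le:
  fixes f :: "'j \<Rightarrow> 'a \<Rightarrow> real"
  assumes "\<And>j. j \<in> J \<Longrightarrow> integrable M (f j)" "\<And>j. j \<in> J \<Longrightarrow> (\<integral>\<omega>. \<bar>f j \<omega>\<bar> \<partial>M) \<le> B j"
  shows "(\<integral>\<omega>. \<bar>\<Sum>j\<in>J. f j \<omega>\<bar> \<partial>M) \<le> (\<Sum>j\<in>J. B j)"
  using assms
proof (induction J rule: infinite_finite_induct)
  case (insert j J)
  have "(\<integral>\<omega>. \<bar>f j \<omega> + (\<Sum>j\<in>J. f j \<omega>)\<bar> \<partial>M) \<le> (\<integral>\<omega>. \<bar>f j \<omega>\<bar> \<partial>M) + (\<integral>\<omega>. \<bar>\<Sum>j\<in>J. f j \<omega>\<bar> \<partial>M)"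
    by (rule integral_abs_triangle) (use insert in auto)
  also have "\<dots> \<le> B j + (\<Sum>j\<in>J. B j)" by (intro add_mono insert) (use insert in auto)
  finally show ?case using insert by simp
qed auto

text \<open>The fitted part is a finite combination of unit columns with square integrable
  coefficients, so each of the two mixed terms and the quadratic one carries the factor
  \<open>sqrt (n * H)\<close> instead of \<open>n\<close>.\<close>

lemma (in finite_measure) qsum_residual_bound:
  fixes v :: "'j \<Rightarrow> 'a \<Rightarrow> real"
  assumes w: "good_weight M n C H w" and \<zeta>: "spec_bound M \<zeta> A" and J: "finite J"
    and y: "\<And>j. unit_column n (y j)" and v: "\<And>j. sq_integrable M (v j)"
  defines "r \<equiv> \<lambda>i \<omega>. \<zeta> i \<omega> - (\<Sum>j\<in>J. y j i * v j \<omega>)"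
  shows "(\<integral>\<omega>. \<bar>qsum n w r r \<omega> - qsum n w \<zeta> \<zeta> \<omega>\<bar> \<partial>M)
     \<le> (2 * A * (\<Sum>j\<in>J. L2_norm M (v j)) + (\<Sum>j\<in>J. L2_norm M (v j))\<^sup>2) * sqrt (real n * H)"
proof -
  let ?e = "\<lambda>j i \<omega>. y j i * v j \<omega>" and ?s = "sqrt (real n * H)"
  let ?\<eta> = "\<lambda>i \<omega>. \<Sum>j\<in>J. ?e j i \<omega>"
  have H: "\<And>a. a \<in> {1..int n} \<Longrightarrow> (\<Sum>b\<in>{1..int n}. (w (a - b))\<^sup>2) \<le> H"
    "\<And>a. a \<in> {1..int n} \<Longrightarrow> (\<Sum>b\<in>{1..int n}. (w (b - a))\<^sup>2) \<le> H"
    using w by (auto simp: good_weight_def)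
  have sqe: "sq_integrable M (?e j i)" for j i by (rule sq_integrable_cmult[OF v])
  note sq\<zeta> = spec_boundD(2)[OF \<zeta>]
  let ?a = "\<lambda>\<omega>. \<Sum>j\<in>J. - qsum n w (?e j) \<zeta> \<omega>" and ?b = "\<lambda>\<omega>. \<Sum>j\<in>J. - qsum n w \<zeta> (?e j) \<omega>"
    and ?c = "\<lambda>\<omega>. \<Sum>j\<in>J. \<Sum>k\<in>J. qsum n w (?e j) (?e k) \<omega>"
  have "qsum n w r r \<omega> - qsum n w \<zeta> \<zeta> \<omega> = (?a \<omega> + ?b \<omega>) + ?c \<omega>" for \<omega>
    unfolding r_def qsum_diff_left qsum_diff_right qsum_sum_left qsum_sum_right by (simp add: sum_negf)
  note dec = this
  have ia: "integrable M (qsum n w (?e j) \<zeta>)" "integrable M (qsum n w \<zeta> (?e j))" "integrable M (qsum n w (?e j) (?e k))" for j k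
    by (rule qsum_integrable[OF sqe sq\<zeta>] qsum_integrable[OF sq\<zeta> sqe] qsum_integrable[OF sqe sqe])+
  have i: "integrable M ?a" "integrable M ?b" "integrable M ?c"
    by (intro Bochner_Integration.integrable_sum Bochner_Integration.integrable_minus ia)+
  have b1: "(\<integral>\<omega>. \<bar>?a \<omega>\<bar> \<partial>M) \<le> (\<Sum>j\<in>J. L2_norm M (v j) * (A * ?s))"
    by (rule integral_abs_sum_le) (use ia qsum_column_left[OF y v \<zeta> H(2)] in simp_all)
  have b2: "(\<integral>\<omega>. \<bar>?b \<omega>\<bar> \<partial>M) \<le> (\<Sum>j\<in>J. L2_norm M (v j) * (A * ?s))"
    by (rule integral_abs_sum_le) (use ia qsum_column_right[OF y v \<zeta> H(1)] in simp_all)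
  have b3: "(\<integral>\<omega>. \<bar>?c \<omega>\<bar> \<partial>M) \<le> (\<Sum>j\<in>J. \<Sum>k\<in>J. L2_norm M (v j) * L2_norm M (v k) * ?s)"
    by (rule integral_abs_sum_le, rule Bochner_Integration.integrable_sum, rule ia, rule integral_abs_sum_le, rule ia)
      (rule qsum_column_both[OF y y v v H(2)])
  have "(\<integral>\<omega>. \<bar>qsum n w r r \<omega> - qsum n w \<zeta> \<zeta> \<omega>\<bar> \<partial>M) = (\<integral>\<omega>. \<bar>(?a \<omega> + ?b \<omega>) + ?c \<omega>\<bar> \<partial>M)"
    by (simp only: dec)
  also have "\<dots> \<le> (\<integral>\<omega>. \<bar>?a \<omega>\<bar> \<partial>M) + (\<integral>\<omega>. \<bar>?b \<omega>\<bar> \<partial>M) + (\<integral>\<omega>. \<bar>?c \<omega>\<bar> \<partial>M)"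
    using integral_abs_triangle[OF Bochner_Integration.integrable_add[OF i(1,2)] i(3)] integral_abs_triangle[OF i(1,2)] by linarith
  also have "\<dots> \<le> (\<Sum>j\<in>J. L2_norm M (v j) * (A * ?s)) + (\<Sum>j\<in>J. L2_norm M (v j) * (A * ?s)) + (\<Sum>j\<in>J. \<Sum>k\<in>J. L2_norm M (v j) * L2_norm M (v k) * ?s)"
    by (intro add_mono b1 b2 b3)
  also have "\<dots> = (2 * A * (\<Sum>j\<in>J. L2_norm M (v j)) + (\<Sum>j\<in>J. L2_norm M (v j))\<^sup>2) * ?s"
  proof -
    have "(\<Sum>j\<in>J. \<Sum>k\<in>J. L2_norm M (v j) * L2_norm M (v k) * ?s) = (\<Sum>j\<in>J. L2_norm M (v j))\<^sup>2 * ?s"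
      by (subst power2_eq_square, subst sum_product) (simp only: sum_distrib_right)
    moreover have "(\<Sum>j\<in>J. L2_norm M (v j) * (A * ?s)) = A * (\<Sum>j\<in>J. L2_norm M (v j)) * ?s"
      unfolding sum_distrib_left sum_distrib_right by (intro sum.cong refl) (simp only: mult_ac)
    ultimately show ?thesis by (simp only: distrib_right)
  qed
  finally show ?thesis .
qed

section \<open>Normalised designs\<close>

definition column :: "(nat \<Rightarrow> real^'p) \<Rightarrow> nat \<Rightarrow> 'p \<Rightarrow> int \<Rightarrow> real" where
  "column x n j t = (if t \<in> {1..int n} then x (nat t) $ j / d_norm x n j else 0)"

lemma d_norm_square: "(d_norm x n j)\<^sup>2 = (\<Sum>i=1..n. (x i $ j)\<^sup>2)"
  by (simp add: d_norm_def sum_nonneg)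

lemma unit_column_column: "unit_column n (column x n j)"
proof -
  have "(\<Sum>t\<in>{1..int n}. (column x n j t)\<^sup>2) = (\<Sum>i=1..n. (column x n j (int i))\<^sup>2)"
    by (rule sum_nat_eq_sum_int[symmetric])
  also have "\<dots> = (\<Sum>i=1..n. (x i $ j)\<^sup>2 / (d_norm x n j)\<^sup>2)"
    by (intro sum.cong refl) (simp add: column_def power_divide)
  also have "\<dots> = (d_norm x n j)\<^sup>2 / (d_norm x n j)\<^sup>2" by (simp only: d_norm_square sum_divide_distrib)
  also have "\<dots> \<le> 1" by simp
  finally show ?thesis by (auto simp: unit_column_def column_def)
qed

text \<open>The autocovariances \<open>R(k)\<close> of the design at all lags \<open>k \<in> \<int>\<close>: those at negative lags are the
  transposes of those at positive ones. The order of the indices is the one of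
  \<^term>\<open>lag_product\<close>.\<close>

definition R_int :: "(nat \<Rightarrow> real^'p) \<Rightarrow> int \<Rightarrow> 'p \<Rightarrow> 'p \<Rightarrow> real" where
  "R_int x k j l = (if 0 \<le> k then R_mat x (nat k) $ l $ j else R_mat x (nat (- k)) $ j $ l)"

text \<open>\<open>rho_seq\<close> shifts its second factor and \<open>lag_product\<close> the
  first, whence the exchange of \<open>j\<close> and \<open>l\<close>.\<close>

lemma lag_product_column_nonneg: "lag_product n (column x n j) (column x n l) (int k) = rho_seq x k l j n"
proof -
  have "rho_seq x k l j n = (\<Sum>t\<in>{1..int n - int k}. column x n j (t + int k) * column x n l t)"
    unfolding rho_seq_def
    by (rule sum.reindex_bij_witness[where i = nat and j = int]) (auto simp: column_def nat_add_distrib nat_diff_distrib mult.commute)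
  also have "\<dots> = lag_product n (column x n j) (column x n l) (int k)"
    unfolding lag_product_def by (rule sum.mono_neutral_left) (auto simp: column_def)
  finally show ?thesis by simp
qed

lemma lag_product_column_neg: "lag_product n (column x n j) (column x n l) (- int k) = rho_seq x k j l n"
proof -
  have "lag_product n (column x n j) (column x n l) (- int k) = (\<Sum>t\<in>{1 + int k..int n}. column x n j (t + - int k) * column x n l t)"
    unfolding lag_product_def by (rule sum.mono_neutral_right) (auto simp: column_def)
  also have "\<dots> = (\<Sum>t\<in>{1..int n - int k}. column x n l (t + int k) * column x n j t)"
    by (rule sum.reindex_bij_witness[where i = "\<lambda>t. t + int k" and j = "\<lambda>t. t - int k"]) (auto simp: mult.commute)
  also have "\<dots> = lag_product n (column x n l) (column x n j) (int k)"
    unfolding lag_product_def by (rule sum.mono_neutral_left) (auto simp: column_def)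
  finally show ?thesis by (simp add: lag_product_column_nonneg)
qed

lemma lag_product_column_tendsto:
  assumes "\<And>j l k. convergent (rho_seq x k j l)"
  shows "(\<lambda>n. lag_product n (column x n j) (column x n l) k) \<longlonglongrightarrow> R_int x k j l"
proof (cases "0 \<le> k")
  case True
  then have "(\<lambda>n. lag_product n (column x n j) (column x n l) k) = rho_seq x (nat k) l j"
    using lag_product_column_nonneg[of _ x j l "nat k"] by auto
  then show ?thesis using True assms by (simp add: R_int_def R_mat_def convergent_LIMSEQ_iff)
next
  case False
  then have "(\<lambda>n. lag_product n (column x n j) (column x n l) k) = rho_seq x (nat (- k)) j l"
    using lag_product_column_neg[of _ x j l "nat (- k)"] by auto
  then show ?thesis using False assms by (simp add: R_int_def R_mat_def convergent_LIMSEQ_iff)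
qed

text \<open>Up to the factor \<open>(2 * pi)\<^sup>2\<close> this is the matrix \<open>G\<close>,
  written without the spectral measure. The enumeration of the integers makes it an ordinary series,
  whose measurability in the design is immediate.\<close>

definition S_mat :: "(int \<Rightarrow> real) \<Rightarrow> (nat \<Rightarrow> real^'p) \<Rightarrow> real^'p^'p" where
  "S_mat \<gamma> x = (\<chi> j l. \<Sum>m. \<gamma> (int_decode m) * R_int x (int_decode m) j l)"

definition C_lim :: "(int \<Rightarrow> real) \<Rightarrow> (nat \<Rightarrow> real^'p) \<Rightarrow> real^'p^'p" where
  "C_lim \<gamma> x = matrix_inv (R_mat x 0) ** S_mat \<gamma> x ** matrix_inv (R_mat x 0)"

section \<open>Deterministic designs\<close>

text \<open>Unlike the Gram matrix itself, this one converges, namely to the invertible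
  \<open>R(0)\<close>; its inverse therefore has a limit too.\<close>

definition normalized_gram :: "(nat \<Rightarrow> real^'p) \<Rightarrow> nat \<Rightarrow> real^'p^'p" where
  "normalized_gram x n = (\<chi> j l. XtX x n $ j $ l / (d_norm x n j * d_norm x n l))"

lemma normalized_gram_eq: "normalized_gram x n $ j $ l = rho_seq x 0 j l n"
  by (simp add: normalized_gram_def XtX_def rho_seq_def sum_divide_distrib)

lemma diag_mult_left: "(D_mat x n ** A) $ j $ l = d_norm x n j * A $ j $ l"
proof -
  have "(D_mat x n ** A) $ j $ l = (\<Sum>k\<in>UNIV. if k = j then d_norm x n j * A $ j $ l else 0)"
    unfolding matrix_matrix_mult_def D_mat_def vec_lambda_beta by (intro sum.cong refl) auto
  then show ?thesis by simp
qed

lemma diag_mult_right: "(A ** D_mat x n) $ j $ l = A $ j $ l * d_norm x n l"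
proof -
  have "(A ** D_mat x n) $ j $ l = (\<Sum>k\<in>UNIV. if k = l then A $ j $ l * d_norm x n l else 0)"
    unfolding matrix_matrix_mult_def D_mat_def vec_lambda_beta by (intro sum.cong refl) auto
  then show ?thesis by simp
qed

lemma triple_product_entry:
  "(A ** B ** C) $ j $ l = (\<Sum>a\<in>UNIV. \<Sum>b\<in>UNIV. A $ j $ a * B $ a $ b * C $ b $ l)"
  for A B C :: "'a::comm_semiring_1^'n^'n"
  unfolding matrix_matrix_mult_def vec_lambda_beta sum_distrib_right by (rule sum.swap)

section \<open>The estimator in normalised coordinates\<close>

context
  fixes x :: "nat \<Rightarrow> real^'p" and n :: nat
  assumes d: "\<And>j. d_norm x n j \<noteq> 0" and det: "det (normalized_gram x n) \<noteq> 0"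
begin

abbreviation (input) "Tn \<equiv> matrix_inv (normalized_gram x n)"

lemma XtX_right_inverse: "XtX x n ** (\<chi> j l. Tn $ j $ l / (d_norm x n j * d_norm x n l)) = mat 1"
proof (rule vec_eq_iff[THEN iffD2], rule allI, rule vec_eq_iff[THEN iffD2], rule allI)
  fix j l
  have "(XtX x n ** (\<chi> j l. Tn $ j $ l / (d_norm x n j * d_norm x n l))) $ j $ l
      = (\<Sum>k\<in>UNIV. d_norm x n j / d_norm x n l * (normalized_gram x n $ j $ k * Tn $ k $ l))"
    unfolding matrix_matrix_mult_def vec_lambda_beta
    by (intro sum.cong refl) (use d in \<open>simp add: normalized_gram_def\<close>)
  also have "\<dots> = d_norm x n j / d_norm x n l * (normalized_gram x n ** Tn) $ j $ l"
    unfolding matrix_matrix_mult_def vec_lambda_beta sum_distrib_left ..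
  also have "\<dots> = mat 1 $ j $ l" using d by (simp add: matrix_inv_right[OF det] mat_def)
  finally show "(XtX x n ** (\<chi> j l. Tn $ j $ l / (d_norm x n j * d_norm x n l))) $ j $ l = mat 1 $ j $ l" .
qed

lemma matrix_inv_XtX: "matrix_inv (XtX x n) $ j $ l = Tn $ j $ l / (d_norm x n j * d_norm x n l)"
  by (subst matrix_inv_eqI[OF XtX_right_inverse]) simp

text \<open>The outer diagonal matrices cancel against the normalisations contained in the inverse
  Gram matrices. What remains are the inverses \<open>Tn\<close> and the normalised middle matrix,
  all of which will have limits.\<close>

lemma C_hat_entry:
  "C_hat K h x y n $ j $ l = (\<Sum>a\<in>UNIV. \<Sum>b\<in>UNIV. Tn $ j $ a *
      (XtMX x (Gamma_hat K h x y n) n $ a $ b / (d_norm x n a * d_norm x n b)) * Tn $ b $ l)"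
proof -
  let ?I = "matrix_inv (XtX x n)" and ?M = "XtMX x (Gamma_hat K h x y n) n"
  have "C_hat K h x y n = (D_mat x n ** ?I) ** ?M ** (?I ** D_mat x n)"
    by (simp only: C_hat_def matrix_mul_assoc)
  then have "C_hat K h x y n $ j $ l = (\<Sum>a\<in>UNIV. \<Sum>b\<in>UNIV. (D_mat x n ** ?I) $ j $ a * ?M $ a $ b * (?I ** D_mat x n) $ b $ l)"
    by (simp only: triple_product_entry)
  also have "\<dots> = (\<Sum>a\<in>UNIV. \<Sum>b\<in>UNIV. Tn $ j $ a * (?M $ a $ b / (d_norm x n a * d_norm x n b)) * Tn $ b $ l)"
    by (intro sum.cong refl) (use d in \<open>simp add: diag_mult_left diag_mult_right matrix_inv_XtX\<close>)
  finally show ?thesis .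
qed

text \<open>The mean of the observations lies in the column space and is fitted exactly, so
  \<open>\<beta>\<close> drops out. The correction is a combination of unit columns with
  coefficients linear in the errors, as \<open>qsum_residual_bound\<close> requires.\<close>

lemma residual_eq:
  assumes i: "i \<in> {1..n}" and y: "\<And>i. 1 \<le> i \<Longrightarrow> y i = x i \<bullet> \<beta> + e (int i)"
  shows "residual x y n i = e (int i)
     - (\<Sum>j\<in>UNIV. column x n j (int i) * (\<Sum>l\<in>UNIV. Tn $ j $ l * (\<Sum>t\<in>{1..int n}. column x n l t * e t)))"
proof -
  let ?I = "matrix_inv (XtX x n)"
  define u where "u = (\<chi> l. \<Sum>i=1..n. x i $ l * e (int i))"
  have "XtY x y n = XtX x n *v \<beta> + u"
  proof (rule vec_eq_iff[THEN iffD2], rule allI)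
    fix l
    have "XtY x y n $ l = (\<Sum>i=1..n. x i $ l * (\<Sum>j\<in>UNIV. x i $ j * \<beta> $ j)) + u $ l"
      by (simp add: XtY_def y u_def sum.distrib distrib_left inner_vec_def)
    also have "(\<Sum>i=1..n. x i $ l * (\<Sum>j\<in>UNIV. x i $ j * \<beta> $ j)) = (XtX x n *v \<beta>) $ l"
      unfolding XtX_def matrix_vector_mult_def vec_lambda_beta sum_distrib_left sum_distrib_right
      by (subst sum.swap) (simp only: mult.assoc)
    finally show "XtY x y n $ l = (XtX x n *v \<beta> + u) $ l" by simp
  qed
  moreover have "?I ** XtX x n = mat 1"
    using matrix_left_right_inverse[of "XtX x n" ?I] matrix_inv_eqI[OF XtX_right_inverse] XtX_right_inverse by simp
  ultimately have "lse x y n = \<beta> + ?I *v u"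
    by (simp add: lse_def matrix_vector_right_distrib matrix_vector_mul_assoc)
  then have "residual x y n i = e (int i) - x i \<bullet> (?I *v u)"
    using i by (simp add: residual_def y inner_add_right)
  also have "x i \<bullet> (?I *v u) = (\<Sum>j\<in>UNIV. column x n j (int i) * (\<Sum>l\<in>UNIV. Tn $ j $ l * (u $ l / d_norm x n l)))"
    using i d by (simp add: inner_vec_def matrix_vector_mult_def matrix_inv_XtX column_def sum_distrib_left sum_distrib_right mult.assoc)
  also have "\<dots> = (\<Sum>j\<in>UNIV. column x n j (int i) * (\<Sum>l\<in>UNIV. Tn $ j $ l * (\<Sum>t\<in>{1..int n}. column x n l t * e t)))"
  proof -
    have "u $ l / d_norm x n l = (\<Sum>t\<in>{1..int n}. column x n l t * e t)" for l
    proof -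
      have "(\<Sum>t\<in>{1..int n}. column x n l t * e t) = (\<Sum>i=1..n. column x n l (int i) * e (int i))"
        by (rule sum_nat_eq_sum_int[symmetric])
      also have "\<dots> = (\<Sum>i=1..n. x i $ l * e (int i) / d_norm x n l)"
        by (intro sum.cong refl) (simp add: column_def)
      finally show ?thesis by (simp add: u_def sum_divide_distrib)
    qed
    then show ?thesis by simp
  qed
  finally show ?thesis .
qed

end

text \<open>Design and residuals enter only through their products at each lag, so their roles can
  be exchanged: a form in the design with random weights becomes a form in the residuals with
  weights determined by the design. The point \<open>\<omega>\<close> is a dummy argument of
  \<open>qsum\<close>.\<close>

lemma XtMX_Gamma_hat_eq:
  fixes x :: "nat \<Rightarrow> real^'p"
  shows "XtMX x (Gamma_hat K h x y n) n $ a $ b / (d_norm x n a * d_norm x n b)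
    = qsum n (lag_weight K h n (column x n a) (column x n b)) (\<lambda>t _. residual x y n (nat t)) (\<lambda>t _. residual x y n (nat t)) \<omega> / real n"
proof -
  let ?r = "\<lambda>t. if t \<in> {1..int n} then residual x y n (nat t) else 0"
  let ?\<phi> = "\<lambda>k. K (of_int k / h) * gamma_hat x y n k" and ?w = "lag_weight K h n (column x n a) (column x n b)"
  have "XtMX x (Gamma_hat K h x y n) n $ a $ b / (d_norm x n a * d_norm x n b)
      = (\<Sum>s=1..n. \<Sum>t=1..n. ?\<phi> (int s - int t) * (column x n a (int s) * column x n b (int t)))"
    unfolding XtMX_def vec_lambda_beta sum_divide_distrib
    by (intro sum.cong refl) (simp add: Gamma_hat_def column_def)
  also have "\<dots> = (\<Sum>s=1..n. \<Sum>t\<in>{1..int n}. ?\<phi> (int s - t) * (column x n a (int s) * column x n b t))"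
    by (intro sum.cong refl sum_nat_eq_sum_int)
  also have "\<dots> = (\<Sum>s\<in>{1..int n}. \<Sum>t\<in>{1..int n}. ?\<phi> (s - t) * (column x n a s * column x n b t))"
    by (rule sum_nat_eq_sum_int)
  also have "\<dots> = (\<Sum>k\<in>{- int n..int n}. ?\<phi> k * lag_product n (column x n a) (column x n b) k)"
    by (rule sum_by_lag) (auto simp: column_def)
  also have "\<dots> = (\<Sum>k\<in>{- int n..int n}. ?w k * lag_product n ?r ?r k / real n)"
  proof (rule sum.cong[OF refl])
    fix k assume "k \<in> {- int n..int n}"
    then have k: "\<bar>k\<bar> \<le> int n" by auto
    show "?\<phi> k * lag_product n (column x n a) (column x n b) k = ?w k * lag_product n ?r ?r k / real n"
      unfolding lag_product_residuals[OF k] by (simp add: lag_weight_def gamma_hat_def)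
  qed
  also have "\<dots> = (\<Sum>k\<in>{- int n..int n}. ?w k * lag_product n ?r ?r k) / real n"
    by (rule sum_divide_distrib[symmetric])
  also have "(\<Sum>k\<in>{- int n..int n}. ?w k * lag_product n ?r ?r k) = (\<Sum>s\<in>{1..int n}. \<Sum>t\<in>{1..int n}. ?w (s - t) * (?r s * ?r t))"
    by (rule sum_by_lag[symmetric]) auto
  also have "\<dots> = qsum n ?w (\<lambda>t _. residual x y n (nat t)) (\<lambda>t _. residual x y n (nat t)) \<omega>"
    unfolding qsum_def by (intro sum.cong refl) simp
  finally show ?thesis .
qed

lemma (in hannan_process) autocov_summable: "summable (\<lambda>m. \<bar>autocov M \<epsilon> (int_decode m)\<bar>)"
proof (rule summable_on_imp_summable)
  show "(\<lambda>m. \<bar>autocov M \<epsilon> (int_decode m)\<bar>) summable_on UNIV"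
    using autocov_abs_summable summable_on_reindex_bij_betw[OF bij_int_decode, of "\<lambda>k. \<bar>autocov M \<epsilon> k\<bar>"] by simp
qed

section \<open>Consistency for a fixed design\<close>

locale regular_design = hannan_process M T F0 \<epsilon>0
  for M :: "'a measure" and T :: "'a \<Rightarrow> 'a" and F0 :: "'a measure" and \<epsilon>0 :: "'a \<Rightarrow> real" +
  fixes x :: "nat \<Rightarrow> real^'p" and \<beta> :: "real^'p" and K :: "real \<Rightarrow> real" and h :: "nat \<Rightarrow> real"
  assumes kernel: "lag_kernel K" and h_pos: "\<And>n. n \<ge> 1 \<Longrightarrow> h n > 0"
    and h_infty: "filterlim h at_top sequentially" and h_small: "(\<lambda>n. h n / real n) \<longlonglongrightarrow> 0"
    and d_infty: "\<And>j. filterlim (\<lambda>n. d_norm x n j) at_top sequentially"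
    and rho_convergent: "\<And>j l k. convergent (rho_seq x k j l)"
    and R0_pos: "pos_definite (R_mat x 0)"
begin

abbreviation \<gamma> :: "int \<Rightarrow> real" where "\<gamma> \<equiv> autocov M \<epsilon>"
abbreviation Yobs :: "'a \<Rightarrow> nat \<Rightarrow> real" where "Yobs \<omega> i \<equiv> x i \<bullet> \<beta> + \<epsilon> (int i) \<omega>"
abbreviation Tn :: "nat \<Rightarrow> real^'p^'p" where "Tn n \<equiv> matrix_inv (normalized_gram x n)"
abbreviation wt :: "'p \<Rightarrow> 'p \<Rightarrow> nat \<Rightarrow> int \<Rightarrow> real" where
  "wt a b n \<equiv> lag_weight K (h n) n (column x n a) (column x n b)"

definition Q :: "'p \<Rightarrow> 'p \<Rightarrow> nat \<Rightarrow> 'a \<Rightarrow> real" where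
  "Q a b n \<omega> = XtMX x (Gamma_hat K (h n) x (Yobs \<omega>) n) n $ a $ b / (d_norm x n a * d_norm x n b)"

lemma normalized_gram_tendsto: "(\<lambda>n. normalized_gram x n $ j $ l) \<longlonglongrightarrow> R_mat x 0 $ j $ l"
  using rho_convergent[of 0 j l] by (simp add: normalized_gram_eq R_mat_def convergent_LIMSEQ_iff)

lemma R0_det: "det (R_mat x 0) \<noteq> 0"
  by (rule pos_definite_det[OF R0_pos])

lemma Tn_tendsto: "(\<lambda>n. Tn n $ j $ l) \<longlonglongrightarrow> matrix_inv (R_mat x 0) $ j $ l"
  by (rule tendsto_matrix_inv[OF normalized_gram_tendsto R0_det])

lemma eventually_regular:
  "\<forall>\<^sub>F n in sequentially. (\<forall>j. d_norm x n j \<noteq> 0) \<and> det (normalized_gram x n) \<noteq> 0 \<and> 0 < n"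
proof (intro eventually_conj)
  have "\<forall>\<^sub>F n in sequentially. d_norm x n j \<noteq> 0" for j
    using filterlim_at_top_dense[THEN iffD1, OF d_infty[of j], rule_format, of 0] by eventually_elim simp
  then show "\<forall>\<^sub>F n in sequentially. \<forall>j. d_norm x n j \<noteq> 0"
    using eventually_ball_finite[of UNIV "\<lambda>n j. d_norm x n j \<noteq> 0" sequentially] by simp
  show "\<forall>\<^sub>F n in sequentially. det (normalized_gram x n) \<noteq> 0"
    by (rule tendsto_imp_eventually_ne[OF tendsto_det[OF normalized_gram_tendsto] R0_det])
qed (rule eventually_gt_at_top)

text \<open>The right side of \<open>residual_eq\<close> at all integers: a square integrable
  process for every \<open>n\<close>, equal to the residuals on \<open>{1..int n}\<close> once the
  column norms and the Gram determinant are nonzero.\<close>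

definition rs :: "nat \<Rightarrow> int \<Rightarrow> 'a \<Rightarrow> real" where
  "rs n i \<omega> = \<epsilon> i \<omega> - (\<Sum>j\<in>UNIV. column x n j i *
     (\<Sum>l\<in>UNIV. Tn n $ j $ l * (\<Sum>t\<in>{1..int n}. column x n l t * \<epsilon> t \<omega>)))"

lemma Q_eq:
  assumes "\<And>j. d_norm x n j \<noteq> 0" "det (normalized_gram x n) \<noteq> 0"
  shows "Q a b n \<omega> = qsum n (wt a b n) (rs n) (rs n) \<omega> / real n"
proof -
  have res: "residual x (Yobs \<omega>) n (nat i) = rs n i \<omega>" if "i \<in> {1..int n}" for i
  proof -
    have "nat i \<in> {1..n}" "int (nat i) = i" using that by auto
    then show ?thesis
      using residual_eq[OF assms, of "nat i" "Yobs \<omega>" \<beta> "\<lambda>t. \<epsilon> t \<omega>"] by (simp add: rs_def)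
  qed
  have "qsum n (wt a b n) (\<lambda>t _. residual x (Yobs \<omega>) n (nat t)) (\<lambda>t _. residual x (Yobs \<omega>) n (nat t)) \<omega>
      = qsum n (wt a b n) (rs n) (rs n) \<omega>"
    by (rule qsum_cong) (simp_all only: res)
  then show ?thesis unfolding Q_def XtMX_Gamma_hat_eq[where \<omega> = \<omega>] by simp
qed

lemma sq_integrable_v: "sq_integrable M (\<lambda>\<omega>. \<Sum>l\<in>UNIV. Tn n $ j $ l * (\<Sum>t\<in>{1..int n}. column x n l t * \<epsilon> t \<omega>))"
  by (rule sq_integrable_sum[OF sq_integrable_cmult[OF sq_integrable_sum[OF sq_integrable_cmult[OF sq_integrable_\<epsilon>]]]])

lemma sq_integrable_rs: "sq_integrable M (rs n i)"
  unfolding rs_def by (rule sq_integrable_diff[OF sq_integrable_\<epsilon> sq_integrable_sum[OF sq_integrable_cmult[OF sq_integrable_v]]])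

lemma Q_integrable:
  assumes "\<And>j. d_norm x n j \<noteq> 0" "det (normalized_gram x n) \<noteq> 0"
  shows "integrable M (Q a b n)"
proof -
  have "Q a b n = (\<lambda>\<omega>. qsum n (wt a b n) (rs n) (rs n) \<omega> / real n)" using Q_eq[OF assms] by (rule ext)
  moreover have "integrable M (\<lambda>\<omega>. qsum n (wt a b n) (rs n) (rs n) \<omega> / real n)"
    by (rule integrable_divide_zero[OF qsum_integrable[OF sq_integrable_rs sq_integrable_rs]])
  ultimately show ?thesis by simp
qed

text \<open>Three errors, the three terms of \<open>g\<close> in the proof: residuals against
  errors, deviation of the form from its mean, and distance of the normalised mean from its
  limit.\<close>

lemma Q_tendsto: "(\<lambda>n. \<integral>\<omega>. \<bar>Q a b n \<omega> - S_mat \<gamma> x $ a $ b\<bar> \<partial>M) \<longlonglongrightarrow> 0"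
proof -
  obtain C c where c: "0 \<le> c" and gw: "\<And>n h y z. 0 < h \<Longrightarrow> unit_column n y \<Longrightarrow> unit_column n z \<Longrightarrow>
     good_weight M n C (C\<^sup>2 * (2 * (c * h) + 1)) (lag_weight K h n y z)"
    using good_weight_lag_weight[OF kernel] by blast
  define H where "H n = C\<^sup>2 * (2 * (c * h n) + 1)" for n
  have "good_weight M n C (H n) (wt a b n)" if "1 \<le> n" for n
    unfolding H_def by (rule gw[OF h_pos[OF that] unit_column_column unit_column_column])
  then have ev: "\<forall>\<^sub>F n in sequentially. good_weight M n C (H n) (wt a b n)"
    using eventually_ge_at_top[of 1] by (rule eventually_mono[rotated])
  have Hn: "(\<lambda>n. H n / real n) \<longlonglongrightarrow> 0"
  proof -
    have "(\<lambda>n. C\<^sup>2 * (2 * c * (h n / real n) + 1 / real n)) \<longlonglongrightarrow> C\<^sup>2 * (2 * c * 0 + 0)"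
      by (intro tendsto_mult tendsto_add tendsto_const h_small lim_1_over_n)
    moreover have "C\<^sup>2 * (2 * c * (h n / real n) + 1 / real n) = H n / real n" for n
      by (simp add: H_def add_divide_distrib distrib_left mult.assoc)
    ultimately show ?thesis by simp
  qed
  let ?m = "\<lambda>n. \<Sum>s\<in>{1..int n}. \<Sum>t\<in>{1..int n}. wt a b n (s - t) * \<gamma> (s - t)"
  have conc: "(\<lambda>n. (\<integral>\<omega>. \<bar>qsum n (wt a b n) \<epsilon> \<epsilon> \<omega> - ?m n\<bar> \<partial>M) / real n) \<longlonglongrightarrow> 0"
    by (rule quadratic_form_concentration[OF ev Hn])
  have bias: "(\<lambda>n. ?m n / real n) \<longlonglongrightarrow> S_mat \<gamma> x $ a $ b"
    unfolding S_mat_def vec_lambda_beta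
    by (rule lag_sum_tendsto[OF kernel h_infty autocov_summable unit_column_column unit_column_column
        lag_product_column_tendsto[OF rho_convergent]])
  \<comment> \<open>Bounds the norms of the fitted coefficients, since a unit column paired with the
    errors has norm at most \<open>hannan_const\<close>. It converges together with
    \<open>Tn\<close>.\<close>
  define V where "V n = (\<Sum>j\<in>UNIV. \<Sum>l\<in>UNIV. \<bar>Tn n $ j $ l\<bar> * hannan_const)" for n
  let ?v = "\<lambda>n j \<omega>. \<Sum>l\<in>UNIV. Tn n $ j $ l * (\<Sum>t\<in>{1..int n}. column x n l t * \<epsilon> t \<omega>)"
  have vV: "(\<Sum>j\<in>UNIV. L2_norm M (?v n j)) \<le> V n" for n
    unfolding V_def
  proof (rule sum_mono)
    fix j
    have "L2_norm M (?v n j) \<le> (\<Sum>l\<in>UNIV. L2_norm M (\<lambda>\<omega>. Tn n $ j $ l * (\<Sum>t\<in>{1..int n}. column x n l t * \<epsilon> t \<omega>)))"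
      by (rule L2_norm_sum_le[OF sq_integrable_cmult[OF sq_integrable_sum[OF sq_integrable_cmult[OF sq_integrable_\<epsilon>]]]])
    also have "\<dots> \<le> (\<Sum>l\<in>UNIV. \<bar>Tn n $ j $ l\<bar> * hannan_const)"
      unfolding L2_norm_cmult
    proof (intro sum_mono mult_left_mono)
      fix l
      have "L2_norm M (\<lambda>\<omega>. \<Sum>t\<in>{1..int n}. column x n l t * \<epsilon> t \<omega>) \<le> hannan_const * L2_set (column x n l) {1..int n}"
        by (rule spec_boundD(4)[OF spec_bound_\<epsilon>]) simp
      also have "\<dots> \<le> hannan_const * 1"
        using unit_column_column[of n x l] spec_boundD(1)[OF spec_bound_\<epsilon>]
        by (intro mult_left_mono) (simp_all add: L2_set_def unit_column_def)
      finally show "L2_norm M (\<lambda>\<omega>. \<Sum>t\<in>{1..int n}. column x n l t * \<epsilon> t \<omega>) \<le> hannan_const" by simp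
    qed simp
    finally show "L2_norm M (?v n j) \<le> (\<Sum>l\<in>UNIV. \<bar>Tn n $ j $ l\<bar> * hannan_const)" .
  qed
  have V0: "0 \<le> (\<Sum>j\<in>UNIV. L2_norm M (?v n j))" for n by (intro sum_nonneg L2_norm_nonneg)
  define g where "g n = (2 * hannan_const * V n + (V n)\<^sup>2) * sqrt (H n / real n)
      + (\<integral>\<omega>. \<bar>qsum n (wt a b n) \<epsilon> \<epsilon> \<omega> - ?m n\<bar> \<partial>M) / real n + \<bar>?m n / real n - S_mat \<gamma> x $ a $ b\<bar>" for n
  have "g \<longlonglongrightarrow> (2 * hannan_const * (\<Sum>j\<in>UNIV. \<Sum>l\<in>UNIV. \<bar>matrix_inv (R_mat x 0) $ j $ l\<bar> * hannan_const)
       + (\<Sum>j\<in>UNIV. \<Sum>l\<in>UNIV. \<bar>matrix_inv (R_mat x 0) $ j $ l\<bar> * hannan_const)\<^sup>2) * sqrt 0 + 0 + \<bar>S_mat \<gamma> x $ a $ b - S_mat \<gamma> x $ a $ b\<bar>"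
    unfolding g_def[abs_def] V_def
    by (intro tendsto_add tendsto_mult tendsto_power tendsto_sum tendsto_rabs tendsto_diff tendsto_const
        tendsto_real_sqrt Tn_tendsto Hn conc bias)
  then have g0: "g \<longlonglongrightarrow> 0" by simp
  have le: "\<forall>\<^sub>F n in sequentially. (\<integral>\<omega>. \<bar>Q a b n \<omega> - S_mat \<gamma> x $ a $ b\<bar> \<partial>M) \<le> g n"
    using eventually_regular ev
  proof eventually_elim
    case (elim n)
    then have n: "0 < real n" and d: "\<And>j. d_norm x n j \<noteq> 0" and det: "det (normalized_gram x n) \<noteq> 0" by auto
    let ?q = "qsum n (wt a b n) \<epsilon> \<epsilon>" and ?r = "qsum n (wt a b n) (rs n) (rs n)"
    have iq: "integrable M ?q" "integrable M ?r"
      by (rule qsum_integrable[OF sq_integrable_\<epsilon> sq_integrable_\<epsilon>] qsum_integrable[OF sq_integrable_rs sq_integrable_rs])+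
    have "(\<integral>\<omega>. \<bar>?r \<omega> - ?q \<omega>\<bar> \<partial>M)
       \<le> (2 * hannan_const * (\<Sum>j\<in>UNIV. L2_norm M (?v n j)) + (\<Sum>j\<in>UNIV. L2_norm M (?v n j))\<^sup>2) * sqrt (real n * H n)"
      unfolding rs_def
      by (rule qsum_residual_bound[OF elim(2) spec_bound_\<epsilon> finite unit_column_column sq_integrable_v])
    also have "\<dots> \<le> (2 * hannan_const * V n + (V n)\<^sup>2) * sqrt (real n * H n)"
      using vV[of n] V0[of n] spec_boundD(1)[OF spec_bound_\<epsilon>] c h_pos[of n] n
      by (intro mult_right_mono add_mono mult_left_mono power_mono) (auto simp: H_def)
    also have "sqrt (real n * H n) = real n * sqrt (H n / real n)"
    proof -
      have "real n * H n = (real n)\<^sup>2 * (H n / real n)" using n by (simp add: power2_eq_square)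
      then show ?thesis by (simp only: real_sqrt_mult) simp
    qed
    finally have r: "(\<integral>\<omega>. \<bar>?r \<omega> - ?q \<omega>\<bar> \<partial>M) / real n \<le> (2 * hannan_const * V n + (V n)\<^sup>2) * sqrt (H n / real n)"
      using n by (simp add: pos_divide_le_eq mult_ac)
    have "(\<integral>\<omega>. \<bar>Q a b n \<omega> - S_mat \<gamma> x $ a $ b\<bar> \<partial>M)
      = (\<integral>\<omega>. \<bar>((?r \<omega> - ?q \<omega>) / real n + (?q \<omega> - ?m n) / real n) + (?m n / real n - S_mat \<gamma> x $ a $ b)\<bar> \<partial>M)"
      by (simp add: Q_eq[OF d det] diff_divide_distrib)
    also have "\<dots> \<le> (\<integral>\<omega>. \<bar>(?r \<omega> - ?q \<omega>) / real n + (?q \<omega> - ?m n) / real n\<bar> \<partial>M) + (\<integral>\<omega>. \<bar>?m n / real n - S_mat \<gamma> x $ a $ b\<bar> \<partial>M)"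
      by (rule integral_abs_triangle) (use iq in simp_all)
    also have "(\<integral>\<omega>. \<bar>(?r \<omega> - ?q \<omega>) / real n + (?q \<omega> - ?m n) / real n\<bar> \<partial>M)
        \<le> (\<integral>\<omega>. \<bar>(?r \<omega> - ?q \<omega>) / real n\<bar> \<partial>M) + (\<integral>\<omega>. \<bar>(?q \<omega> - ?m n) / real n\<bar> \<partial>M)"
      by (rule integral_abs_triangle) (use iq in simp_all)
    also have "(\<integral>\<omega>. \<bar>(?r \<omega> - ?q \<omega>) / real n\<bar> \<partial>M) = (\<integral>\<omega>. \<bar>?r \<omega> - ?q \<omega>\<bar> \<partial>M) / real n"
      using n by (simp add: abs_divide)
    also have "(\<integral>\<omega>. \<bar>(?q \<omega> - ?m n) / real n\<bar> \<partial>M) = (\<integral>\<omega>. \<bar>?q \<omega> - ?m n\<bar> \<partial>M) / real n"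
      using n by (simp add: abs_divide)
    finally show ?case using r by (simp add: g_def prob_space)
  qed
  show ?thesis
    by (rule real_tendsto_sandwich[OF _ le tendsto_const g0]) (simp add: always_eventually)
qed

theorem C_hat_consistent:
  "(\<lambda>n. \<integral>\<^sup>+\<omega>. ennreal \<bar>C_hat K (h n) x (Yobs \<omega>) n $ j $ l - C_lim \<gamma> x $ j $ l\<bar> \<partial>M) \<longlonglongrightarrow> 0"
proof -
  let ?L = "matrix_inv (R_mat x 0)" and ?S = "S_mat \<gamma> x"
  define g where "g n = (\<Sum>a\<in>UNIV. \<Sum>b\<in>UNIV. \<bar>Tn n $ j $ a * Tn n $ b $ l\<bar> * (\<integral>\<omega>. \<bar>Q a b n \<omega> - ?S $ a $ b\<bar> \<partial>M)
      + \<bar>(Tn n $ j $ a * Tn n $ b $ l - ?L $ j $ a * ?L $ b $ l) * ?S $ a $ b\<bar>)" for n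
  have "g \<longlonglongrightarrow> (\<Sum>a\<in>UNIV. \<Sum>b\<in>UNIV. \<bar>?L $ j $ a * ?L $ b $ l\<bar> * 0 + \<bar>(?L $ j $ a * ?L $ b $ l - ?L $ j $ a * ?L $ b $ l) * ?S $ a $ b\<bar>)"
    unfolding g_def[abs_def]
    by (intro tendsto_sum tendsto_add tendsto_mult tendsto_rabs tendsto_diff tendsto_const Tn_tendsto Q_tendsto)
  then have g0: "g \<longlonglongrightarrow> 0" by simp
  have "\<forall>\<^sub>F n in sequentially. (\<integral>\<^sup>+\<omega>. ennreal \<bar>C_hat K (h n) x (Yobs \<omega>) n $ j $ l - C_lim \<gamma> x $ j $ l\<bar> \<partial>M) \<le> ennreal (g n)"
    using eventually_regular
  proof eventually_elim
    case (elim n)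
    then have d: "\<And>j. d_norm x n j \<noteq> 0" and det: "det (normalized_gram x n) \<noteq> 0" by auto
    note iQ = Q_integrable[OF d det]
    \<comment> \<open>Entrywise splitting of the difference of triple products into Tn (Q - S) Tn,
      small in mean, and (Tn Tn - L L) S, which is deterministic.\<close>
    let ?f = "\<lambda>a b \<omega>. Tn n $ j $ a * Tn n $ b $ l * (Q a b n \<omega> - ?S $ a $ b)
        + (Tn n $ j $ a * Tn n $ b $ l - ?L $ j $ a * ?L $ b $ l) * ?S $ a $ b"
    have eq: "C_hat K (h n) x (Yobs \<omega>) n $ j $ l - C_lim \<gamma> x $ j $ l = (\<Sum>a\<in>UNIV. \<Sum>b\<in>UNIV. ?f a b \<omega>)" for \<omega>
      unfolding C_hat_entry[OF d det] C_lim_def triple_product_entry Q_def[symmetric] sum_subtractf[symmetric]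
      by (intro sum.cong refl) (simp add: algebra_simps)
    have i: "integrable M (?f a b)" for a b using iQ by simp
    have fb: "(\<integral>\<omega>. \<bar>?f a b \<omega>\<bar> \<partial>M) \<le> \<bar>Tn n $ j $ a * Tn n $ b $ l\<bar> * (\<integral>\<omega>. \<bar>Q a b n \<omega> - ?S $ a $ b\<bar> \<partial>M)
      + \<bar>(Tn n $ j $ a * Tn n $ b $ l - ?L $ j $ a * ?L $ b $ l) * ?S $ a $ b\<bar>" for a b
    proof -
      have "(\<integral>\<omega>. \<bar>?f a b \<omega>\<bar> \<partial>M) \<le> (\<integral>\<omega>. \<bar>Tn n $ j $ a * Tn n $ b $ l * (Q a b n \<omega> - ?S $ a $ b)\<bar> \<partial>M)
         + (\<integral>\<omega>. \<bar>(Tn n $ j $ a * Tn n $ b $ l - ?L $ j $ a * ?L $ b $ l) * ?S $ a $ b\<bar> \<partial>M)"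
        by (rule integral_abs_triangle) (use iQ in simp_all)
      then show ?thesis by (simp add: abs_mult[of "Tn n $ j $ a * Tn n $ b $ l" "Q a b n _ - _"] prob_space)
    qed
    have "(\<integral>\<omega>. \<bar>\<Sum>a\<in>UNIV. \<Sum>b\<in>UNIV. ?f a b \<omega>\<bar> \<partial>M) \<le> g n"
      unfolding g_def
      by (rule integral_abs_sum_le, rule Bochner_Integration.integrable_sum, rule i, rule integral_abs_sum_le, rule i, rule fb)
    moreover have "(\<integral>\<^sup>+\<omega>. ennreal \<bar>\<Sum>a\<in>UNIV. \<Sum>b\<in>UNIV. ?f a b \<omega>\<bar> \<partial>M) = ennreal (\<integral>\<omega>. \<bar>\<Sum>a\<in>UNIV. \<Sum>b\<in>UNIV. ?f a b \<omega>\<bar> \<partial>M)"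
      by (rule nn_integral_eq_integral[OF integrable_abs[OF Bochner_Integration.integrable_sum[OF Bochner_Integration.integrable_sum[OF i]]]]) simp
    ultimately show ?case unfolding eq by (simp only: ennreal_leI)
  qed
  note le = this
  have "(\<lambda>n. ennreal (g n)) \<longlonglongrightarrow> 0" using tendsto_ennrealI[OF g0] by simp
  from tendsto_sandwich[OF _ le tendsto_const this] show ?thesis by simp
qed

end

section \<open>Spectral measures of designs\<close>

lemma positive_variation_cong:
  assumes "\<And>B. B \<in> sets S \<Longrightarrow> \<nu> B = \<nu>' B"
  shows "positive_variation S \<nu> = positive_variation S \<nu>'"
proof -
  have "(\<lambda>A. SUP B\<in>{B \<in> sets S. B \<subseteq> A}. ennreal (\<nu> B)) = (\<lambda>A. SUP B\<in>{B \<in> sets S. B \<subseteq> A}. ennreal (\<nu>' B))"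
    using assms by (intro ext SUP_cong) auto
  then show ?thesis by (simp add: positive_variation_def)
qed

lemma signed_integral_cong:
  assumes "\<And>B. B \<in> sets S \<Longrightarrow> \<nu> B = \<nu>' B"
  shows "signed_integral S \<nu> g = signed_integral S \<nu>' g"
  using positive_variation_cong[of S \<nu> \<nu>'] positive_variation_cong[of S "\<lambda>A. - \<nu> A" "\<lambda>A. - \<nu>' A"] assms
  by (simp add: signed_integral_def)

lemma signed_integral_uminus: "signed_integral S (\<lambda>A. - \<nu> A) g = - signed_integral S \<nu> g"
  by (simp add: signed_integral_def)

lemma signed_integral_cnj: "signed_integral S \<nu> (\<lambda>t. cnj (g t)) = cnj (signed_integral S \<nu> g)"
  by (simp add: signed_integral_def)

lemma sets_positive_variation [simp, measurable_cong]: "sets (positive_variation S \<nu>) = sets S"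
  and space_positive_variation [simp]: "space (positive_variation S \<nu>) = space S"
  by (simp_all add: positive_variation_def)

text \<open>The countable additivity of the positive variation is not needed: if it failed, then
  \<^const>\<open>measure_of\<close> would give the null measure.\<close>

lemma finite_positive_variation:
  assumes "\<And>B. B \<in> sets S \<Longrightarrow> \<nu> B \<le> \<tau>"
  shows "finite_measure (positive_variation S \<nu>)"
proof
  have "emeasure (positive_variation S \<nu>) (space S) \<le> (SUP B\<in>{B \<in> sets S. B \<subseteq> space S}. ennreal (\<nu> B))"
    unfolding positive_variation_def by (subst emeasure_measure_of_conv) auto
  also have "\<dots> \<le> ennreal \<tau>" by (rule SUP_least) (auto intro: ennreal_leI assms)
  also have "\<dots> < \<infinity>" by simp
  finally show "emeasure (positive_variation S \<nu>) (space (positive_variation S \<nu>)) \<noteq> \<infinity>" by simp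
qed

lemma finite_measure_trig_series:
  fixes P :: "real measure" and c :: "nat \<Rightarrow> complex" and k :: "nat \<Rightarrow> int"
  assumes P: "finite_measure P" "sets P = sets freq_space" and c: "summable (\<lambda>m. cmod (c m))"
  shows "(\<lambda>m. c m * (\<integral>t. cis (of_int (k m) * t) \<partial>P)) sums (\<integral>t. (\<Sum>m. c m * cis (of_int (k m) * t)) \<partial>P)"
proof -
  interpret finite_measure P by fact
  have cm: "(\<lambda>t. cis (of_int k * t)) \<in> borel_measurable P" for k
  proof -
    have "(\<lambda>t. cis (of_int k * t)) \<in> borel_measurable freq_space"
      unfolding freq_space_def by (rule measurable_restrict_space1) measurable
    then show ?thesis using measurable_cong_sets[OF P(2) refl] by blast
  qed
  have i: "integrable P (\<lambda>t. c m * cis (of_int (k m) * t))" for m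
    by (intro integrable_mult_right integrable_const_bound[where B = 1] AE_I2 cm) simp
  have "(\<lambda>m. \<integral>t. c m * cis (of_int (k m) * t) \<partial>P) sums (\<integral>t. (\<Sum>m. c m * cis (of_int (k m) * t)) \<partial>P)"
  proof (rule sums_integral[OF i])
    show "AE t in P. summable (\<lambda>m. norm (c m * cis (of_int (k m) * t)))" using c by (simp add: norm_mult)
    show "summable (\<lambda>m. \<integral>t. norm (c m * cis (of_int (k m) * t)) \<partial>P)"
      using c by (simp add: norm_mult summable_mult)
  qed
  then show ?thesis by simp
qed

text \<open>The bound on \<open>\<nu>\<close> makes both variations finite measures. For these,
  series and integral may be exchanged, as the terms have modulus \<open>cmod (c m)\<close>.\<close>

lemma signed_integral_trig_series:
  fixes c :: "nat \<Rightarrow> complex" and k :: "nat \<Rightarrow> int"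
  assumes \<nu>: "\<And>B. B \<in> sets freq_space \<Longrightarrow> \<bar>\<nu> B\<bar> \<le> \<tau>" and c: "summable (\<lambda>m. cmod (c m))"
  shows "(\<lambda>m. c m * signed_integral freq_space \<nu> (\<lambda>t. cis (of_int (k m) * t)))
     sums signed_integral freq_space \<nu> (\<lambda>t. \<Sum>m. c m * cis (of_int (k m) * t))"
proof -
  have "finite_measure (positive_variation freq_space \<nu>)"
    by (rule finite_positive_variation[where \<tau> = \<tau>]) (use \<nu> in force)
  moreover have "finite_measure (positive_variation freq_space (\<lambda>A. - \<nu> A))"
    by (rule finite_positive_variation[where \<tau> = \<tau>]) (use \<nu> in force)
  ultimately show ?thesis
    unfolding signed_integral_def right_diff_distrib
    by (intro sums_diff finite_measure_trig_series c) simp_all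
qed

text \<open>Test vectors with entry 1 at \<open>j\<close> and one of the entries \<open>1\<close>,
  \<open>-1\<close>, \<open>\<i>\<close>, \<open>-\<i>\<close> at \<open>l\<close>, and 0 elsewhere,
  isolate the real and imaginary part of the mixed entry.\<close>

lemma hermitian_nonneg_entry_bound:
  fixes A :: "complex^'p^'p"
  assumes A: "hermitian_nonneg A"
  shows "\<bar>Re (A $ j $ l)\<bar> \<le> Re (A $ j $ j) + Re (A $ l $ l)" "\<bar>Im (A $ j $ l)\<bar> \<le> Re (A $ j $ j) + Re (A $ l $ l)"
    "0 \<le> Re (A $ j $ j)"
proof -
  have herm: "A $ l $ j = cnj (A $ j $ l)" for j l using A unfolding hermitian_nonneg_def by blast
  have q: "0 \<le> Re (\<Sum>j\<in>UNIV. \<Sum>l\<in>UNIV. cnj (v $ j) * A $ j $ l * v $ l)" for v using A unfolding hermitian_nonneg_def by blast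
  have two: "0 \<le> (cmod u)\<^sup>2 * Re (A $ j $ j) + 2 * Re (cnj u * A $ j $ l * w) + (cmod w)\<^sup>2 * Re (A $ l $ l)"
    if "j \<noteq> l" for j l u w
  proof -
    define v where "v = (\<chi> i. if i = j then u else if i = l then w else 0)"
    have s: "(\<Sum>i\<in>UNIV. f i * v $ i) = f j * u + f l * w" for f
    proof -
      have "(\<Sum>i\<in>UNIV. f i * v $ i) = (\<Sum>i\<in>UNIV. (if i = j then f j * u else 0) + (if i = l then f l * w else 0))"
        using that by (intro sum.cong) (auto simp: v_def)
      then show ?thesis by (simp add: sum.distrib)
    qed
    have s': "(\<Sum>i\<in>UNIV. cnj (v $ i) * f i) = cnj u * f j + cnj w * f l" for f
    proof -
      have "(\<Sum>i\<in>UNIV. cnj (v $ i) * f i) = (\<Sum>i\<in>UNIV. (if i = j then cnj u * f j else 0) + (if i = l then cnj w * f l else 0))"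
        using that by (intro sum.cong) (auto simp: v_def)
      then show ?thesis by (simp add: sum.distrib)
    qed
    have "(\<Sum>j\<in>UNIV. \<Sum>l\<in>UNIV. cnj (v $ j) * A $ j $ l * v $ l)
        = (\<Sum>i\<in>UNIV. cnj (v $ i) * A $ i $ j * u + cnj (v $ i) * A $ i $ l * w)"
      by (rule sum.cong[OF refl]) (rule s)
    also have "\<dots> = (\<Sum>i\<in>UNIV. cnj (v $ i) * (A $ i $ j * u + A $ i $ l * w))"
      by (simp only: distrib_left mult.assoc)
    also have "\<dots> = cnj u * (A $ j $ j * u + A $ j $ l * w) + cnj w * (A $ l $ j * u + A $ l $ l * w)"
      by (rule s')
    finally have e: "(\<Sum>j\<in>UNIV. \<Sum>l\<in>UNIV. cnj (v $ j) * A $ j $ l * v $ l)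
       = cnj u * (A $ j $ j * u + A $ j $ l * w) + cnj w * (cnj (A $ j $ l) * u + A $ l $ l * w)"
      by (simp only: herm[of l j])
    have re: "Re (cnj u * (a * u + b * w) + cnj w * (cnj b * u + c * w)) = (cmod u)\<^sup>2 * Re a + 2 * Re (cnj u * b * w) + (cmod w)\<^sup>2 * Re c" for a b c
      unfolding cmod_power2 by (simp add: power2_eq_square algebra_simps)
    show ?thesis using q[of v] unfolding e re .
  qed
  have diag: "0 \<le> Re (A $ j $ j)" for j
  proof -
    define v where "v = (\<chi> i. if i = j then (1::complex) else 0)"
    have "(\<Sum>l\<in>UNIV. cnj (v $ i) * A $ i $ l * v $ l) = (\<Sum>l\<in>UNIV. if l = j then cnj (v $ i) * A $ i $ j else 0)" for i
      by (intro sum.cong) (auto simp: v_def)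
    then have "(\<Sum>i\<in>UNIV. \<Sum>l\<in>UNIV. cnj (v $ i) * A $ i $ l * v $ l) = (\<Sum>i\<in>UNIV. if i = j then A $ j $ j else 0)"
      by (intro sum.cong) (auto simp: v_def)
    then show ?thesis using q[of v] by simp
  qed
  then show "0 \<le> Re (A $ j $ j)" .
  show "\<bar>Re (A $ j $ l)\<bar> \<le> Re (A $ j $ j) + Re (A $ l $ l)"
  proof (cases "j = l")
    case False
    show ?thesis using two[OF False, of 1 1] two[OF False, of 1 "-1"] diag[of j] diag[of l] by simp
  qed (use diag in simp)
  show "\<bar>Im (A $ j $ l)\<bar> \<le> Re (A $ j $ j) + Re (A $ l $ l)"
  proof (cases "j = l")
    case True
    then have "Im (A $ j $ l) = 0" using arg_cong[OF herm[of j j], of Im] by simp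
    then show ?thesis using diag[of j] diag[of l] by simp
  next
    case False
    show ?thesis using two[OF False, of 1 \<i>] two[OF False, of 1 "-\<i>"] diag[of j] diag[of l] by simp
  qed
qed

text \<open>Diagonal entries are nonnegative and additive, hence monotone in the set, and they
  dominate all other entries. This supplies the bound that makes the variations of every entry
  finite.\<close>

lemma hermitian_matrix_measure_bound:
  assumes N: "hermitian_matrix_measure S N" and B: "B \<in> sets S"
  shows "\<bar>Re (N B $ j $ l)\<bar> \<le> Re (N (space S) $ j $ j) + Re (N (space S) $ l $ l)"
    "\<bar>Im (N B $ j $ l)\<bar> \<le> Re (N (space S) $ j $ j) + Re (N (space S) $ l $ l)"
proof -
  have add: "(\<lambda>i. N (A i)) sums N (\<Union>i. A i)" if "range A \<subseteq> sets S" "disjoint_family A" for A :: "nat \<Rightarrow> _"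
    using N that unfolding hermitian_matrix_measure_def by blast
  have nn: "hermitian_nonneg (N A)" if "A \<in> sets S" for A using N that unfolding hermitian_matrix_measure_def by blast
  \<comment> \<open>A convergent constant series forces \<open>N {} = 0\<close>; with empty sets as
    padding, countable additivity then yields additivity for \<open>B\<close> and its
    complement.\<close>
  have "(\<lambda>i::nat. N {}) sums N {}" using add[of "\<lambda>_. {}"] by (simp add: disjoint_family_on_def)
  then have "(\<lambda>i::nat. N {}) \<longlonglongrightarrow> 0" by (intro summable_LIMSEQ_zero) (rule sums_summable)
  then have N0: "N {} = 0" by (simp add: LIMSEQ_const_iff)
  have "range (binaryset B (space S - B)) \<subseteq> sets S" "disjoint_family (binaryset B (space S - B))"
    using B by (auto simp: range_binaryset_eq disjoint_family_on_def binaryset_def)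
  from add[OF this] have "(\<lambda>i. N (binaryset B (space S - B) i)) sums N (B \<union> (space S - B))"
    by (simp add: UN_binaryset_eq)
  moreover have "(\<lambda>i. N (binaryset B (space S - B) i)) sums (N B + N (space S - B))"
    by (rule binaryset_sums[of N, OF N0])
  ultimately have "N (B \<union> (space S - B)) = N B + N (space S - B)" by (rule sums_unique2)
  moreover have "B \<union> (space S - B) = space S" using sets.sets_into_space[OF B] by blast
  ultimately have split: "N (space S) = N B + N (space S - B)" by simp
  have diag: "Re (N B $ j $ j) \<le> Re (N (space S) $ j $ j)" for j
  proof -
    have "space S - B \<in> sets S" using B by simp
    from hermitian_nonneg_entry_bound(3)[OF nn[OF this], of j] show ?thesis by (simp add: split)
  qed
  show "\<bar>Re (N B $ j $ l)\<bar> \<le> Re (N (space S) $ j $ j) + Re (N (space S) $ l $ l)"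
    using hermitian_nonneg_entry_bound(1)[OF nn[OF B], of j l] diag[of j] diag[of l] by linarith
  show "\<bar>Im (N B $ j $ l)\<bar> \<le> Re (N (space S) $ j $ j) + Re (N (space S) $ l $ l)"
    using hermitian_nonneg_entry_bound(2)[OF nn[OF B], of j l] diag[of j] diag[of l] by linarith
qed

lemma matrix_integral_trig_series:
  fixes c :: "nat \<Rightarrow> complex" and k :: "nat \<Rightarrow> int"
  assumes N: "hermitian_matrix_measure freq_space N" and c: "summable (\<lambda>m. cmod (c m))"
  shows "(\<lambda>m. c m * matrix_integral freq_space N (\<lambda>t. cis (of_int (k m) * t)) $ j $ l)
     sums matrix_integral freq_space N (\<lambda>t. \<Sum>m. c m * cis (of_int (k m) * t)) $ j $ l"
proof -
  note b = hermitian_matrix_measure_bound[OF N, where j = j and l = l]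
  have "(\<lambda>m. c m * signed_integral freq_space (\<lambda>A. Re (N A $ j $ l)) (\<lambda>t. cis (of_int (k m) * t))
      + \<i> * (c m * signed_integral freq_space (\<lambda>A. Im (N A $ j $ l)) (\<lambda>t. cis (of_int (k m) * t))))
    sums (signed_integral freq_space (\<lambda>A. Re (N A $ j $ l)) (\<lambda>t. \<Sum>m. c m * cis (of_int (k m) * t))
      + \<i> * signed_integral freq_space (\<lambda>A. Im (N A $ j $ l)) (\<lambda>t. \<Sum>m. c m * cis (of_int (k m) * t)))"
    by (intro sums_add sums_mult signed_integral_trig_series[OF b(1) c] signed_integral_trig_series[OF b(2) c])
  then show ?thesis by (simp add: matrix_integral_def complex_measure_integral_def distrib_left mult.left_commute)
qed

text \<open>Hermitian symmetry turns conjugation of the integrand into conjugation and transposition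
  of the integral. It extends the representation of \<open>R(k)\<close>, given for nonnegative
  \<open>k\<close>, to negative lags.\<close>

lemma matrix_integral_cnj:
  assumes N: "hermitian_matrix_measure S N"
  shows "matrix_integral S N (\<lambda>t. cnj (g t)) $ j $ l = cnj (matrix_integral S N g $ l $ j)"
proof -
  have herm: "N A $ j $ l = cnj (N A $ l $ j)" if "A \<in> sets S" for A
    using N that unfolding hermitian_matrix_measure_def hermitian_nonneg_def by blast
  have "signed_integral S (\<lambda>A. Re (N A $ j $ l)) g = signed_integral S (\<lambda>A. Re (N A $ l $ j)) g"
    by (rule signed_integral_cong) (simp add: herm)
  moreover have "signed_integral S (\<lambda>A. Im (N A $ j $ l)) g = signed_integral S (\<lambda>A. - Im (N A $ l $ j)) g"
    by (rule signed_integral_cong) (simp add: herm)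
  ultimately show ?thesis
    by (simp add: matrix_integral_def complex_measure_integral_def signed_integral_cnj signed_integral_uminus)
qed

lemma spectral_density_suminf:
  assumes "summable (\<lambda>m. \<bar>\<gamma> (int_decode m)\<bar>)"
  shows "spectral_density \<gamma> t
     = (\<Sum>m. complex_of_real (\<gamma> (int_decode m) / (2 * pi)) * cis (of_int (int_decode m) * t))"
proof -
  let ?f = "\<lambda>k. complex_of_real (\<gamma> k) * cis (of_int k * t)"
  have n: "summable (\<lambda>m. norm (?f (int_decode m)))" using assms by (simp add: norm_mult)
  have s: "(\<lambda>m. ?f (int_decode m)) sums (\<Sum>m. ?f (int_decode m))"
    by (rule summable_sums[OF summable_norm_cancel[OF n]])
  have "((\<lambda>m. ?f (int_decode m)) has_sum (\<Sum>m. ?f (int_decode m))) UNIV"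
    by (rule norm_summable_imp_has_sum[OF n s])
  then have "(?f has_sum (\<Sum>m. ?f (int_decode m))) UNIV"
    by (simp only: has_sum_reindex_bij_betw[OF bij_int_decode, of ?f])
  then have "spectral_density \<gamma> t = (1 / (2 * pi)) *\<^sub>R (\<Sum>m. ?f (int_decode m))"
    unfolding spectral_density_def by (simp only: infsumI)
  also have "\<dots> = (\<Sum>m. (1 / (2 * pi)) *\<^sub>R ?f (int_decode m))"
    by (rule suminf_scaleR_right) (rule sums_summable[OF s])
  finally show ?thesis by (simp add: scaleR_conv_of_real)
qed

lemma (in regular_design) R_int_le_1: "\<bar>R_int x k j l\<bar> \<le> 1"
proof (rule LIMSEQ_le_const2)
  show "(\<lambda>n. \<bar>lag_product n (column x n j) (column x n l) k\<bar>) \<longlonglongrightarrow> \<bar>R_int x k j l\<bar>"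
    by (rule tendsto_rabs[OF lag_product_column_tendsto[OF rho_convergent]])
qed (auto intro: abs_lag_product_le unit_column_column)

text \<open>The powers of \<open>2 * pi\<close> cancel: each inverse of \<open>F\<close> contributes
  one, and \<open>G\<close> is \<open>S_mat\<close> divided by two of them, one from its definition
  and one from the spectral density.\<close>

theorem (in regular_design) C_mat_eq_C_lim:
  assumes N: "is_spectral_measure (R_mat x) N"
  shows "C_mat (spectral_density \<gamma>) N $ j $ l = complex_of_real (C_lim \<gamma> x $ j $ l)"
proof -
  have hN: "hermitian_matrix_measure freq_space N" using N by (simp add: is_spectral_measure_def)
  have pos: "matrix_integral freq_space N (\<lambda>t. cis (real k * t)) $ j $ l = complex_of_real (R_mat x k $ j $ l)" for k j l
    using N unfolding is_spectral_measure_def by (metis (no_types, lifting) vec_lambda_beta)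
  have sym: "R_mat x 0 $ j $ l = R_mat x 0 $ l $ j" for j l
  proof -
    have "transpose (R_mat x 0) = R_mat x 0" using R0_pos by (simp only: pos_definite_def)
    moreover have "transpose (R_mat x 0) $ l $ j = R_mat x 0 $ j $ l" by (simp add: transpose_def)
    ultimately show ?thesis by (simp only:)
  qed
  \<comment> \<open>The lag changes sign because \<open>R_int\<close> follows the index order of
    \<open>lag_product\<close>, opposite to that of \<open>R_mat\<close>. At lag 0 both orders agree
    by the symmetry of \<open>R(0)\<close>.\<close>
  have all: "matrix_integral freq_space N (\<lambda>t. cis (of_int k * t)) $ j $ l = complex_of_real (R_int x (- k) j l)" for k j l
  proof (cases "0 \<le> k")
    case True
    then have "matrix_integral freq_space N (\<lambda>t. cis (of_int k * t)) $ j $ l = complex_of_real (R_mat x (nat k) $ j $ l)"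
      using pos[of "nat k" j l] by simp
    then show ?thesis using True sym[of j l] by (cases "k = 0") (auto simp: R_int_def)
  next
    case False
    have "matrix_integral freq_space N (\<lambda>t. cis (of_int k * t)) $ j $ l
        = matrix_integral freq_space N (\<lambda>t. cnj (cis (real (nat (- k)) * t))) $ j $ l"
      using False by (simp add: cis_cnj)
    also have "\<dots> = cnj (complex_of_real (R_mat x (nat (- k)) $ l $ j))"
      unfolding matrix_integral_cnj[OF hN] pos ..
    finally show ?thesis using False by (simp add: R_int_def)
  qed
  have sg: "summable (\<lambda>m. \<bar>\<gamma> (int_decode m) * R_int x (int_decode m) j l\<bar>)" for j l
  proof (rule summable_comparison_test'[OF autocov_summable])
    fix m
    show "norm \<bar>\<gamma> (int_decode m) * R_int x (int_decode m) j l\<bar> \<le> \<bar>\<gamma> (int_decode m)\<bar>"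
      using R_int_le_1[of "int_decode m" j l] by (simp add: abs_mult mult_left_le)
  qed
  have F: "F_mat N $ j $ l = complex_of_real (R_mat x 0 $ j $ l) / complex_of_real (2 * pi)" for j l
  proof -
    have "F_mat N $ j $ l = (1 / (2 * pi)) *\<^sub>R complex_of_real (R_mat x 0 $ j $ l)"
      using pos[of 0 j l] by (simp add: F_mat_def)
    then show ?thesis by (simp add: scaleR_conv_of_real)
  qed
  have G: "G_mat (spectral_density \<gamma>) N $ j $ l = complex_of_real (S_mat \<gamma> x $ j $ l) / complex_of_real ((2 * pi)\<^sup>2)" for j l
  proof -
    let ?c = "\<lambda>m. complex_of_real (\<gamma> (int_decode m) / (2 * pi))"
    have "cmod (?c m) = \<bar>\<gamma> (int_decode m)\<bar> / (2 * pi)" for m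
      unfolding norm_of_real by (simp add: abs_divide)
    then have "summable (\<lambda>m. cmod (?c m))"
      using summable_divide[OF autocov_summable, of "2 * pi"] by (simp only:)
    from matrix_integral_trig_series[OF hN this, of int_decode j l]
    have "(\<lambda>m. complex_of_real (\<gamma> (int_decode m) * R_int x (- int_decode m) j l / (2 * pi)))
        sums matrix_integral freq_space N (spectral_density \<gamma>) $ j $ l"
      unfolding all spectral_density_suminf[OF autocov_summable, abs_def, symmetric] by simp
    moreover have "(\<lambda>m. complex_of_real (\<gamma> (int_decode m) * R_int x (- int_decode m) j l / (2 * pi)))
        sums complex_of_real (S_mat \<gamma> x $ j $ l / (2 * pi))"
    proof (intro sums_of_real sums_divide)
      let ?f = "\<lambda>k. \<gamma> k * R_int x k j l"
      \<comment> \<open>The reflection of the integers, transported to their enumeration; as the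
        autocovariance is even, it undoes the reversed sign of the lag.\<close>
      have "bij (\<lambda>m. int_encode (- int_decode m))"
        using bij_comp[OF bij_comp[OF bij_int_decode bij_uminus] bij_int_encode] by (simp add: o_def)
      have "((\<lambda>m. ?f (int_decode m)) has_sum (\<Sum>m. ?f (int_decode m))) UNIV"
        by (rule norm_summable_imp_has_sum[OF _ summable_sums[OF summable_rabs_cancel[OF sg]]]) (simp only: real_norm_def sg)
      then have "((\<lambda>m. ?f (int_decode (int_encode (- int_decode m)))) has_sum (\<Sum>m. ?f (int_decode m))) UNIV"
        by (simp only: has_sum_reindex_bij_betw[OF \<open>bij (\<lambda>m. int_encode (- int_decode m))\<close>, of "\<lambda>m. ?f (int_decode m)"])
      from has_sum_imp_sums[OF this]
      show "(\<lambda>m. \<gamma> (int_decode m) * R_int x (- int_decode m) j l) sums S_mat \<gamma> x $ j $ l"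
        by (simp add: autocov_minus S_mat_def)
    qed
    ultimately have "matrix_integral freq_space N (spectral_density \<gamma>) $ j $ l = complex_of_real (S_mat \<gamma> x $ j $ l / (2 * pi))"
      by (rule sums_unique2)
    then have "G_mat (spectral_density \<gamma>) N $ j $ l = (1 / (2 * pi)) *\<^sub>R complex_of_real (S_mat \<gamma> x $ j $ l / (2 * pi))"
      by (simp add: G_mat_def)
    then show ?thesis by (simp add: scaleR_conv_of_real power2_eq_square)
  qed
  let ?I = "matrix_inv (R_mat x 0)"
  have Finv: "matrix_inv (F_mat N) = (\<chi> j l. complex_of_real (2 * pi) * complex_of_real (?I $ j $ l))"
  proof (rule matrix_inv_eqI, rule vec_eq_iff[THEN iffD2], rule allI, rule vec_eq_iff[THEN iffD2], rule allI)
    fix j l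
    have "(F_mat N ** (\<chi> j l. complex_of_real (2 * pi) * complex_of_real (?I $ j $ l))) $ j $ l
        = (\<Sum>k\<in>UNIV. complex_of_real (R_mat x 0 $ j $ k * ?I $ k $ l))"
      unfolding matrix_matrix_mult_def vec_lambda_beta F by (intro sum.cong refl) simp
    also have "\<dots> = complex_of_real ((R_mat x 0 ** ?I) $ j $ l)"
      unfolding matrix_matrix_mult_def vec_lambda_beta of_real_sum ..
    also have "\<dots> = mat 1 $ j $ l" unfolding matrix_inv_right[OF R0_det] by (simp add: mat_def)
    finally show "(F_mat N ** (\<chi> j l. complex_of_real (2 * pi) * complex_of_real (?I $ j $ l))) $ j $ l = mat 1 $ j $ l" .
  qed
  show ?thesis
    unfolding C_mat_def C_lim_def triple_product_entry Finv vec_lambda_beta G of_real_sum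
    by (intro sum.cong refl) (simp add: power2_eq_square)
qed

section \<open>Dependence on the rows from the first one on\<close>

context
  fixes x x' :: "nat \<Rightarrow> real^'p" and y y' :: "nat \<Rightarrow> real"
  assumes x: "\<And>i. 1 \<le> i \<Longrightarrow> x i = x' i" and y: "\<And>i. 1 \<le> i \<Longrightarrow> y i = y' i"
begin

lemma d_norm_rows: "d_norm x n = d_norm x' n"
  by (intro ext) (simp add: d_norm_def x)

lemma rho_seq_rows: "rho_seq x = rho_seq x'"
  by (intro ext) (simp add: rho_seq_def d_norm_rows x)

lemma R_mat_rows: "R_mat x = R_mat x'"
  by (intro ext) (simp add: R_mat_def rho_seq_rows)

lemma C_lim_rows: "C_lim \<gamma> x = C_lim \<gamma> x'"
  unfolding C_lim_def S_mat_def R_int_def R_mat_rows ..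

lemma residual_rows: "1 \<le> i \<Longrightarrow> residual x y n i = residual x' y' n i"
  by (simp add: residual_def lse_def XtX_def XtY_def x y)

text \<open>The random design will be a point of a product space over \<open>{1..}\<close>, whose
  coordinate 0 is \<open>undefined\<close>, so the pathwise functionals must not depend on row
  0.\<close>

lemma C_hat_rows: "C_hat K b x y n = C_hat K b x' y' n"
proof -
  have "gamma_hat x y n = gamma_hat x' y' n"
    by (intro ext) (simp add: gamma_hat_def residual_rows)
  then have "Gamma_hat K b x y n = Gamma_hat K b x' y' n" by (intro ext) (simp add: Gamma_hat_def)
  moreover have "D_mat x n = D_mat x' n" unfolding D_mat_def d_norm_rows ..
  moreover have "XtX x n = XtX x' n" by (simp add: XtX_def x)
  moreover have "XtMX x \<Gamma> n = XtMX x' \<Gamma> n" for \<Gamma> by (simp add: XtMX_def x)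
  ultimately show ?thesis by (simp add: C_hat_def)
qed

end

section \<open>Measurability in the design and the errors\<close>

lemma borel_measurable_matrix_mult:
  fixes A B :: "'b \<Rightarrow> real^'n^'n"
  assumes "\<And>j l. (\<lambda>\<omega>. A \<omega> $ j $ l) \<in> borel_measurable N" "\<And>j l. (\<lambda>\<omega>. B \<omega> $ j $ l) \<in> borel_measurable N"
  shows "(\<lambda>\<omega>. (A \<omega> ** B \<omega>) $ j $ l) \<in> borel_measurable N"
  unfolding matrix_matrix_mult_def vec_lambda_beta by (intro borel_measurable_sum borel_measurable_times assms)

context
  fixes N :: "'b measure" and x :: "'b \<Rightarrow> nat \<Rightarrow> real^'p" and y :: "'b \<Rightarrow> nat \<Rightarrow> real"
  assumes xm: "\<And>i j. 1 \<le> i \<Longrightarrow> (\<lambda>\<omega>. x \<omega> i $ j) \<in> borel_measurable N"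
    and ym: "\<And>i. 1 \<le> i \<Longrightarrow> (\<lambda>\<omega>. y \<omega> i) \<in> borel_measurable N"
begin

lemma d_norm_measurable: "(\<lambda>\<omega>. d_norm (x \<omega>) n j) \<in> borel_measurable N"
  unfolding d_norm_def
  by (intro measurable_compose[OF _ borel_measurable_sqrt] borel_measurable_sum borel_measurable_power xm) simp

lemma rho_seq_measurable: "(\<lambda>\<omega>. rho_seq (x \<omega>) k j l n) \<in> borel_measurable N"
  unfolding rho_seq_def
  by (intro borel_measurable_sum borel_measurable_divide borel_measurable_times xm d_norm_measurable) simp_all

lemma R_mat_measurable: "(\<lambda>\<omega>. R_mat (x \<omega>) k $ j $ l) \<in> borel_measurable N"
  unfolding R_mat_def vec_lambda_beta by (rule borel_measurable_lim_metric) (rule rho_seq_measurable)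

lemma C_lim_measurable: "(\<lambda>\<omega>. C_lim \<gamma> (x \<omega>) $ j $ l) \<in> borel_measurable N"
proof -
  have "(\<lambda>\<omega>. R_int (x \<omega>) k j l) \<in> borel_measurable N" for k j l
    unfolding R_int_def by (cases "0 \<le> k") (simp_all add: R_mat_measurable)
  then have "(\<lambda>\<omega>. S_mat \<gamma> (x \<omega>) $ j $ l) \<in> borel_measurable N" for j l
    unfolding S_mat_def vec_lambda_beta by (intro borel_measurable_suminf borel_measurable_times) simp_all
  then show ?thesis
    unfolding C_lim_def by (intro borel_measurable_matrix_mult borel_measurable_matrix_inv R_mat_measurable)
qed

lemma matrix_inv_XtX_measurable: "(\<lambda>\<omega>. matrix_inv (XtX (x \<omega>) n) $ j $ l) \<in> borel_measurable N"
proof (rule borel_measurable_matrix_inv)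
  fix j l
  show "(\<lambda>\<omega>. XtX (x \<omega>) n $ j $ l) \<in> borel_measurable N"
    unfolding XtX_def vec_lambda_beta by (intro borel_measurable_sum borel_measurable_times xm) simp_all
qed

lemma residual_measurable:
  assumes "1 \<le> i"
  shows "(\<lambda>\<omega>. residual (x \<omega>) (y \<omega>) n i) \<in> borel_measurable N"
proof -
  have "(\<lambda>\<omega>. XtY (x \<omega>) (y \<omega>) n $ j) \<in> borel_measurable N" for j
    unfolding XtY_def vec_lambda_beta by (intro borel_measurable_sum borel_measurable_times xm ym) simp_all
  then show ?thesis
    unfolding residual_def lse_def inner_vec_def matrix_vector_mult_def vec_lambda_beta inner_real_def
    by (intro borel_measurable_diff borel_measurable_sum borel_measurable_times xm ym matrix_inv_XtX_measurable assms)
qed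

lemma C_hat_measurable: "(\<lambda>\<omega>. C_hat K b (x \<omega>) (y \<omega>) n $ j $ l) \<in> borel_measurable N"
proof -
  have "(\<lambda>\<omega>. gamma_hat (x \<omega>) (y \<omega>) n k) \<in> borel_measurable N" for k
    unfolding gamma_hat_def
    by (intro borel_measurable_divide borel_measurable_sum borel_measurable_times residual_measurable borel_measurable_const) simp_all
  then have "(\<lambda>\<omega>. Gamma_hat K b (x \<omega>) (y \<omega>) n s t) \<in> borel_measurable N" for s t
    unfolding Gamma_hat_def by (intro borel_measurable_times borel_measurable_const)
  then have M: "(\<lambda>\<omega>. XtMX (x \<omega>) (Gamma_hat K b (x \<omega>) (y \<omega>) n) n $ j $ l) \<in> borel_measurable N" for j l
    unfolding XtMX_def vec_lambda_beta by (intro borel_measurable_sum borel_measurable_times xm) simp_all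
  have D: "(\<lambda>\<omega>. D_mat (x \<omega>) n $ j $ l) \<in> borel_measurable N" for j l
    unfolding D_mat_def vec_lambda_beta by (cases "j = l") (simp_all add: d_norm_measurable)
  show ?thesis unfolding C_hat_def
    by (intro borel_measurable_matrix_mult matrix_inv_XtX_measurable M D)
qed

end

section \<open>Conditioning on an independent variable\<close>

lemma sets_generated_algebra:
  assumes "\<And>i. i \<in> I \<Longrightarrow> Z i \<in> borel_measurable M"
  shows "sets (generated_algebra M I Z)
    = {(\<lambda>\<omega>. \<lambda>i\<in>I. Z i \<omega>) -` B \<inter> space M |B. B \<in> sets (\<Pi>\<^sub>M i\<in>I. borel)}"
  unfolding generated_algebra_def
  by (rule sets_vimage_algebra2) (use assms in \<open>auto simp: space_PiM\<close>)

text \<open>In a complete space changes on a null set keep measurability. The deviation from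
  \<open>C\<close> involves the spectral measure, which is tied to the design only almost surely,
  and becomes measurable in this way.\<close>

lemma (in complete_measure) borel_measurable_AE_eq:
  fixes f g :: "'a \<Rightarrow> ennreal"
  assumes f: "f \<in> borel_measurable M" and ae: "AE \<omega> in M. f \<omega> = g \<omega>"
  shows "g \<in> borel_measurable M"
proof (rule measurableI)
  fix B :: "ennreal set" assume "B \<in> sets borel"
  then have "f -` B \<inter> space M \<in> sets M" by (rule measurable_sets[OF f])
  note S = this
  have "AE \<omega> in M. \<omega> \<in> f -` B \<inter> space M \<longleftrightarrow> \<omega> \<in> g -` B \<inter> space M"
    using ae by eventually_elim simp
  from in_sets_AE[OF this S] show "g -` B \<inter> space M \<in> sets M" by simp
qed simp

text \<open>By independence the joint law is a product, so conditioning on \<open>X\<close> means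
  freezing it and integrating over \<open>E\<close> alone. As \<open>g\<close> agrees only almost
  surely with a measurable function, the expectation is taken on the completion, while the
  conditioning algebra is left as it is.\<close>

lemma (in prob_space) nn_cond_exp_independent:
  fixes X :: "'i \<Rightarrow> 'a \<Rightarrow> 'b::topological_space" and E :: "'k \<Rightarrow> 'a \<Rightarrow> 'c::topological_space"
  assumes X: "\<And>i. i \<in> I \<Longrightarrow> X i \<in> borel_measurable M" and E: "\<And>i. i \<in> J \<Longrightarrow> E i \<in> borel_measurable M"
    and ind: "indep_set (sets (generated_algebra M I X)) (sets (generated_algebra M J E))"
    and \<Psi>: "\<Psi> \<in> borel_measurable ((\<Pi>\<^sub>M i\<in>I. borel) \<Otimes>\<^sub>M (\<Pi>\<^sub>M i\<in>J. borel))"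
    and g: "AE \<omega> in M. g \<omega> = \<Psi> (\<lambda>i\<in>I. X i \<omega>, \<lambda>i\<in>J. E i \<omega>)"
  shows "AE \<omega> in M. nn_cond_exp (completion M) (generated_algebra M I X) g \<omega>
     = (\<integral>\<^sup>+\<omega>'. \<Psi> (\<lambda>i\<in>I. X i \<omega>, \<lambda>i\<in>J. E i \<omega>') \<partial>M)"
proof -
  let ?PX = "\<Pi>\<^sub>M i\<in>I. (borel :: 'b measure)" and ?PE = "\<Pi>\<^sub>M i\<in>J. (borel :: 'c measure)"
  let ?X = "\<lambda>\<omega>. \<lambda>i\<in>I. X i \<omega>" and ?E = "\<lambda>\<omega>. \<lambda>i\<in>J. E i \<omega>" and ?G = "generated_algebra M I X"
  have Xm [measurable]: "?X \<in> M \<rightarrow>\<^sub>M ?PX" using X by (intro measurable_restrict)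
  have Em [measurable]: "?E \<in> M \<rightarrow>\<^sub>M ?PE" using E by (intro measurable_restrict)
  note [measurable] = \<Psi>
  interpret DX: prob_space "distr M ?PX ?X" by (rule prob_space_distr[OF Xm])
  interpret DE: prob_space "distr M ?PE ?E" by (rule prob_space_distr[OF Em])
  \<comment> \<open>Rectangles suffice, and on them this is the independence of the two generated
    algebras.\<close>
  have joint: "distr M ?PX ?X \<Otimes>\<^sub>M distr M ?PE ?E = distr M (?PX \<Otimes>\<^sub>M ?PE) (\<lambda>\<omega>. (?X \<omega>, ?E \<omega>))"
  proof (rule pair_measure_eqI)
    show "sets (distr M ?PX ?X \<Otimes>\<^sub>M distr M ?PE ?E) = sets (distr M (?PX \<Otimes>\<^sub>M ?PE) (\<lambda>\<omega>. (?X \<omega>, ?E \<omega>)))"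
      unfolding sets_distr by (intro sets_pair_measure_cong sets_distr)
    fix A B assume "A \<in> sets (distr M ?PX ?X)" "B \<in> sets (distr M ?PE ?E)"
    then have A: "A \<in> sets ?PX" and B: "B \<in> sets ?PE" by (simp_all only: sets_distr)
    let ?a = "?X -` A \<inter> space M" and ?b = "?E -` B \<inter> space M"
    have ab: "prob (?a \<inter> ?b) = prob ?a * prob ?b"
      by (rule indep_setD[OF ind]) (use A B in \<open>auto simp: sets_generated_algebra[OF X] sets_generated_algebra[OF E]\<close>)
    have "emeasure (distr M ?PX ?X) A * emeasure (distr M ?PE ?E) B = ennreal (prob ?a) * ennreal (prob ?b)"
      unfolding emeasure_distr[OF Xm A] emeasure_distr[OF Em B] emeasure_eq_measure ..
    also have "\<dots> = ennreal (prob (?a \<inter> ?b))" unfolding ab by (simp add: ennreal_mult)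
    also have "\<dots> = emeasure M ((\<lambda>\<omega>. (?X \<omega>, ?E \<omega>)) -` (A \<times> B) \<inter> space M)"
      unfolding emeasure_eq_measure by (intro arg_cong[where f = ennreal] arg_cong[where f = prob]) auto
    also have "\<dots> = emeasure (distr M (?PX \<Otimes>\<^sub>M ?PE) (\<lambda>\<omega>. (?X \<omega>, ?E \<omega>))) (A \<times> B)"
      by (rule emeasure_distr[symmetric, OF measurable_Pair[OF Xm Em] pair_measureI[OF A B]])
    finally show "emeasure (distr M ?PX ?X) A * emeasure (distr M ?PE ?E) B
      = emeasure (distr M (?PX \<Otimes>\<^sub>M ?PE) (\<lambda>\<omega>. (?X \<omega>, ?E \<omega>))) (A \<times> B)" .
  qed unfold_locales
  interpret C: prob_space "completion M" by (rule prob_space_completion)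
  have sub: "subalgebra (completion M) ?G"
    unfolding subalgebra_def
  proof
    show "space ?G = space (completion M)" by (simp add: generated_algebra_def)
    show "sets ?G \<subseteq> sets (completion M)"
      using measurable_sets[OF Xm] by (auto simp: sets_generated_algebra[OF X])
  qed
  interpret S: finite_measure_subalgebra "completion M" ?G by unfold_locales (rule sub)
  \<comment> \<open>Measurable on the product space by Tonelli; composed with the design it is
    measurable for the conditioning algebra.\<close>
  define \<Phi> where "\<Phi> \<xi> = (\<integral>\<^sup>+e. \<Psi> (\<xi>, e) \<partial>distr M ?PE ?E)" for \<xi>
  have \<Phi>m: "\<Phi> \<in> borel_measurable ?PX" unfolding \<Phi>_def by measurable
  have \<Phi>_eq: "\<Phi> \<xi> = (\<integral>\<^sup>+\<omega>'. \<Psi> (\<xi>, ?E \<omega>') \<partial>M)" if "\<xi> \<in> space ?PX" for \<xi>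
    unfolding \<Phi>_def by (rule nn_integral_distr[OF Em]) (use that in measurable)
  have XG: "?X \<in> ?G \<rightarrow>\<^sub>M ?PX"
    unfolding generated_algebra_def by (rule measurable_vimage_algebra1) (use measurable_space[OF Xm] in auto)
  let ?f = "\<lambda>\<omega>. \<Psi> (?X \<omega>, ?E \<omega>)"
  have fm: "?f \<in> borel_measurable M" by measurable
  have fC: "?f \<in> borel_measurable (completion M)" by (rule measurable_completion[OF fm])
  have ae: "AE \<omega> in completion M. ?f \<omega> = g \<omega>" using AE_completion[OF g] by eventually_elim simp
  have gC: "g \<in> borel_measurable (completion M)" by (rule completion.borel_measurable_AE_eq[OF fC ae])
  have "AE \<omega> in completion M. \<Phi> (?X \<omega>) = nn_cond_exp (completion M) ?G g \<omega>"
  proof (rule S.nn_cond_exp_charact[OF _ gC measurable_compose[OF XG \<Phi>m]])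
    fix A assume "A \<in> sets ?G"
    then obtain B where B [measurable]: "B \<in> sets ?PX" and A: "A = ?X -` B \<inter> space M"
      by (auto simp: sets_generated_algebra[OF X])
    have "(\<integral>\<^sup>+\<omega>\<in>A. g \<omega> \<partial>completion M) = (\<integral>\<^sup>+\<omega>\<in>A. ?f \<omega> \<partial>completion M)"
      by (rule nn_integral_cong_AE) (use ae in eventually_elim, simp)
    also have "\<dots> = (\<integral>\<^sup>+\<omega>. indicator B (?X \<omega>) * \<Psi> (?X \<omega>, ?E \<omega>) \<partial>M)"
      unfolding nn_integral_completion by (rule nn_integral_cong) (auto simp: A indicator_def)
    also have "\<dots> = (\<integral>\<^sup>+p. indicator B (fst p) * \<Psi> p \<partial>distr M (?PX \<Otimes>\<^sub>M ?PE) (\<lambda>\<omega>. (?X \<omega>, ?E \<omega>)))"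
      by (subst nn_integral_distr) simp_all
    also have "\<dots> = (\<integral>\<^sup>+\<xi>. \<integral>\<^sup>+e. indicator B \<xi> * \<Psi> (\<xi>, e) \<partial>distr M ?PE ?E \<partial>distr M ?PX ?X)"
      unfolding joint[symmetric] by (subst DE.nn_integral_fst[symmetric]) simp_all
    also have "\<dots> = (\<integral>\<^sup>+\<xi>. indicator B \<xi> * \<Phi> \<xi> \<partial>distr M ?PX ?X)"
      unfolding \<Phi>_def by (intro nn_integral_cong nn_integral_cmult) measurable
    also have "\<dots> = (\<integral>\<^sup>+\<omega>. indicator B (?X \<omega>) * \<Phi> (?X \<omega>) \<partial>M)"
      using \<Phi>m by (intro nn_integral_distr) measurable
    also have "\<dots> = (\<integral>\<^sup>+\<omega>\<in>A. \<Phi> (?X \<omega>) \<partial>completion M)"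
      unfolding nn_integral_completion by (rule nn_integral_cong) (auto simp: A indicator_def)
    finally show "(\<integral>\<^sup>+\<omega>\<in>A. g \<omega> \<partial>completion M) = (\<integral>\<^sup>+\<omega>\<in>A. \<Phi> (?X \<omega>) \<partial>completion M)" .
  qed
  then have "AE \<omega> in M. \<Phi> (?X \<omega>) = nn_cond_exp (completion M) ?G g \<omega>" by (simp add: AE_completion_iff)
  then show ?thesis
    using AE_space by eventually_elim (use measurable_space[OF Xm] in \<open>simp add: \<Phi>_eq\<close>)
qed

section \<open>Random designs\<close>

theorem theorem3p1:
  fixes M :: "'a measure"
    and T :: "'a \<Rightarrow> 'a"
    and F0 :: "'a measure"
    and \<epsilon>0 :: "'a \<Rightarrow> real"
    and \<epsilon> :: "int \<Rightarrow> 'a \<Rightarrow> real"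
    and x :: "nat \<Rightarrow> 'a \<Rightarrow> real^'p"
    and \<beta> :: "real^'p"
    and Y :: "nat \<Rightarrow> 'a \<Rightarrow> real"
    and K :: "real \<Rightarrow> real"
    and h :: "nat \<Rightarrow> real"
    and FX :: "'a \<Rightarrow> real set \<Rightarrow> complex^'p^'p"
  assumes "prob_space M"
    and "bij_betw T (space M) (space M)"
    and "T \<in> M \<rightarrow>\<^sub>M M"
    and "the_inv_into (space M) T \<in> M \<rightarrow>\<^sub>M M"
    and "distr M M T = M"
    and "\<epsilon>0 \<in> borel_measurable M"
    and "integrable M (\<lambda>\<omega>. (\<epsilon>0 \<omega>)\<^sup>2)"
    and "(\<integral>\<omega>. \<epsilon>0 \<omega> \<partial>M) = 0"
    and "\<And>i. \<epsilon> i = error M T \<epsilon>0 i"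
    and "subalgebra M F0"
    and "sets F0 \<subseteq> sets (vimage_algebra (space M) T F0)"
    and "\<And>A. A \<in> filt_minus_infty_sets M T F0 \<Longrightarrow> measure M A = 0 \<or> measure M A = 1"
    and "\<epsilon>0 \<in> borel_measurable (filt_infty M T F0)"
    and hannan: "(\<lambda>i::int. L2_norm M (proj_op M T F0 0 (\<epsilon> i))) summable_on UNIV"
    and "\<And>i. i \<ge> 1 \<Longrightarrow> x i \<in> borel_measurable M"
    and "prob_space.indep_set M
           (sets (generated_algebra M {1..} x)) (sets (generated_algebra M UNIV \<epsilon>))"
    and "\<And>i \<omega>. i \<ge> 1 \<Longrightarrow> Y i \<omega> = x i \<omega> \<bullet> \<beta> + \<epsilon> (int i) \<omega>"
    and design_i: "AE \<omega> in M. \<forall>j. filterlim (\<lambda>n. d_norm (\<lambda>i. x i \<omega>) n j) at_top sequentially"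
    and design_ii: "AE \<omega> in M. \<forall>j.
           (\<lambda>n. (SUP i\<in>{1..n}. \<bar>x i \<omega> $ j\<bar>) / d_norm (\<lambda>i. x i \<omega>) n j) \<longlonglongrightarrow> 0"
    and design_iii: "AE \<omega> in M. \<forall>j l k. convergent (rho_seq (\<lambda>i. x i \<omega>) k j l)"
    and design_iv: "AE \<omega> in M. pos_definite (R_mat (\<lambda>i. x i \<omega>) 0)"
    and spectral: "AE \<omega> in M. is_spectral_measure (R_mat (\<lambda>i. x i \<omega>)) (FX \<omega>)"
    and "lag_kernel K"
    and "\<And>n. n \<ge> 1 \<Longrightarrow> h n > 0"
    and "filterlim h at_top sequentially"
    and "(\<lambda>n. h n / real n) \<longlonglongrightarrow> 0"
    and "(\<lambda>n. h n * (\<integral>\<omega>. (\<epsilon>0 \<omega>)\<^sup>2 * min 1 (h n / real n * (\<epsilon>0 \<omega>)\<^sup>2) \<partial>M)) \<longlonglongrightarrow> 0"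
  shows "\<forall>j l. AE \<omega> in M.
    (\<lambda>n. nn_cond_exp (completion M) (generated_algebra M {1..} x)
           (\<lambda>\<omega>'. ennreal (cmod (
              complex_of_real (C_hat K (h n) (\<lambda>i. x i \<omega>') (\<lambda>i. Y i \<omega>') n $ j $ l)
              - C_mat (spectral_density (autocov M \<epsilon>)) (FX \<omega>') $ j $ l))) \<omega>)
      \<longlonglongrightarrow> 0"
proof (intro allI)
  fix j l :: 'p
  have \<epsilon>_def: "\<epsilon> = error M T \<epsilon>0" by (rule ext) (rule assms(9))
  interpret hannan_process M T F0 \<epsilon>0
  proof (intro hannan_process.intro stationary_filtration.intro stationary_filtration_axioms.intro hannan_process_axioms.intro)
    show "sq_integrable M \<epsilon>0" using assms(6,7) by (simp add: sq_integrable_def)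
    show "(\<lambda>i. L2_norm M (proj_op M T F0 0 (error M T \<epsilon>0 i))) summable_on UNIV" using hannan unfolding \<epsilon>_def .
  qed (fact assms)+
  let ?X = "\<lambda>\<omega>. \<lambda>i\<in>{1..}. x i \<omega>" and ?E = "\<lambda>\<omega>. \<lambda>i\<in>UNIV. \<epsilon> i \<omega>"
  let ?N = "(\<Pi>\<^sub>M i\<in>{1..}. borel) \<Otimes>\<^sub>M (\<Pi>\<^sub>M i\<in>UNIV. borel) :: ((nat \<Rightarrow> real^'p) \<times> (int \<Rightarrow> real)) measure"
  \<comment> \<open>The deviation as a function of design and errors, with the spectral limit
    already replaced by \<open>C_lim\<close>; in this form it is jointly measurable.\<close>
  define \<Psi> where "\<Psi> n p = ennreal \<bar>C_hat K (h n) (fst p) (\<lambda>i. fst p i \<bullet> \<beta> + snd p (int i)) n $ j $ l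
      - C_lim (autocov M \<epsilon>) (fst p) $ j $ l\<bar>" for n and p :: "(nat \<Rightarrow> real^'p) \<times> (int \<Rightarrow> real)"
  have \<Psi>m: "\<Psi> n \<in> borel_measurable ?N" for n
  proof -
    have c: "(\<lambda>p. fst p i) \<in> borel_measurable ?N" if "1 \<le> i" for i
      by (rule measurable_compose[OF measurable_fst measurable_component_singleton]) (use that in simp)
    have e: "(\<lambda>p. snd p i) \<in> borel_measurable ?N" for i
      by (rule measurable_compose[OF measurable_snd measurable_component_singleton]) simp
    have xm: "(\<lambda>p. fst p i $ k) \<in> borel_measurable ?N" if "1 \<le> i" for i k
      by (rule measurable_compose[OF c[OF that] borel_measurable_continuous_onI]) (intro continuous_intros)
    have ym: "(\<lambda>p. fst p i \<bullet> \<beta> + snd p (int i)) \<in> borel_measurable ?N" if "1 \<le> i" for i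
      by (intro borel_measurable_add borel_measurable_inner c[OF that] e borel_measurable_const)
    have "(\<lambda>p. C_hat K (h n) (fst p) (\<lambda>i. fst p i \<bullet> \<beta> + snd p (int i)) n $ j $ l) \<in> borel_measurable ?N"
      by (rule C_hat_measurable[where x = fst and y = "\<lambda>p i. fst p i \<bullet> \<beta> + snd p (int i)", OF xm ym])
    moreover have "(\<lambda>p. C_lim (autocov M \<epsilon>) (fst p) $ j $ l) \<in> borel_measurable ?N"
      by (rule C_lim_measurable[OF xm ym])
    ultimately show ?thesis
      unfolding \<Psi>_def by (intro measurable_compose[OF _ measurable_ennreal] borel_measurable_abs borel_measurable_diff)
  qed
  have rows: "\<Psi> n (?X \<omega>, ?E \<omega>') = ennreal \<bar>C_hat K (h n) (\<lambda>i. x i \<omega>) (\<lambda>i. x i \<omega> \<bullet> \<beta> + \<epsilon> (int i) \<omega>') n $ j $ l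
      - C_lim (autocov M \<epsilon>) (\<lambda>i. x i \<omega>) $ j $ l\<bar>" for n \<omega> \<omega>'
  proof -
    have "C_hat K (h n) (?X \<omega>) (\<lambda>i. ?X \<omega> i \<bullet> \<beta> + ?E \<omega>' (int i)) n
        = C_hat K (h n) (\<lambda>i. x i \<omega>) (\<lambda>i. x i \<omega> \<bullet> \<beta> + \<epsilon> (int i) \<omega>') n"
      by (rule C_hat_rows) auto
    moreover have "C_lim (autocov M \<epsilon>) (?X \<omega>) = C_lim (autocov M \<epsilon>) (\<lambda>i. x i \<omega>)" by (rule C_lim_rows) auto
    ultimately show ?thesis by (simp only: \<Psi>_def fst_conv snd_conv)
  qed
  have regular: "AE \<omega> in M. regular_design M T F0 \<epsilon>0 (\<lambda>i. x i \<omega>) K h"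
    using design_i design_iii design_iv
  proof eventually_elim
    case (elim \<omega>)
    show ?case
    proof (intro regular_design.intro regular_design_axioms.intro)
      show "hannan_process M T F0 \<epsilon>0" by (rule hannan_process_axioms)
    qed (use elim assms(23-26) in blast)+
  qed
  let ?g = "\<lambda>n \<omega>'. ennreal (cmod (complex_of_real (C_hat K (h n) (\<lambda>i. x i \<omega>') (\<lambda>i. Y i \<omega>') n $ j $ l)
              - C_mat (spectral_density (autocov M \<epsilon>)) (FX \<omega>') $ j $ l))"
  \<comment> \<open>Almost surely the limit built from \<open>FX\<close> may be exchanged for the
    one built from the autocovariances of the design.\<close>
  have g: "AE \<omega> in M. ?g n \<omega> = \<Psi> n (?X \<omega>, ?E \<omega>)" for n
    using regular spectral
  proof eventually_elim
    case (elim \<omega>)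
    have "C_mat (spectral_density (autocov M \<epsilon>)) (FX \<omega>) $ j $ l = complex_of_real (C_lim (autocov M \<epsilon>) (\<lambda>i. x i \<omega>) $ j $ l)"
      using regular_design.C_mat_eq_C_lim[OF elim] unfolding \<epsilon>_def .
    moreover have "C_hat K (h n) (\<lambda>i. x i \<omega>) (\<lambda>i. Y i \<omega>) n = C_hat K (h n) (\<lambda>i. x i \<omega>) (\<lambda>i. x i \<omega> \<bullet> \<beta> + \<epsilon> (int i) \<omega>) n"
      by (rule C_hat_rows) (simp_all add: assms(17))
    ultimately show ?case unfolding rows by (simp only: of_real_diff[symmetric] norm_of_real)
  qed
  have "AE \<omega> in M. nn_cond_exp (completion M) (generated_algebra M {1..} x) (?g n) \<omega> = (\<integral>\<^sup>+\<omega>'. \<Psi> n (?X \<omega>, ?E \<omega>') \<partial>M)" for n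
  proof (rule nn_cond_exp_independent[OF _ _ assms(16) \<Psi>m g])
    show "x i \<in> borel_measurable M" if "i \<in> {1..}" for i using assms(15) that by simp
    show "\<epsilon> i \<in> borel_measurable M" for i unfolding \<epsilon>_def by (rule sq_integrable_measurable[OF sq_integrable_\<epsilon>])
  qed
  \<comment> \<open>One null set for all \<open>n\<close>, so that the limit can be taken at a fixed
    design.\<close>
  then have "AE \<omega> in M. \<forall>n. nn_cond_exp (completion M) (generated_algebra M {1..} x) (?g n) \<omega> = (\<integral>\<^sup>+\<omega>'. \<Psi> n (?X \<omega>, ?E \<omega>') \<partial>M)"
    by (simp only: AE_all_countable) blast
  with regular show "AE \<omega> in M. (\<lambda>n. nn_cond_exp (completion M) (generated_algebra M {1..} x) (?g n) \<omega>) \<longlonglongrightarrow> 0"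
  proof eventually_elim
    case (elim \<omega>)
    have "(\<lambda>n. \<integral>\<^sup>+\<omega>'. \<Psi> n (?X \<omega>, ?E \<omega>') \<partial>M) \<longlonglongrightarrow> 0"
      using regular_design.C_hat_consistent[OF elim(1), of \<beta> j l] unfolding rows unfolding \<epsilon>_def .
    then show ?case using elim(2) by simp
  qed
qed

end
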